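(* Let $\mathscr{G}=(\mathscr{V},\mathscr{E})$ be a $k$-sparse graph (for some $k\ge 0$) and let $q:\mathscr{V}\to[0,\infty)$. Then: (a) For all $0<\varepsilon\le 1$, $$(1-\varepsilon)(\deg+q)-\frac{k}{2}\Big(\frac1\varepsilon-\varepsilon\Big)\ \le\ \Delta+q\ \le\ (1+\varepsilon)(\deg+q)+\frac{k}{2}\Big(\frac1\varepsilon-\varepsilon\Big)\quad\text{on } C_c(\mathscr{V}).$$ (b) $\mathcal{D}\big((\Delta+q)^{1/2}\big)=\mathcal{D}\big((\deg+q)^{1/2}\big)$. (c) The operator $\Delta+q$ has purely discrete spectrum if and only if $\liminf_{|x|\to\infty}(\deg+q)(x)=\infty$. In this case, $$\liminf_{n\to\infty}\frac{\lambda_n(\Delta+q)}{\lambda_n(\deg+q)}=1 .$$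
   Context: A graph $\mathscr{G}=(\mathscr{V},\mathscr{E})$ consists of a countable vertex set $\mathscr{V}$ and a symmetric function $\mathscr{E}:\mathscr{V}\times\mathscr{V}\to\{0,1\}$ with zero diagonal; $x\sim y$ means $\mathscr{E}(x,y)=1$. Graphs are locally finite: every vertex has finitely many neighbors; $\deg(x)$ is the number of neighbors of $x$. For finite $\mathscr{W}\subseteq\mathscr{V}$, $|\mathscr{E}_{\mathscr{W}}|:=\frac12|\{(x,y)\in\mathscr{W}\times\mathscr{W}: x\sim y\}|$ is the number of non-oriented edges of the subgraph induced on $\mathscr{W}$. The graph is $k$-sparse if $2|\mathscr{E}_{\mathscr{W}}|\le k|\mathscr{W}|$ for every finite $\mathscr{W}\subseteq\mathscr{V}$. $\ell^2(\mathscr{V})$ is the complex Hilbert space of square-summable functions $\mathscr{V}\to\mathbb{C}$; $C_c(\mathscr{V})$ is the set of finitely supported functions $\mathscr{V}\to\mathbb{R}$. A real function $g$ on $\mathscr{V}$ also denotes the selfadjoint multiplication operator by $g$ on its maximal domain $\{\varphi\in\ell^2(\mathscr V): g\varphi\in\ell^2(\mathscr V)\}$. For $q\ge0$, $\Delta+q$ is the operator $(\Delta+q)\varphi(v)=\sum_{w\sim v}(\varphi(v)-\varphi(w))+q(v)\varphi(v)$ with domain the set of all $\varphi\in\ell^2(\mathscr{V})$ for which the right-hand side is in $\ell^2(\mathscr{V})$; it is non-negative, selfadjoint, and essentially selfadjoint on the finitely supported functions. $T_1\le T_2$ on $\mathcal{D}_0$ means $\langle T_1f,f\rangle\le\langle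 T_2f,f\rangle$ for all $f\in\mathcal{D}_0$. $\liminf_{|x|\to\infty}g(x):=\sup_{\mathscr{W}\subset\mathscr{V}\text{ finite}}\inf_{x\in\mathscr{V}\setminus\mathscr{W}}g(x)$. For a selfadjoint operator $T$ bounded from below, $\lambda_n(T)$, $n\ge0$, are the eigenvalues below the essential spectrum in increasing order counted with multiplicity. The asymptotic statement as $n\to\infty$ is understood for infinite $\mathscr{V}$. *)

theory Defs
  imports "HOL-Analysis.Analysis" "HOL-Library.Function_Algebras" "HOL-Library.Complex_Order"
begin

section \<open>Graphs\<close>

text \<open>The vertex set is the type \<open>'v\<close>, which is of class \<open>countable\<close>; \<open>E x y\<close> means \<open>x \<sim> y\<close>.\<close>

definition locally_finite_graph :: "('v \<Rightarrow> 'v \<Rightarrow> bool) \<Rightarrow> bool" where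
  "locally_finite_graph E \<longleftrightarrow> symp E \<and> irreflp E \<and> (\<forall>x. finite {y. E x y})"

definition deg :: "('v \<Rightarrow> 'v \<Rightarrow> bool) \<Rightarrow> 'v \<Rightarrow> real" where
  "deg E x = real (card {y. E x y})"

definition num_edges :: "('v \<Rightarrow> 'v \<Rightarrow> bool) \<Rightarrow> 'v set \<Rightarrow> real" where
  "num_edges E W = real (card {(x, y). x \<in> W \<and> y \<in> W \<and> E x y}) / 2"

definition k_sparse :: "real \<Rightarrow> ('v \<Rightarrow> 'v \<Rightarrow> bool) \<Rightarrow> bool" where
  "k_sparse k E \<longleftrightarrow> (\<forall>W. finite W \<longrightarrow> 2 * num_edges E W \<le> k * real (card W))"

definition liminf_at_infinity :: "('v \<Rightarrow> real) \<Rightarrow> ereal" where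
  "liminf_at_infinity g = (SUP W\<in>{W. finite W}. INF x\<in>UNIV - W. ereal (g x))"


section \<open>The Hilbert space of square-summable functions\<close>

definition l2 :: "('v \<Rightarrow> complex) set" where
  "l2 = {\<phi>. (\<lambda>v. (cmod (\<phi> v))\<^sup>2) summable_on UNIV}"

definition l2_inner :: "('v \<Rightarrow> complex) \<Rightarrow> ('v \<Rightarrow> complex) \<Rightarrow> complex" where
  "l2_inner \<phi> \<psi> = (\<Sum>\<^sub>\<infinity>v. \<phi> v * cnj (\<psi> v))"

definition l2_norm :: "('v \<Rightarrow> complex) \<Rightarrow> real" where
  "l2_norm \<phi> = sqrt (\<Sum>\<^sub>\<infinity>v. (cmod (\<phi> v))\<^sup>2)"

text \<open>The real-valued finitely supported functions, embedded into the complex-valued ones.\<close>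

definition Cc :: "('v \<Rightarrow> complex) set" where
  "Cc = {\<phi>. finite {v. \<phi> v \<noteq> 0} \<and> (\<forall>v. \<phi> v \<in> \<real>)}"

definition cscale :: "complex \<Rightarrow> ('v \<Rightarrow> complex) \<Rightarrow> 'v \<Rightarrow> complex" where
  "cscale c \<phi> = (\<lambda>v. c * \<phi> v)"

interpretation cfun: vector_space cscale
  by unfold_locales (auto simp: cscale_def fun_eq_iff algebra_simps)


section \<open>Unbounded operators\<close>

text \<open>
  An unbounded operator is represented by its graph, so its domain is \<^const>\<open>Domain\<close>, the
  product of operators is relational composition, and equality includes equality of domains.
\<close>

type_synonym 'v operator = "(('v \<Rightarrow> complex) \<times> ('v \<Rightarrow> complex)) set"

definition mult_op :: "('v \<Rightarrow> real) \<Rightarrow> 'v operator" where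
  "mult_op g = {(\<phi>, \<psi>). \<phi> \<in> l2 \<and> \<psi> \<in> l2 \<and> (\<forall>v. \<psi> v = complex_of_real (g v) * \<phi> v)}"

definition schroedinger_op :: "('v \<Rightarrow> 'v \<Rightarrow> bool) \<Rightarrow> ('v \<Rightarrow> real) \<Rightarrow> 'v operator" where
  "schroedinger_op E q = {(\<phi>, \<psi>). \<phi> \<in> l2 \<and> \<psi> \<in> l2 \<and>
     (\<forall>v. \<psi> v = (\<Sum>w | E v w. \<phi> v - \<phi> w) + complex_of_real (q v) * \<phi> v)}"

text \<open>
  The order is the one of \<^theory>\<open>HOL-Library.Complex_Order\<close>; for complex numbers \<open>z \<le> w\<close>
  includes the equality of the imaginary parts.
\<close>

definition op_le_on :: "('v \<Rightarrow> complex) set \<Rightarrow> 'v operator \<Rightarrow> 'v operator \<Rightarrow> bool" where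
  "op_le_on D S T \<longleftrightarrow>
     (\<forall>f\<in>D. \<exists>g h. (f, g) \<in> S \<and> (f, h) \<in> T \<and> l2_inner g f \<le> l2_inner h f)"

definition nonneg_op :: "'v operator \<Rightarrow> bool" where
  "nonneg_op T \<longleftrightarrow> (\<forall>(\<phi>, \<psi>)\<in>T. 0 \<le> l2_inner \<psi> \<phi>)"

definition densely_defined :: "'v operator \<Rightarrow> bool" where
  "densely_defined T \<longleftrightarrow> (\<forall>\<phi>\<in>l2. \<forall>e>0. \<exists>\<psi>\<in>Domain T. l2_norm (\<phi> - \<psi>) < e)"

definition adjoint_op :: "'v operator \<Rightarrow> 'v operator" where
  "adjoint_op T = {(\<psi>, \<eta>). \<psi> \<in> l2 \<and> \<eta> \<in> l2 \<and>
     (\<forall>(\<phi>, \<xi>)\<in>T. l2_inner \<xi> \<psi> = l2_inner \<phi> \<eta>)}"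

text \<open>
  Linearity and single-valuedness need not be required below: an adjoint is a linear relation,
  and the adjoint of a densely defined relation is single-valued.
\<close>

definition selfadjoint_op :: "'v operator \<Rightarrow> bool" where
  "selfadjoint_op T \<longleftrightarrow> densely_defined T \<and> adjoint_op T = T"

text \<open>
  A non-negative selfadjoint operator has exactly one non-negative selfadjoint square root, so
  the choice below is no real choice.
\<close>

definition sqrt_op :: "'v operator \<Rightarrow> 'v operator" where
  "sqrt_op T = (SOME S. selfadjoint_op S \<and> nonneg_op S \<and> S O S = T)"


section \<open>Spectrum and eigenvalues\<close>

definition shift_op :: "'v operator \<Rightarrow> complex \<Rightarrow> 'v operator" where
  "shift_op T z = {(\<phi>, \<psi> - cscale z \<phi>) | \<phi> \<psi>. (\<phi>, \<psi>) \<in> T}"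

definition resolvent_set :: "'v operator \<Rightarrow> complex set" where
  "resolvent_set T = {z. (\<forall>\<eta>\<in>l2. \<exists>!\<phi>. (\<phi>, \<eta>) \<in> shift_op T z) \<and>
     (\<exists>C. \<forall>(\<phi>, \<eta>)\<in>shift_op T z. l2_norm \<phi> \<le> C * l2_norm \<eta>)}"

definition spectrum :: "'v operator \<Rightarrow> complex set" where
  "spectrum T = - resolvent_set T"

definition eigenspace :: "'v operator \<Rightarrow> complex \<Rightarrow> ('v \<Rightarrow> complex) set" where
  "eigenspace T z = {\<phi>. (\<phi>, cscale z \<phi>) \<in> T}"

definition is_eigenvalue :: "'v operator \<Rightarrow> complex \<Rightarrow> bool" where
  "is_eigenvalue T z \<longleftrightarrow> (\<exists>\<phi>\<in>eigenspace T z. \<phi> \<noteq> 0)"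

definition discrete_spectrum :: "'v operator \<Rightarrow> complex set" where
  "discrete_spectrum T = {z. z isolated_in spectrum T \<and> is_eigenvalue T z \<and>
     (\<exists>B. finite B \<and> eigenspace T z \<subseteq> cfun.span B)}"

definition essential_spectrum :: "'v operator \<Rightarrow> complex set" where
  "essential_spectrum T = spectrum T - discrete_spectrum T"

definition purely_discrete_spectrum :: "'v operator \<Rightarrow> bool" where
  "purely_discrete_spectrum T \<longleftrightarrow> essential_spectrum T = {}"

definition eigenvalues_below_ess :: "'v operator \<Rightarrow> real set" where
  "eigenvalues_below_ess T =
     {x. is_eigenvalue T (complex_of_real x) \<and> (\<forall>z\<in>essential_spectrum T. x < Re z)}"

definition multiplicity_op :: "'v operator \<Rightarrow> real \<Rightarrow> nat" where
  "multiplicity_op T x = cfun.dim (eigenspace T (complex_of_real x))"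

text \<open>
  The eigenvalue of index \<open>n\<close> (starting from 0) is the smallest one below the essential spectrum
  such that more than \<open>n\<close> eigenvalues, counted with multiplicity, do not exceed it. For
  selfadjoint \<open>T\<close> bounded from below the sum has finitely many summands, and the dimensions are
  finite. The value is meaningful only if there are more than \<open>n\<close> such eigenvalues.
\<close>

definition nth_eigenvalue :: "'v operator \<Rightarrow> nat \<Rightarrow> real" where
  "nth_eigenvalue T n = (LEAST x. x \<in> eigenvalues_below_ess T \<and>
     n < (\<Sum>y | y \<in> eigenvalues_below_ess T \<and> y \<le> x. multiplicity_op T y))"

end

theory Submission imports Defs begin

text \<open>
  Part (a) rests on the bound \<open>a b \<le> \<epsilon> (a\<^sup>2 + b\<^sup>2) / 2 + (1 / \<epsilon> - \<epsilon>) / 2 \<cdot> min a\<^sup>2 b\<^sup>2\<close> on each edge,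
  because sparseness controls the sum of the minima over the edges by \<open>k\<close> times the sum over the
  vertices. A solution \<open>u\<close> of \<open>(\<Delta> + q + 1) u = 0\<close> in the Hilbert space vanishes, since \<open>\<bar>u\<bar>\<close> attains
  its maximum; hence the finitely supported functions are a core of the operator and of its square
  root, and (b) follows from the equivalence of the two forms on this core. For (c), the resolvent
  embeds the form domain compactly if the weight tends to infinity; conversely, if the spectrum is
  purely discrete, the form is large on the complement of finitely many eigenvectors. Counting
  dimensions then compares the eigenvalue counting function with the number of vertices of small
  weight, in both directions, and (a) for small \<open>\<epsilon>\<close> gives the asymptotics.
\<close>

section \<open>The real Hilbert space underlying the square-summable functions\<close>

text \<open>Spectral resolutions are avoided: spectral questions are moved to the bounded operator
  \<open>B\<close>, the inverse of \<Delta> + q + 1, under which a spectral value s becomes 1 / (1 +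
  s). Since 0 \<le> B \<le> 1, both B and 1 - B have bounded square roots C and D, and D C^(-1) is a
  square root of \<Delta> + q. As \<open>sqrt_op\<close> is a choice, the domain in (b) is computed
  for an arbitrary selfadjoint square root and turns out to depend on the form alone. The obstacle
  in (c) is that a spectral gap is only a lower bound for the norms of A x - \<mu> x, whereas
  eigenvalue counting needs inequalities between quadratic forms; the lemmas on symmetric bounded
  operators bridge this. Dimension counts with homogeneous linear systems take the place of a
  min-max principle. Multiplication by a function is the Schroedinger operator of the graph without
  edges, so results on square roots, spectra and eigenvalues are proved once and applied to both
  operators. The eigenvalue ratios are shown to converge to 1, which is more than the lower limit in
  the claim.\<close>

lemma l2_mult_summable: "\<phi> \<in> l2 \<Longrightarrow> \<psi> \<in> l2 \<Longrightarrow> (\<lambda>v. \<phi> v * cnj (\<psi> v)) summable_on UNIV"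
  by (rule abs_summable_summable[OF abs_summable_product])
    (simp_all add: l2_def norm_mult power2_eq_square)

lemma l2_inner_summable:
  assumes "\<phi> \<in> l2" "\<psi> \<in> l2" shows "(\<lambda>v. \<phi> v \<bullet> \<psi> v) summable_on UNIV"
proof -
  have "(\<lambda>v. Re (\<phi> v * cnj (\<psi> v))) summable_on UNIV"
    using l2_mult_summable[OF assms]
    by (rule summable_on_bounded_linear[OF bounded_linear_Re, unfolded o_def])
  then show ?thesis by (simp add: inner_complex_def)
qed

lemma l2_cscale: "\<phi> \<in> l2 \<Longrightarrow> cscale c \<phi> \<in> l2"
  by (auto simp: l2_def cscale_def norm_mult power_mult_distrib intro: summable_on_cmult_right)

lemma l2_add:
  assumes "\<phi> \<in> l2" "\<psi> \<in> l2" shows "\<phi> + \<psi> \<in> l2"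
proof -
  have "(cmod (\<phi> v + \<psi> v))\<^sup>2 = (cmod (\<phi> v))\<^sup>2 + (cmod (\<psi> v))\<^sup>2 + 2 * (\<phi> v \<bullet> \<psi> v)" for v
    by (simp add: power2_norm_eq_inner inner_add inner_commute)
  moreover have "(\<lambda>v. (cmod (\<phi> v))\<^sup>2 + (cmod (\<psi> v))\<^sup>2 + 2 * (\<phi> v \<bullet> \<psi> v)) summable_on UNIV"
    using assms l2_inner_summable[OF assms]
    by (intro summable_on_add summable_on_cmult_right) (auto simp: l2_def)
  ultimately show ?thesis by (simp add: l2_def)
qed

lemma l2_zero: "(\<lambda>_. 0) \<in> l2"
  by (simp add: l2_def)

lemma l2_uminus: "\<phi> \<in> l2 \<Longrightarrow> - \<phi> \<in> l2"
  by (simp add: l2_def)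

lemma l2_diff: "\<phi> \<in> l2 \<Longrightarrow> \<psi> \<in> l2 \<Longrightarrow> \<phi> - \<psi> \<in> l2"
  using l2_add[OF _ l2_uminus, of \<phi> \<psi>] by simp

lemma l2_finite_support:
  assumes "finite {v. \<phi> v \<noteq> 0}" shows "\<phi> \<in> l2"
proof -
  have "(\<lambda>v. (cmod (\<phi> v))\<^sup>2) summable_on {v. \<phi> v \<noteq> 0}"
    using assms by (rule summable_on_finite)
  then show ?thesis
    unfolding l2_def mem_Collect_eq by (rule summable_on_cong_neutral[THEN iffD1, rotated -1]) auto
qed

text \<open>The inner product is the real part of \<^const>\<open>l2_inner\<close>, so that the library of real inner product
  spaces applies; complex linearity is recovered from the operator \<open>cs \<i>\<close> below.\<close>

typedef 'v ell2 = "l2 :: ('v \<Rightarrow> complex) set" morphisms fn ell2_of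
  using l2_zero by blast

setup_lifting type_definition_ell2

instantiation ell2 :: (type) real_inner
begin
lift_definition zero_ell2 :: "'a ell2" is "\<lambda>_. 0" by (rule l2_zero)
lift_definition plus_ell2 :: "'a ell2 \<Rightarrow> 'a ell2 \<Rightarrow> 'a ell2" is "\<lambda>\<phi> \<psi>. \<phi> + \<psi>" by (rule l2_add)
lift_definition minus_ell2 :: "'a ell2 \<Rightarrow> 'a ell2 \<Rightarrow> 'a ell2" is "\<lambda>\<phi> \<psi>. \<phi> - \<psi>" by (rule l2_diff)
lift_definition uminus_ell2 :: "'a ell2 \<Rightarrow> 'a ell2" is "\<lambda>\<phi>. - \<phi>" by (rule l2_uminus)
lift_definition scaleR_ell2 :: "real \<Rightarrow> 'a ell2 \<Rightarrow> 'a ell2" is "\<lambda>r. cscale (complex_of_real r)"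
  by (rule l2_cscale)
lift_definition inner_ell2 :: "'a ell2 \<Rightarrow> 'a ell2 \<Rightarrow> real" is "\<lambda>\<phi> \<psi>. \<Sum>\<^sub>\<infinity>v. \<phi> v \<bullet> \<psi> v" .
definition norm_ell2 :: "'a ell2 \<Rightarrow> real" where "norm_ell2 x = sqrt (x \<bullet> x)"
definition dist_ell2 :: "'a ell2 \<Rightarrow> 'a ell2 \<Rightarrow> real" where "dist_ell2 x y = norm (x - y)"
definition sgn_ell2 :: "'a ell2 \<Rightarrow> 'a ell2" where "sgn_ell2 x = inverse (norm x) *\<^sub>R x"
definition uniformity_ell2 :: "('a ell2 \<times> 'a ell2) filter"
  where "uniformity_ell2 = (INF e\<in>{0<..}. principal {(x, y). dist x y < e})"
definition open_ell2 :: "'a ell2 set \<Rightarrow> bool"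
  where "open_ell2 U \<longleftrightarrow> (\<forall>x\<in>U. eventually (\<lambda>(x', y). x' = x \<longrightarrow> y \<in> U) uniformity)"
instance
proof
  fix x y z :: "'a ell2" and a b :: real
  show "x + y + z = x + (y + z)" by transfer (simp add: fun_eq_iff)
  show "x + y = y + x" by transfer (simp add: fun_eq_iff)
  show "0 + x = x" by transfer (simp add: fun_eq_iff)
  show "- x + x = 0" by transfer (simp add: fun_eq_iff)
  show "x - y = x + - y" by transfer (simp add: fun_eq_iff)
  show "a *\<^sub>R (x + y) = a *\<^sub>R x + a *\<^sub>R y"
    by transfer (simp add: fun_eq_iff cscale_def algebra_simps)
  show "(a + b) *\<^sub>R x = a *\<^sub>R x + b *\<^sub>R x"
    by transfer (simp add: fun_eq_iff cscale_def algebra_simps)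
  show "a *\<^sub>R b *\<^sub>R x = (a * b) *\<^sub>R x" by transfer (simp add: fun_eq_iff cscale_def)
  show "1 *\<^sub>R x = x" by transfer (simp add: fun_eq_iff cscale_def)
  show "dist x y = norm (x - y)" by (rule dist_ell2_def)
  show "sgn x = inverse (norm x) *\<^sub>R x" by (rule sgn_ell2_def)
  show "uniformity = (INF e\<in>{0<..}. principal {(x, y :: 'a ell2). dist x y < e})"
    by (rule uniformity_ell2_def)
  show "open U \<longleftrightarrow> (\<forall>x\<in>U. eventually (\<lambda>(x', y). x' = x \<longrightarrow> y \<in> U) uniformity)" for U :: "'a ell2 set"
    by (rule open_ell2_def)
  show "x \<bullet> y = y \<bullet> x" by transfer (simp add: inner_commute)
  show "(x + y) \<bullet> z = x \<bullet> z + y \<bullet> z"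
    by transfer (simp add: inner_add_left infsum_add l2_inner_summable)
  show "a *\<^sub>R x \<bullet> y = a * (x \<bullet> y)"
  proof (transfer fixing: a)
    fix x y :: "'a \<Rightarrow> complex"
    have "cscale (complex_of_real a) x v \<bullet> y v = a * (x v \<bullet> y v)" for v
      by (simp add: cscale_def inner_complex_def algebra_simps)
    then show "(\<Sum>\<^sub>\<infinity>v. cscale (complex_of_real a) x v \<bullet> y v) = a * (\<Sum>\<^sub>\<infinity>v. x v \<bullet> y v)"
      by (simp add: infsum_cmult_right')
  qed
  show "0 \<le> x \<bullet> x" by transfer (simp add: infsum_nonneg)
  show "x \<bullet> x = 0 \<longleftrightarrow> x = 0"
  proof transfer
    fix x :: "'a \<Rightarrow> complex" assume "x \<in> l2"
    then have s: "(\<lambda>v. x v \<bullet> x v) summable_on UNIV" by (simp add: l2_inner_summable)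
    show "(\<Sum>\<^sub>\<infinity>v. x v \<bullet> x v) = 0 \<longleftrightarrow> x = (\<lambda>_. 0)"
      using nonneg_infsum_le_0D[OF _ s] by (fastforce simp: fun_eq_iff)
  qed
  show "norm x = sqrt (x \<bullet> x)" by (rule norm_ell2_def)
qed
end

lemmas [simp] = zero_ell2.rep_eq
lemma fn_add [simp]: "fn (x + y) v = fn x v + fn y v" by (simp add: plus_ell2.rep_eq)
lemma fn_diff [simp]: "fn (x - y) v = fn x v - fn y v" by (simp add: minus_ell2.rep_eq)
lemma fn_uminus [simp]: "fn (- x) v = - fn x v" by (simp add: uminus_ell2.rep_eq)
lemma fn_scaleR [simp]: "fn (r *\<^sub>R x) v = r *\<^sub>R fn x v"
  by (simp add: scaleR_ell2.rep_eq cscale_def scaleR_conv_of_real)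
lemma fn_sum [simp]: "fn (\<Sum>i\<in>I. f i) v = (\<Sum>i\<in>I. fn (f i) v)"
  by (induction I rule: infinite_finite_induct) auto

lemma fn_in_l2 [simp]: "fn x \<in> l2"
  by (rule fn)

lemma fn_ell2_of [simp]: "\<phi> \<in> l2 \<Longrightarrow> fn (ell2_of \<phi>) = \<phi>"
  by (rule ell2_of_inverse)

lemma ell2_eqI: "(\<And>v. fn x v = fn y v) \<Longrightarrow> x = y"
  by (auto simp: fn_inject[symmetric])

lemma ell2_summable: "(\<lambda>v. (cmod (fn x v))\<^sup>2) summable_on UNIV"
  using fn_in_l2[of x] by (simp add: l2_def)

lemma ell2_norm_sq: "(norm x)\<^sup>2 = (\<Sum>\<^sub>\<infinity>v. (cmod (fn x v))\<^sup>2)"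
  by (simp add: power2_norm_eq_inner inner_ell2.rep_eq)

lemma l2_norm_fn [simp]: "l2_norm (fn x) = norm x"
  unfolding l2_norm_def ell2_norm_sq[symmetric] by simp

lemma sum_le_ell2_norm: "finite F \<Longrightarrow> (\<Sum>v\<in>F. (cmod (fn x v))\<^sup>2) \<le> (norm x)\<^sup>2"
  unfolding ell2_norm_sq by (rule finite_sum_le_infsum[OF ell2_summable]) auto

lemma cmod_fn_le: "cmod (fn x v) \<le> norm x"
  using sum_le_ell2_norm[of "{v}" x] by (simp add: power2_le_iff_abs_le)

lemma ell2_norm_le:
  assumes "\<And>F. finite F \<Longrightarrow> (\<Sum>v\<in>F. (cmod (fn x v))\<^sup>2) \<le> b\<^sup>2" "0 \<le> b" shows "norm x \<le> b"
proof -
  have "(norm x)\<^sup>2 \<le> b\<^sup>2"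
    unfolding ell2_norm_sq using assms(1) by (intro infsum_le_finite_sums ell2_summable) auto
  then show ?thesis using assms(2) by (simp add: power2_le_iff_abs_le)
qed

text \<open>Coordinates converge because evaluation at a vertex is a contraction; the Cauchy bounds
  for finite partial sums then pass to the limit, uniformly in the finite set.\<close>

instance ell2 :: (type) complete_space
proof
  fix X :: "nat \<Rightarrow> 'a ell2" assume X: "Cauchy X"
  have "Cauchy (\<lambda>n. fn (X n) v)" for v
    unfolding Cauchy_def
  proof (intro allI impI)
    fix e :: real assume "0 < e"
    with X obtain M where "\<forall>m\<ge>M. \<forall>n\<ge>M. dist (X m) (X n) < e" unfolding Cauchy_def by blast
    moreover have "dist (fn (X m) v) (fn (X n) v) \<le> dist (X m) (X n)" for m n
      using cmod_fn_le[of "X m - X n" v] by (simp add: dist_norm)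
    ultimately show "\<exists>M. \<forall>m\<ge>M. \<forall>n\<ge>M. dist (fn (X m) v) (fn (X n) v) < e"
      using le_less_trans by blast
  qed
  then have "\<forall>v. \<exists>l. (\<lambda>n. fn (X n) v) \<longlonglongrightarrow> l" by (simp add: Cauchy_convergent convergentD)
  then obtain f where f: "\<And>v. (\<lambda>n. fn (X n) v) \<longlonglongrightarrow> f v" by metis
  \<comment> \<open>The sum is finite, so the limit in \<open>m\<close> is taken term by term; the
    bound does not depend on \<open>F\<close>. It gives both membership of the limit in
    \<open>l2\<close> and convergence in norm.\<close>
  have tail: "(\<Sum>v\<in>F. (cmod (fn (X n) v - f v))\<^sup>2) \<le> e\<^sup>2"
    if F: "finite F" and M: "\<And>m. M \<le> m \<Longrightarrow> dist (X n) (X m) < e" for F n M e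
  proof (rule tendsto_upperbound)
    show "(\<lambda>m. \<Sum>v\<in>F. (cmod (fn (X n) v - fn (X m) v))\<^sup>2) \<longlonglongrightarrow> (\<Sum>v\<in>F. (cmod (fn (X n) v - f v))\<^sup>2)"
      by (intro tendsto_intros f)
    show "\<forall>\<^sub>F m in sequentially. (\<Sum>v\<in>F. (cmod (fn (X n) v - fn (X m) v))\<^sup>2) \<le> e\<^sup>2"
    proof (rule eventually_sequentiallyI)
      fix m assume "M \<le> m"
      then have "(norm (X n - X m))\<^sup>2 \<le> e\<^sup>2" using M[of m] by (intro power_mono) (auto simp: dist_norm)
      then show "(\<Sum>v\<in>F. (cmod (fn (X n) v - fn (X m) v))\<^sup>2) \<le> e\<^sup>2"
        using sum_le_ell2_norm[OF F, of "X n - X m"] by simp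
    qed
  qed simp
  have diff: "fn (X n) - f \<in> l2" if "\<And>m. M \<le> m \<Longrightarrow> dist (X n) (X m) < e" for n M e
    unfolding l2_def mem_Collect_eq
    by (rule nonneg_bdd_above_summable_on) (auto intro!: bdd_aboveI2[where M="e\<^sup>2"] tail that)
  obtain N where "\<And>m n. N \<le> m \<Longrightarrow> N \<le> n \<Longrightarrow> dist (X m) (X n) < 1"
    using X unfolding Cauchy_def by (meson zero_less_one)
  then have "fn (X N) - f \<in> l2" by (intro diff[of N N 1]) auto
  then have "fn (X N) - (fn (X N) - f) \<in> l2" by (rule l2_diff[OF fn_in_l2])
  moreover have "fn (X N) - (fn (X N) - f) = f" by (simp add: fun_eq_iff)
  ultimately have fl2: "f \<in> l2" by simp
  have "X \<longlonglongrightarrow> ell2_of f"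
  proof (rule metric_LIMSEQ_I)
    fix e :: real assume e: "0 < e"
    then obtain M where M: "\<And>m n. M \<le> m \<Longrightarrow> M \<le> n \<Longrightarrow> dist (X m) (X n) < e / 2"
      using X unfolding Cauchy_def by (meson half_gt_zero)
    have "dist (X n) (ell2_of f) < e" if "M \<le> n" for n
    proof -
      have "norm (X n - ell2_of f) \<le> e / 2"
        using e fl2 M[OF that] by (intro ell2_norm_le) (auto intro!: tail)
      then show ?thesis using e by (simp add: dist_norm)
    qed
    then show "\<exists>M. \<forall>n\<ge>M. dist (X n) (ell2_of f) < e" by blast
  qed
  then show "convergent X" by (rule convergentI)
qed

instance ell2 :: (type) banach ..

lemma bounded_linear_fn: "bounded_linear (\<lambda>x. fn x v)"
  by (rule bounded_linear_intro[where K=1]) (use cmod_fn_le[of _ v] in auto)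

lemmas tendsto_fn = bounded_linear.tendsto[OF bounded_linear_fn]

section \<open>Complex structure on the underlying real space\<close>

lift_definition cs :: "complex \<Rightarrow> 'v ell2 \<Rightarrow> 'v ell2" is cscale by (rule l2_cscale)

lemma fn_cs [simp]: "fn (cs c x) v = c * fn x v"
  by (simp add: cs.rep_eq cscale_def)

text \<open>An identity for the complex inner product thus follows from its real version for
  \<open>y\<close> and for \<open>cs \<i> y\<close>.\<close>

lemma l2_inner_fn: "l2_inner (fn x) (fn y) = Complex (x \<bullet> y) (x \<bullet> cs \<i> y)"
proof -
  have s: "(\<lambda>v. fn x v * cnj (fn y v)) summable_on UNIV" by (simp add: l2_mult_summable)
  have "Re (l2_inner (fn x) (fn y)) = x \<bullet> y"
    unfolding l2_inner_def inner_ell2.rep_eq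
    by (subst infsum_Re[OF s, symmetric])
      (simp add: inner_complex_def)
  moreover have "Im (l2_inner (fn x) (fn y)) = x \<bullet> cs \<i> y"
    unfolding l2_inner_def inner_ell2.rep_eq
    by (subst infsum_Im[OF s, symmetric])
      (simp add: inner_complex_def algebra_simps)
  ultimately show ?thesis by (simp add: complex_eq_iff)
qed

lemma cs_add: "cs c (x + y) = cs c x + cs c y" by (rule ell2_eqI) (simp add: algebra_simps)
lemma cs_diff: "cs c (x - y) = cs c x - cs c y" by (rule ell2_eqI) (simp add: algebra_simps)
lemma cs_scaleR: "cs c (r *\<^sub>R x) = r *\<^sub>R cs c x" by (rule ell2_eqI) simp
lemma cs_of_real: "cs (complex_of_real r) x = r *\<^sub>R x" by (rule ell2_eqI) (simp add: scaleR_conv_of_real)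
lemma cs_complex: "cs c x = Re c *\<^sub>R x + Im c *\<^sub>R cs \<i> x"
  by (rule ell2_eqI) (simp add: complex_eq_iff)

lemma norm_cs [simp]: "norm (cs c x) = cmod c * norm x"
proof (rule power2_eq_imp_eq)
  have "(norm (cs c x))\<^sup>2 = (\<Sum>\<^sub>\<infinity>v. (cmod c)\<^sup>2 * (cmod (fn x v))\<^sup>2)"
    by (simp only: ell2_norm_sq fn_cs norm_mult power_mult_distrib)
  also have "\<dots> = (cmod c)\<^sup>2 * (norm x)\<^sup>2" unfolding ell2_norm_sq by (rule infsum_cmult_right')
  finally show "(norm (cs c x))\<^sup>2 = (cmod c * norm x)\<^sup>2" by (simp only: power_mult_distrib)
qed auto

lemma inner_cs_left: "cs c x \<bullet> y = x \<bullet> cs (cnj c) y"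
  by (simp add: inner_ell2.rep_eq inner_complex_def algebra_simps)

definition delta :: "'v \<Rightarrow> 'v \<Rightarrow> complex" where "delta v w = (if w = v then 1 else 0)"

lemma delta_l2: "cscale c (delta v) \<in> l2"
  by (rule l2_finite_support[OF finite_subset[of _ "{v}"]]) (auto simp: cscale_def delta_def)

lemma inner_finite_support:
  assumes "finite A" "\<And>v. v \<notin> A \<Longrightarrow> fn x v = 0"
  shows "x \<bullet> y = (\<Sum>v\<in>A. fn x v \<bullet> fn y v)" "y \<bullet> x = (\<Sum>v\<in>A. fn y v \<bullet> fn x v)"
proof -
  have "x \<bullet> y = (\<Sum>\<^sub>\<infinity>v\<in>A. fn x v \<bullet> fn y v)"
    unfolding inner_ell2.rep_eq by (rule infsum_cong_neutral) (use assms in auto)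
  then show "x \<bullet> y = (\<Sum>v\<in>A. fn x v \<bullet> fn y v)" using assms by simp
  then show "y \<bullet> x = (\<Sum>v\<in>A. fn y v \<bullet> fn x v)" by (simp add: inner_commute)
qed

section \<open>Symmetric bounded operators on real Hilbert spaces\<close>

text \<open>For \<open>0 < c\<close> evaluate at the minimum \<open>t = - b / c\<close>. For
  \<open>c = 0\<close> the function is affine and would take the value -1 if \<open>b\<close> were
  nonzero.\<close>

lemma discriminant_le:
  fixes a b c :: real
  assumes nn: "\<And>t. 0 \<le> a + 2 * t * b + t\<^sup>2 * c" and "0 \<le> c"
  shows "b\<^sup>2 \<le> a * c"
proof (cases "c = 0")
  case True
  have "b = 0"
  proof (rule ccontr)
    assume "b \<noteq> 0"
    then show False using nn[of "- (a + 1) / (2 * b)"] True by (simp add: field_simps)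
  qed
  then show ?thesis using True by simp
next
  case False
  then have "0 < c" using \<open>0 \<le> c\<close> by simp
  then show ?thesis using nn[of "- b / c"] by (simp add: field_simps power2_eq_square)
qed

text \<open>A minimising sequence is Cauchy by the parallelogram law. As \<open>S\<close> need not
  be closed, the nearest point lies in its closure; this is the standard tool below for density: if
  orthogonality to \<open>S\<close> forces \<open>x - c = 0\<close>, then \<open>x\<close> is in the
  closure.\<close>

lemma projection_exists:
  fixes x :: "'h::{real_inner,banach}"
  assumes "subspace S"
  obtains c where "c \<in> closure S" "\<And>s. s \<in> S \<Longrightarrow> (x - c) \<bullet> s = 0"
proof -
  define D where "D = (INF c\<in>S. (norm (x - c))\<^sup>2)"
  have S: "S \<noteq> {}" and bdd: "bdd_below ((\<lambda>c. (norm (x - c))\<^sup>2) ` S)"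
    using assms by (auto simp: subspace_def intro!: bdd_belowI2[where m=0])
  have D_le: "D \<le> (norm (x - c))\<^sup>2" if "c \<in> S" for c
    unfolding D_def using bdd that by (rule cINF_lower)
  have "\<exists>c\<in>S. (norm (x - c))\<^sup>2 < D + 1 / real (Suc n)" for n
    using cINF_less_iff[OF S bdd, of "D + 1 / real (Suc n)"] unfolding D_def by auto
  then obtain c where c: "\<And>n. c n \<in> S" "\<And>n. (norm (x - c n))\<^sup>2 < D + 1 / real (Suc n)" by metis
  have par: "(norm (c m - c n))\<^sup>2 \<le> 2 * (1 / real (Suc m) + 1 / real (Suc n))" for m n
  proof -
    have "(1/2) *\<^sub>R (c m + c n) \<in> S" using assms c(1) by (simp add: subspace_def)
    then have "D \<le> (norm (x - (1/2) *\<^sub>R (c m + c n)))\<^sup>2" by (rule D_le)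
    moreover have "(norm (c m - c n))\<^sup>2 + 4 * (norm (x - (1/2) *\<^sub>R (c m + c n)))\<^sup>2
        = 2 * (norm (x - c m))\<^sup>2 + 2 * (norm (x - c n))\<^sup>2"
      by (simp add: power2_norm_eq_inner algebra_simps inner_commute)
    ultimately show ?thesis using c(2)[of m] c(2)[of n] by argo
  qed
  have "Cauchy c"
    unfolding Cauchy_def
  proof (intro allI impI)
    fix e :: real assume "0 < e"
    then obtain N where N: "1 / real (Suc N) < e\<^sup>2 / 4"
      using reals_Archimedean[of "e\<^sup>2 / 4"] by (auto simp: inverse_eq_divide)
    have "dist (c m) (c n) < e" if "N \<le> m" "N \<le> n" for m n
    proof -
      have "1 / real (Suc m) \<le> 1 / real (Suc N)" "1 / real (Suc n) \<le> 1 / real (Suc N)"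
        using that by (simp_all add: frac_le)
      then have "(norm (c m - c n))\<^sup>2 < e\<^sup>2" using par[of m n] N by argo
      then show ?thesis using \<open>0 < e\<close> by (simp add: dist_norm power2_less_imp_less)
    qed
    then show "\<exists>M. \<forall>m\<ge>M. \<forall>n\<ge>M. dist (c m) (c n) < e" by blast
  qed
  then obtain l where l: "c \<longlonglongrightarrow> l" using Cauchy_convergent convergentD by blast
  have "(x - l) \<bullet> s = 0" if s: "s \<in> S" for s
  proof -
    have "(norm (x - l))\<^sup>2 \<le> D"
    proof (rule LIMSEQ_le)
      show "(\<lambda>n. (norm (x - c n))\<^sup>2) \<longlonglongrightarrow> (norm (x - l))\<^sup>2" by (intro tendsto_intros l)
      show "(\<lambda>n. D + 1 / real (Suc n)) \<longlonglongrightarrow> D"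
        using LIMSEQ_inverse_real_of_nat_add[of D] by (simp only: inverse_eq_divide)
      show "\<exists>N. \<forall>n\<ge>N. (norm (x - c n))\<^sup>2 \<le> D + 1 / real (Suc n)" using c(2) less_imp_le by blast
    qed
    moreover have "D \<le> (norm (x - l - t *\<^sub>R s))\<^sup>2" for t
    proof (rule LIMSEQ_le_const)
      show "(\<lambda>n. (norm (x - c n - t *\<^sub>R s))\<^sup>2) \<longlonglongrightarrow> (norm (x - l - t *\<^sub>R s))\<^sup>2"
        by (intro tendsto_intros l)
      have "c n + t *\<^sub>R s \<in> S" for n using assms s c(1) by (simp add: subspace_def)
      then show "\<exists>N. \<forall>n\<ge>N. D \<le> (norm (x - c n - t *\<^sub>R s))\<^sup>2" using D_le by (auto simp: diff_diff_add)
    qed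
    ultimately have "(norm (x - l))\<^sup>2 \<le> (norm (x - l - t *\<^sub>R s))\<^sup>2" for t using order_trans by blast
    then have "0 \<le> 0 + 2 * t * (- ((x - l) \<bullet> s)) + t\<^sup>2 * (s \<bullet> s)" for t
      unfolding power2_norm_eq_inner by (simp add: inner_diff inner_commute power2_eq_square algebra_simps)
    \<comment> \<open>The constant coefficient is 0, so the discriminant bound says that the linear
      coefficient vanishes.\<close>
    from discriminant_le[OF this] show ?thesis by simp
  qed
  then show ?thesis using that[of l] l c(1) closure_sequential by blast
qed

text \<open>The subspace \<open>K\<close> is a parameter because the results are applied both to the
  whole space and to the orthogonal complement of the eigenspaces up to a given level.\<close>

locale symmetric_on =
  fixes K :: "'h::{real_inner,banach} set" and A :: "'h \<Rightarrow> 'h"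
  assumes subspace: "subspace K" and blin: "bounded_linear A"
    and invariant: "x \<in> K \<Longrightarrow> A x \<in> K"
    and symmetric: "x \<in> K \<Longrightarrow> y \<in> K \<Longrightarrow> A x \<bullet> y = x \<bullet> A y"
begin

sublocale bounded_linear A by (rule blin)

lemma shift: "symmetric_on K (\<lambda>x. A x - \<mu> *\<^sub>R x)"
proof (rule symmetric_on.intro)
  show "bounded_linear (\<lambda>x. A x - \<mu> *\<^sub>R x)"
    by (intro bounded_linear_sub blin bounded_linear_scaleR_right)
qed (auto simp: subspace subspace_diff subspace_mul invariant symmetric inner_diff)

lemma reflect: "symmetric_on K (\<lambda>x. \<mu> *\<^sub>R x - A x)"
proof (rule symmetric_on.intro)
  show "bounded_linear (\<lambda>x. \<mu> *\<^sub>R x - A x)"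
    by (intro bounded_linear_sub blin bounded_linear_scaleR_right)
qed (auto simp: subspace subspace_diff subspace_mul invariant symmetric inner_diff)

lemma square: "symmetric_on K (\<lambda>x. A (A x))"
  by (rule symmetric_on.intro) (auto simp: subspace invariant symmetric intro: bounded_linear_compose[OF blin blin])

lemma positive_cauchy_schwarz:
  assumes "\<And>x. x \<in> K \<Longrightarrow> 0 \<le> A x \<bullet> x" "x \<in> K" "y \<in> K"
  shows "(A x \<bullet> y)\<^sup>2 \<le> (A x \<bullet> x) * (A y \<bullet> y)"
proof (rule discriminant_le)
  fix t :: real
  have "x + t *\<^sub>R y \<in> K" using subspace assms by (simp add: subspace_def)
  from assms(1)[OF this] show "0 \<le> A x \<bullet> x + 2 * t * (A x \<bullet> y) + t\<^sup>2 * (A y \<bullet> y)"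
    using symmetric[OF assms(2,3)]
    by (simp add: add scaleR inner_add power2_eq_square algebra_simps inner_commute)
qed (simp add: assms)

text \<open>The operator inequality \<open>A\<^sup>2 \<le> M A\<close> on \<open>K\<close>: apply
  the Cauchy--Schwarz inequality of the form to \<open>x\<close> and \<open>A x\<close>, then cancel
  one factor \<open>A x \<bullet> A x\<close>.\<close>

lemma positive_square_le:
  assumes pos: "\<And>x. x \<in> K \<Longrightarrow> 0 \<le> A x \<bullet> x" and le: "\<And>x. x \<in> K \<Longrightarrow> A x \<bullet> x \<le> M * (x \<bullet> x)"
    and x: "x \<in> K"
  shows "A x \<bullet> A x \<le> M * (A x \<bullet> x)"
proof (cases "A x = 0")
  case False
  then have p: "0 < A x \<bullet> A x" by simp
  have "(A x \<bullet> A x)\<^sup>2 \<le> (A x \<bullet> x) * (A (A x) \<bullet> A x)"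
    by (rule positive_cauchy_schwarz[OF pos x invariant[OF x]])
  also have "\<dots> \<le> (A x \<bullet> x) * (M * (A x \<bullet> A x))"
    by (intro mult_left_mono le pos x invariant)
  finally have "(A x \<bullet> A x) * (A x \<bullet> A x) \<le> (M * (A x \<bullet> x)) * (A x \<bullet> A x)"
    by (simp only: power2_eq_square mult_ac)
  then show ?thesis using p by (rule mult_right_le_imp_le)
qed (use pos[OF x] in simp)

text \<open>If the infimum \<open>m\<close> of the quotients \<open>\<parallel>A x\<parallel>\<^sup>2 / \<parallel>x\<parallel>\<^sup>2\<close> were below \<open>h\<^sup>2\<close>, the factors of
  \<open>A\<^sup>2 - m = (A - \<surd>m) (A + \<surd>m)\<close> would both be bounded below, and so would be \<open>A\<^sup>2 - m \<ge> 0\<close>.\<close>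

lemma coercive_if_shifts_bounded_below:
  assumes h: "0 < h" and below: "\<And>\<mu>. \<bar>\<mu>\<bar> < h \<Longrightarrow> \<exists>c>0. \<forall>x\<in>K. c * norm x \<le> norm (A x - \<mu> *\<^sub>R x)"
    and x: "x \<in> K"
  shows "h\<^sup>2 * (x \<bullet> x) \<le> A x \<bullet> A x"
proof (rule ccontr)
  assume neg: "\<not> ?thesis"
  define m where "m = (INF x\<in>{x\<in>K. x \<noteq> 0}. (A x \<bullet> A x) / (x \<bullet> x))"
  have x0: "x \<noteq> 0" using neg zero by auto
  have bdd: "bdd_below ((\<lambda>x. (A x \<bullet> A x) / (x \<bullet> x)) ` {x\<in>K. x \<noteq> 0})"
    by (rule bdd_belowI2[where m=0]) simp
  have ne: "{x\<in>K. x \<noteq> 0} \<noteq> {}" using x x0 by blast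
  have m_le: "m * (y \<bullet> y) \<le> A y \<bullet> A y" if y: "y \<in> K" for y
  proof (cases "y = 0")
    case False
    then have "m \<le> (A y \<bullet> A y) / (y \<bullet> y)"
      unfolding m_def using y by (intro cINF_lower bdd) auto
    then show ?thesis using False by (simp add: field_simps)
  qed simp
  have m0: "0 \<le> m" unfolding m_def by (rule cINF_greatest[OF ne]) simp
  have mh: "m < h\<^sup>2"
  proof -
    have "m * (x \<bullet> x) < h\<^sup>2 * (x \<bullet> x)" using m_le[OF x] neg by linarith
    then show ?thesis by (simp add: mult_less_cancel_right)
  qed
  define s where "s = sqrt m"
  have s: "s\<^sup>2 = m" "\<bar>s\<bar> < h" "\<bar>- s\<bar> < h"
    using m0 mh h by (auto simp: s_def real_less_lsqrt)
  obtain c where c: "0 < c" "\<And>y. y \<in> K \<Longrightarrow> c * norm y \<le> norm (A y - s *\<^sub>R y)"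
    using below[OF s(2)] by blast
  obtain d where d: "0 < d" "\<And>y. y \<in> K \<Longrightarrow> d * norm y \<le> norm (A y - (- s) *\<^sub>R y)"
    using below[OF s(3)] by blast
  obtain M where M: "0 < M" "\<And>y. norm (A y) \<le> norm y * M" using pos_bounded by blast
  interpret P: symmetric_on K "\<lambda>y. A (A y) - m *\<^sub>R y" by (rule symmetric_on.shift[OF square])
  have Pxx: "(A (A y) - m *\<^sub>R y) \<bullet> y = A y \<bullet> A y - m * (y \<bullet> y)" if "y \<in> K" for y
    using symmetric[OF invariant[OF that] that] by (simp add: inner_diff)
  have lower: "(c * d)\<^sup>2 / M\<^sup>2 + m \<le> (A y \<bullet> A y) / (y \<bullet> y)" if y: "y \<in> K" "y \<noteq> 0" for y
  proof -
    have "c * (d * norm y) \<le> c * norm (A y + s *\<^sub>R y)" using c(1) d(2)[OF y(1)] by simp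
    also have "\<dots> \<le> norm (A (A y + s *\<^sub>R y) - s *\<^sub>R (A y + s *\<^sub>R y))"
      using y by (intro c(2)) (simp add: subspace subspace_add subspace_mul invariant)
    also have "A (A y + s *\<^sub>R y) - s *\<^sub>R (A y + s *\<^sub>R y) = A (A y) - m *\<^sub>R y"
      by (simp add: add scaleR s(1)[symmetric] power2_eq_square algebra_simps)
    finally have "(c * d * norm y)\<^sup>2 \<le> (norm (A (A y) - m *\<^sub>R y))\<^sup>2"
      using c(1) d(1) by (intro power_mono) (auto simp: mult.assoc)
    \<comment> \<open>\<open>A\<^sup>2 - m\<close> is non-negative by the choice of \<open>m\<close>
      and at most \<open>M\<^sup>2\<close>, so its squared norm is controlled by its form.\<close>
    also have "\<dots> \<le> M\<^sup>2 * (A y \<bullet> A y - m * (y \<bullet> y))"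
      unfolding power2_norm_eq_inner Pxx[OF y(1), symmetric]
    proof (rule P.positive_square_le)
      fix z assume z: "z \<in> K"
      show "0 \<le> (A (A z) - m *\<^sub>R z) \<bullet> z" using Pxx[OF z] m_le[OF z] by simp
      have "(norm (A z))\<^sup>2 \<le> (norm z * M)\<^sup>2" using M(2) by (intro power_mono) auto
      then have "A z \<bullet> A z \<le> M\<^sup>2 * (z \<bullet> z)" by (simp add: power2_norm_eq_inner power_mult_distrib mult.commute)
      moreover have "0 \<le> m * (z \<bullet> z)" using m0 by simp
      ultimately show "(A (A z) - m *\<^sub>R z) \<bullet> z \<le> M\<^sup>2 * (z \<bullet> z)" using Pxx[OF z] by simp
    qed (rule y(1))
    finally have "((c * d)\<^sup>2 / M\<^sup>2 + m) * (y \<bullet> y) \<le> A y \<bullet> A y"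
      using M(1) by (simp add: power_mult_distrib power2_norm_eq_inner field_simps)
    moreover have "0 < y \<bullet> y" using y(2) by simp
    ultimately show ?thesis by (simp only: pos_le_divide_eq)
  qed
  have "(c * d)\<^sup>2 / M\<^sup>2 + m \<le> m"
    unfolding m_def by (rule cINF_greatest[OF ne]) (use lower m_def in auto)
  moreover have "0 < (c * d)\<^sup>2 / M\<^sup>2" using c(1) d(1) M(1) by simp
  ultimately show False by simp
qed

text \<open>The previous lemma gives \<open>r \<langle>A x, x\<rangle> \<le> \<langle>A x, A x\<rangle>\<close>. By the Cauchy--Schwarz inequality for the form
  of \<open>A\<close> the quotients of consecutive moments increase, which gives the claim on the range.\<close>

lemma positive_gap:
  assumes pos: "\<And>x. x \<in> K \<Longrightarrow> 0 \<le> A x \<bullet> x" and r: "0 < r" and K: "closed K"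
    and inj: "\<And>x. x \<in> K \<Longrightarrow> A x = 0 \<Longrightarrow> x = 0"
    and below: "\<And>\<mu>. 0 < \<mu> \<Longrightarrow> \<mu> < r \<Longrightarrow> \<exists>c>0. \<forall>x\<in>K. c * norm x \<le> norm (A x - \<mu> *\<^sub>R x)"
    and x: "x \<in> K"
  shows "r * (x \<bullet> x) \<le> A x \<bullet> x"
proof -
  interpret S: symmetric_on K "\<lambda>x. A x - (r/2) *\<^sub>R x" by (rule shift)
  have gap: "r * (A y \<bullet> y) \<le> A y \<bullet> A y" if y: "y \<in> K" for y
  proof -
    \<comment> \<open>The interval from 0 to r is centred at r/2. When the coercivity bound for A -
      r/2 is expanded, the terms with \<open>(r/2)\<^sup>2\<close> cancel and the claimed inequality
      is left.\<close>
    have "(r/2)\<^sup>2 * (y \<bullet> y) \<le> (A y - (r/2) *\<^sub>R y) \<bullet> (A y - (r/2) *\<^sub>R y)"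
    proof (rule S.coercive_if_shifts_bounded_below[OF _ _ y])
      fix \<mu> :: real assume "\<bar>\<mu>\<bar> < r / 2"
      then show "\<exists>c>0. \<forall>x\<in>K. c * norm x \<le> norm (A x - (r/2) *\<^sub>R x - \<mu> *\<^sub>R x)"
        using below[of "r/2 + \<mu>"] by (simp add: algebra_simps)
    qed (use r in simp)
    then show ?thesis by (simp add: inner_diff inner_commute power2_eq_square algebra_simps)
  qed
  have range: "r * (A y \<bullet> A y) \<le> A (A y) \<bullet> A y" if y: "y \<in> K" for y
  proof (cases "A y = 0")
    case False
    have "(r * (A y \<bullet> A y)) * (A y \<bullet> A y) \<le> r * ((A y \<bullet> y) * (A (A y) \<bullet> A y))"
      using positive_cauchy_schwarz[OF pos y invariant[OF y]] r by (simp add: power2_eq_square)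
    also have "\<dots> \<le> (A y \<bullet> A y) * (A (A y) \<bullet> A y)"
      using mult_right_mono[OF gap[OF y] pos[OF invariant[OF y]]] by (simp add: mult.assoc)
    finally have "(r * (A y \<bullet> A y)) * (A y \<bullet> A y) \<le> (A (A y) \<bullet> A y) * (A y \<bullet> A y)"
      by (simp add: mult.commute)
    then show ?thesis using False by (simp add: mult_le_cancel_right)
  qed (simp add: zero)
  \<comment> \<open>The part of \<open>x\<close> orthogonal to the range lies in \<open>K\<close>
    and is annihilated by \<open>A\<close>, by symmetry. Injectivity therefore puts \<open>x\<close>
    in the closure of the range, to which the bound extends by continuity.\<close>
  have sub: "subspace (A ` K)" using blin subspace
    by (intro linear_subspace_image bounded_linear.linear)
  obtain c where c: "c \<in> closure (A ` K)" "\<And>s. s \<in> A ` K \<Longrightarrow> (x - c) \<bullet> s = 0"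
    using projection_exists[OF sub] by blast
  have "closure (A ` K) \<subseteq> K" using K invariant by (intro closure_minimal) auto
  then have w: "x - c \<in> K" using x c(1) subspace subspace_diff by blast
  then have "A (x - c) \<bullet> A (x - c) = 0"
    using c(2)[of "A (A (x - c))"] invariant symmetric by (simp add: imageI)
  then have "x = c" using inj[OF w] by simp
  moreover have "closure (A ` K) \<subseteq> {x. r * (x \<bullet> x) \<le> A x \<bullet> x}"
  proof (rule closure_minimal)
    have "continuous_on UNIV A" by (rule linear_continuous_on[OF blin])
    then show "closed {x. r * (x \<bullet> x) \<le> A x \<bullet> x}" by (intro closed_Collect_le continuous_intros)
  qed (use range in auto)
  ultimately show ?thesis using c(1) by blast
qed

text \<open>If the supremum \<beta> of the quotients exceeded \<alpha>, then \<beta> - A would be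
  non-negative, injective and bounded below after small positive shifts, so
  \<open>positive_gap\<close> would push all quotients down to \<beta> - r. The gap lies strictly to
  the left of \<beta>, which is what an isolated spectral point provides.\<close>

lemma upper_bound_if_gaps:
  assumes K: "closed K"
    and inj: "\<And>\<beta> x. \<alpha> < \<beta> \<Longrightarrow> x \<in> K \<Longrightarrow> A x = \<beta> *\<^sub>R x \<Longrightarrow> x = 0"
    and gaps: "\<And>\<beta>. \<alpha> < \<beta> \<Longrightarrow>
      \<exists>r>0. \<forall>\<mu>. \<beta> - r < \<mu> \<longrightarrow> \<mu> < \<beta> \<longrightarrow> (\<exists>c>0. \<forall>x\<in>K. c * norm x \<le> norm (A x - \<mu> *\<^sub>R x))"
    and x: "x \<in> K"
  shows "A x \<bullet> x \<le> \<alpha> * (x \<bullet> x)"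
proof (rule ccontr)
  assume neg: "\<not> ?thesis"
  then have x0: "x \<noteq> 0" by auto
  define \<beta> where "\<beta> = (SUP x\<in>{x\<in>K. x \<noteq> 0}. (A x \<bullet> x) / (x \<bullet> x))"
  obtain M where M: "0 < M" "\<And>y. norm (A y) \<le> norm y * M" using pos_bounded by blast
  have bdd: "bdd_above ((\<lambda>x. (A x \<bullet> x) / (x \<bullet> x)) ` {x\<in>K. x \<noteq> 0})"
  proof (rule bdd_aboveI2[where M=M])
    fix y assume "y \<in> {x\<in>K. x \<noteq> 0}"
    then have "0 < y \<bullet> y" by simp
    moreover have "A y \<bullet> y \<le> norm y * M * norm y"
      using norm_cauchy_schwarz[of "A y" y] mult_right_mono[OF M(2) norm_ge_zero, of y y] by linarith
    ultimately show "(A y \<bullet> y) / (y \<bullet> y) \<le> M"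
      by (simp add: pos_divide_le_eq dot_square_norm power2_eq_square mult_ac)
  qed
  have ne: "{x\<in>K. x \<noteq> 0} \<noteq> {}" using x x0 by blast
  have le_\<beta>: "(A y \<bullet> y) / (y \<bullet> y) \<le> \<beta>" if "y \<in> K" "y \<noteq> 0" for y
    unfolding \<beta>_def using that by (intro cSUP_upper bdd) auto
  have "\<alpha> < (A x \<bullet> x) / (x \<bullet> x)" using neg x0 by (simp add: pos_less_divide_eq)
  then have \<alpha>\<beta>: "\<alpha> < \<beta>" using le_\<beta>[OF x x0] by simp
  obtain r where r: "0 < r" "\<And>\<mu>. \<beta> - r < \<mu> \<Longrightarrow> \<mu> < \<beta> \<Longrightarrow> \<exists>c>0. \<forall>x\<in>K. c * norm x \<le> norm (A x - \<mu> *\<^sub>R x)"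
    using gaps[OF \<alpha>\<beta>] by blast
  interpret R: symmetric_on K "\<lambda>x. \<beta> *\<^sub>R x - A x" by (rule reflect)
  have "(A y \<bullet> y) / (y \<bullet> y) \<le> \<beta> - r" if y: "y \<in> K" "y \<noteq> 0" for y
  proof -
    have "r * (y \<bullet> y) \<le> (\<beta> *\<^sub>R y - A y) \<bullet> y"
    proof (rule R.positive_gap[OF _ r(1) K _ _ y(1)])
      fix z assume z: "z \<in> K"
      show "0 \<le> (\<beta> *\<^sub>R z - A z) \<bullet> z"
        using le_\<beta>[OF z] by (cases "z = 0") (auto simp: inner_diff field_simps)
      show "z = 0" if "\<beta> *\<^sub>R z - A z = 0"
        using inj[OF \<alpha>\<beta> z] that by simp
    next
      fix \<mu> :: real assume \<mu>: "0 < \<mu>" "\<mu> < r"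
      have "norm (\<beta> *\<^sub>R z - A z - \<mu> *\<^sub>R z) = norm (A z - (\<beta> - \<mu>) *\<^sub>R z)" for z
        by (subst norm_minus_commute) (simp add: algebra_simps)
      then show "\<exists>c>0. \<forall>x\<in>K. c * norm x \<le> norm (\<beta> *\<^sub>R x - A x - \<mu> *\<^sub>R x)"
        using r(2)[of "\<beta> - \<mu>"] \<mu> by simp
    qed
    moreover have "0 < y \<bullet> y" using y(2) by simp
    ultimately show ?thesis by (simp only: pos_divide_le_eq inner_diff left_diff_distrib inner_scaleR_left)
  qed
  then have "\<beta> \<le> \<beta> - r" by (subst (1) \<beta>_def, intro cSUP_least[OF ne]) auto
  then show False using r(1) by simp
qed

end

section \<open>Square roots of bounded positive operators\<close>

text \<open>The limit \<open>R\<close> satisfies \<open>2 R = X + R\<^sup>2\<close>, so \<open>1 - R\<close> is a square root of \<open>1 - X\<close>.\<close>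

context
  fixes X :: "'h::{real_inner,banach} \<Rightarrow>\<^sub>L 'h"
begin

primrec sqrt_iteration :: "nat \<Rightarrow> 'h \<Rightarrow>\<^sub>L 'h" where
  "sqrt_iteration 0 = 0"
| "sqrt_iteration (Suc n) = (1/2) *\<^sub>R (X + (sqrt_iteration n o\<^sub>L sqrt_iteration n))"

end

text \<open>The same recursion with \<open>X\<close> replaced by 1: a majorant for the iterates and
  for their increments. Monotone bounded convergence of this sequence makes the operator iteration
  Cauchy without any geometric rate.\<close>

primrec scalar_sqrt_iteration :: "nat \<Rightarrow> real" where
  "scalar_sqrt_iteration 0 = 0"
| "scalar_sqrt_iteration (Suc n) = (1 + (scalar_sqrt_iteration n)\<^sup>2) / 2"

lemma scalar_sqrt_iteration_bounds: "0 \<le> scalar_sqrt_iteration n \<and> scalar_sqrt_iteration n \<le> 1"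
  by (induction n) (auto simp: power_le_one)

lemma scalar_sqrt_iteration_mono: "incseq scalar_sqrt_iteration"
proof (rule incseq_SucI)
  fix n show "scalar_sqrt_iteration n \<le> scalar_sqrt_iteration (Suc n)"
    using zero_le_power2[of "1 - scalar_sqrt_iteration n"] by (simp add: power2_diff)
qed

text \<open>Each iterate is a polynomial in \<open>X\<close>.\<close>

lemma sqrt_iteration_commute:
  assumes "\<And>x. blinfun_apply A (blinfun_apply X x) = blinfun_apply X (blinfun_apply A x)"
  shows "blinfun_apply A (blinfun_apply (sqrt_iteration X n) x) = blinfun_apply (sqrt_iteration X n) (blinfun_apply A x)"
  by (induction n arbitrary: x)
    (simp_all add: assms blinfun.add_left blinfun.add_right blinfun.scaleR_left blinfun.scaleR_right)

lemma norm_sqrt_iteration_le: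
  assumes "norm X \<le> 1" shows "norm (sqrt_iteration X n) \<le> scalar_sqrt_iteration n"
proof (induction n)
  case (Suc n)
  have "norm (X + (sqrt_iteration X n o\<^sub>L sqrt_iteration X n)) \<le> 1 + (scalar_sqrt_iteration n)\<^sup>2"
    using assms norm_blinfun_compose[of "sqrt_iteration X n" "sqrt_iteration X n"]
      power_mono[OF Suc norm_ge_zero, of 2]
    using norm_triangle_ineq[of X "sqrt_iteration X n o\<^sub>L sqrt_iteration X n"]
    unfolding power2_eq_square by linarith
  then show ?case by simp
qed simp

lemma sqrt_step_diff:
  fixes R S X :: "'h::real_normed_vector \<Rightarrow>\<^sub>L 'h"
  assumes "\<And>x. blinfun_apply S (blinfun_apply R x) = blinfun_apply R (blinfun_apply S x)"
  shows "(1/2) *\<^sub>R (X + (S o\<^sub>L S)) - (1/2) *\<^sub>R (X + (R o\<^sub>L R)) = (1/2) *\<^sub>R ((S - R) o\<^sub>L (S + R))"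
  by (rule blinfun_eqI) (simp add: blinfun.bilinear_simps assms scaleR_diff_right[symmetric])

text \<open>Consecutive iterates commute, so the difference of their squares factors into difference
  times sum. The scalar recursion factors in the same way and dominates both factors.\<close>

lemma norm_sqrt_iteration_diff_le:
  assumes X: "norm X \<le> 1"
  shows "norm (sqrt_iteration X (Suc n) - sqrt_iteration X n)
    \<le> scalar_sqrt_iteration (Suc n) - scalar_sqrt_iteration n"
proof (induction n)
  case 0
  then show ?case using X by simp
next
  case (Suc n)
  let ?R = "sqrt_iteration X n" and ?S = "sqrt_iteration X (Suc n)"
  let ?r = "scalar_sqrt_iteration n" and ?s = "scalar_sqrt_iteration (Suc n)"
  have comm: "blinfun_apply ?S (blinfun_apply ?R x) = blinfun_apply ?R (blinfun_apply ?S x)" for x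
    by (intro sqrt_iteration_commute sqrt_iteration_commute[symmetric]) simp
  have "sqrt_iteration X (Suc (Suc n)) - ?S = (1/2) *\<^sub>R ((?S - ?R) o\<^sub>L (?S + ?R))"
    using sqrt_step_diff[OF comm, where X=X] by simp
  also have "norm \<dots> \<le> 1/2 * ((?s - ?r) * (?s + ?r))"
  proof -
    have "norm (?S + ?R) \<le> ?s + ?r"
      by (intro order_trans[OF norm_triangle_ineq] add_mono norm_sqrt_iteration_le X)
    then have "norm (?S - ?R) * norm (?S + ?R) \<le> (?s - ?r) * (?s + ?r)"
      by (intro mult_mono Suc order_trans[OF norm_ge_zero Suc]) auto
    then show ?thesis using norm_blinfun_compose[of "?S - ?R" "?S + ?R"] by simp
  qed
  also have "\<dots> = scalar_sqrt_iteration (Suc (Suc n)) - ?s"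
    unfolding scalar_sqrt_iteration.simps(2)[of "Suc n"] power2_eq_square
    using scalar_sqrt_iteration.simps(2)[of n] by (simp add: power2_eq_square algebra_simps)
  finally show ?case .
qed

text \<open>From 0 \<le> B \<le> 1 the operator X = 1 - B has norm at most 1, as the iteration
  requires. The bound C \<le> 1 allows taking a further root; the commutation clause, inherited from
  the iterates, serves as a substitute for functional calculus.\<close>

theorem blinfun_sqrt:
  fixes B :: "'h::{real_inner,banach} \<Rightarrow>\<^sub>L 'h"
  assumes sym: "\<And>x y. blinfun_apply B x \<bullet> y = x \<bullet> blinfun_apply B y"
    and pos: "\<And>x. 0 \<le> blinfun_apply B x \<bullet> x" and le: "\<And>x. blinfun_apply B x \<bullet> x \<le> x \<bullet> x"
  obtains C :: "'h \<Rightarrow>\<^sub>L 'h" where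
    "\<And>x y. blinfun_apply C x \<bullet> y = x \<bullet> blinfun_apply C y" "\<And>x. 0 \<le> blinfun_apply C x \<bullet> x"
    "\<And>x. blinfun_apply C x \<bullet> x \<le> x \<bullet> x"
    "\<And>x. blinfun_apply C (blinfun_apply C x) = blinfun_apply B x"
    "\<And>A x. (\<And>y. blinfun_apply A (blinfun_apply B y) = blinfun_apply B (blinfun_apply A y)) \<Longrightarrow>
      blinfun_apply A (blinfun_apply C x) = blinfun_apply C (blinfun_apply A x)"
proof -
  define X where "X = id_blinfun - B"
  have Xx [simp]: "blinfun_apply X x = x - blinfun_apply B x" for x
    by (simp add: X_def blinfun.diff_left)
  interpret X: symmetric_on UNIV "blinfun_apply X"
  proof (rule symmetric_on.intro)
    show "bounded_linear (blinfun_apply X)" by (rule blinfun.bounded_linear_right)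
    show "blinfun_apply X x \<bullet> y = x \<bullet> blinfun_apply X y" for x y by (simp add: inner_diff sym)
  qed auto
  have "norm X \<le> 1"
  proof (rule norm_blinfun_bound)
    fix x
    have "blinfun_apply X x \<bullet> blinfun_apply X x \<le> 1 * (blinfun_apply X x \<bullet> x)"
      by (rule X.positive_square_le) (use pos le in \<open>auto simp: inner_diff\<close>)
    also have "\<dots> \<le> x \<bullet> x" using pos[of x] by (simp add: inner_diff)
    finally show "norm (blinfun_apply X x) \<le> 1 * norm x" by (simp add: norm_le)
  qed simp
  let ?R = "sqrt_iteration X" and ?r = scalar_sqrt_iteration
  have mono: "norm (?R (m + k) - ?R m) \<le> ?r (m + k) - ?r m" for m k
  proof (induction k)
    case (Suc k)
    have "norm (?R (m + Suc k) - ?R m) \<le> norm (?R (Suc (m + k)) - ?R (m + k)) + norm (?R (m + k) - ?R m)"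
      using norm_triangle_ineq[of "?R (Suc (m + k)) - ?R (m + k)" "?R (m + k) - ?R m"] by simp
    then show ?case
      using norm_sqrt_iteration_diff_le[OF \<open>norm X \<le> 1\<close>, of "m + k"] Suc
      by (simp del: sqrt_iteration.simps scalar_sqrt_iteration.simps)
  qed simp
  have dist_le: "dist (?R m) (?R n) \<le> dist (?r m) (?r n)" for m n
  proof (induction m n rule: linorder_wlog)
    case (le m n)
    then show ?case using mono[of m "n - m"] by (simp add: dist_norm norm_minus_commute)
  qed (simp add: dist_commute)
  have "Cauchy ?r"
    using scalar_sqrt_iteration_mono scalar_sqrt_iteration_bounds
    by (intro convergent_Cauchy) (metis convergentI incseq_convergent)
  then have "Cauchy ?R"
    unfolding Cauchy_def using dist_le by (meson le_less_trans)
  then obtain R where R: "?R \<longlonglongrightarrow> R" using Cauchy_convergent convergentD by blast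
  have Rx: "(\<lambda>n. blinfun_apply (?R n) x) \<longlonglongrightarrow> blinfun_apply R x" for x
    by (intro tendsto_intros R)
  have sym_n: "blinfun_apply (?R n) x \<bullet> y = x \<bullet> blinfun_apply (?R n) y" for n x y
    by (induction n arbitrary: x y) (simp_all add: blinfun.bilinear_simps inner_add inner_diff sym)
  have sym_R: "blinfun_apply R x \<bullet> y = x \<bullet> blinfun_apply R y" for x y
  proof (rule LIMSEQ_unique)
    show "(\<lambda>n. blinfun_apply (?R n) x \<bullet> y) \<longlonglongrightarrow> blinfun_apply R x \<bullet> y" by (intro tendsto_intros Rx)
    show "(\<lambda>n. blinfun_apply (?R n) x \<bullet> y) \<longlonglongrightarrow> x \<bullet> blinfun_apply R y"
      unfolding sym_n by (intro tendsto_intros Rx)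
  qed
  have pos_n: "0 \<le> blinfun_apply (?R n) x \<bullet> x" for n x
  proof (cases n)
    case (Suc m)
    have "blinfun_apply (?R m) (blinfun_apply (?R m) x) \<bullet> x = blinfun_apply (?R m) x \<bullet> blinfun_apply (?R m) x"
      by (rule sym_n)
    then show ?thesis using Suc le[of x] by (simp add: blinfun.bilinear_simps inner_add inner_diff)
  qed simp
  have pos_R: "0 \<le> blinfun_apply R x \<bullet> x" for x
    by (rule LIMSEQ_le_const[where X="\<lambda>n. blinfun_apply (?R n) x \<bullet> x"]) (auto intro!: tendsto_intros Rx pos_n)
  have "norm (?R n) \<le> 1" for n
    using norm_sqrt_iteration_le[OF \<open>norm X \<le> 1\<close>, of n] scalar_sqrt_iteration_bounds[of n] by linarith
  then have norm_R: "norm R \<le> 1"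
    by (intro LIMSEQ_le_const2[OF tendsto_norm[OF R]]) auto
  have le_R: "blinfun_apply R x \<bullet> x \<le> x \<bullet> x" for x
  proof -
    have "blinfun_apply R x \<bullet> x \<le> norm (blinfun_apply R x) * norm x" by (rule norm_cauchy_schwarz)
    also have "\<dots> \<le> (norm R * norm x) * norm x" by (intro mult_right_mono norm_blinfun) simp
    also have "\<dots> \<le> (1 * norm x) * norm x" by (intro mult_right_mono norm_R) auto
    finally show ?thesis by (simp add: dot_square_norm power2_eq_square)
  qed
  have "(\<lambda>n. ?R (Suc n)) \<longlonglongrightarrow> (1/2) *\<^sub>R (X + (R o\<^sub>L R))"
    unfolding sqrt_iteration.simps
    by (intro tendsto_intros R bounded_bilinear.tendsto[OF bounded_bilinear_blinfun_compose])
  then have fixpoint: "R = (1/2) *\<^sub>R (X + (R o\<^sub>L R))" using LIMSEQ_Suc[OF R] LIMSEQ_unique by blast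
  have RR: "blinfun_apply R (blinfun_apply R x) = 2 *\<^sub>R blinfun_apply R x - (x - blinfun_apply B x)" for x
    by (subst (3) fixpoint) (simp add: blinfun.bilinear_simps)
  show ?thesis
  proof (rule that[of "id_blinfun - R"])
    fix x y
    show "blinfun_apply (id_blinfun - R) x \<bullet> y = x \<bullet> blinfun_apply (id_blinfun - R) y"
      by (simp add: blinfun.bilinear_simps inner_diff sym_R)
    show "0 \<le> blinfun_apply (id_blinfun - R) x \<bullet> x" using le_R by (simp add: blinfun.bilinear_simps inner_diff)
    show "blinfun_apply (id_blinfun - R) x \<bullet> x \<le> x \<bullet> x"
      using pos_R by (simp add: blinfun.bilinear_simps inner_diff)
    show "blinfun_apply (id_blinfun - R) (blinfun_apply (id_blinfun - R) x) = blinfun_apply B x"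
      by (simp add: blinfun.bilinear_simps RR scaleR_2)
  next
    fix A :: "'h \<Rightarrow>\<^sub>L 'h" and x
    assume A: "\<And>y. blinfun_apply A (blinfun_apply B y) = blinfun_apply B (blinfun_apply A y)"
    have n: "blinfun_apply A (blinfun_apply (?R n) x) = blinfun_apply (?R n) (blinfun_apply A x)" for n
      by (rule sqrt_iteration_commute) (simp add: blinfun.bilinear_simps A)
    have "blinfun_apply A (blinfun_apply R x) = blinfun_apply R (blinfun_apply A x)"
    proof (rule LIMSEQ_unique)
      show "(\<lambda>n. blinfun_apply A (blinfun_apply (?R n) x)) \<longlonglongrightarrow> blinfun_apply A (blinfun_apply R x)"
        by (intro tendsto_intros Rx)
      show "(\<lambda>n. blinfun_apply A (blinfun_apply (?R n) x)) \<longlonglongrightarrow> blinfun_apply R (blinfun_apply A x)"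
        unfolding n by (rule Rx)
    qed
    then show "blinfun_apply A (blinfun_apply (id_blinfun - R) x) = blinfun_apply (id_blinfun - R) (blinfun_apply A x)"
      by (simp add: blinfun.bilinear_simps)
  qed
qed

section \<open>The operator on finitely supported functions and its resolvent\<close>

definition fs :: "'v ell2 set" where "fs = {x. finite {v. fn x v \<noteq> 0}}"

lemma subspace_fs: "subspace fs"
  unfolding subspace_def
proof (intro conjI ballI allI)
  fix x y :: "'v ell2" and r :: real
  assume x: "x \<in> fs"
  show "r *\<^sub>R x \<in> fs" using x by (auto simp: fs_def elim: rev_finite_subset)
  assume y: "y \<in> fs"
  have "{v. fn (x + y) v \<noteq> 0} \<subseteq> {v. fn x v \<noteq> 0} \<union> {v. fn y v \<noteq> 0}" by auto
  then show "x + y \<in> fs" using x y by (auto simp: fs_def elim: finite_subset)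
qed (simp add: fs_def)

locale graph_potential =
  fixes E :: "'v::countable \<Rightarrow> 'v \<Rightarrow> bool" and q :: "'v \<Rightarrow> real"
  assumes graph: "locally_finite_graph E" and q_nonneg: "0 \<le> q v"
begin

lemma E_sym: "E v w \<longleftrightarrow> E w v"
  using graph by (auto simp: locally_finite_graph_def dest: sympD)

lemma E_irrefl: "\<not> E v v"
  using graph by (auto simp: locally_finite_graph_def dest: irreflpD)

lemma finite_neighbours [simp]: "finite {w. E v w}"
  using graph by (simp add: locally_finite_graph_def)

lemma deg_nonneg: "0 \<le> deg E v"
  by (simp add: deg_def)

definition g :: "'v \<Rightarrow> real" where "g v = deg E v + q v"

lemma g_nonneg: "0 \<le> g v"
  by (simp add: g_def deg_nonneg q_nonneg)

definition lap :: "('v \<Rightarrow> complex) \<Rightarrow> 'v \<Rightarrow> complex" where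
  "lap f v = g v *\<^sub>R f v - (\<Sum>w | E v w. f w)"

lemma lap_eq: "lap f v = (\<Sum>w | E v w. f v - f w) + complex_of_real (q v) * f v"
  by (simp add: lap_def g_def deg_def sum_subtractf scaleR_conv_of_real algebra_simps)

definition acts :: "'v ell2 \<Rightarrow> 'v ell2 \<Rightarrow> bool" where
  "acts x y \<longleftrightarrow> (\<forall>v. fn y v = lap (fn x) v)"

lemma schroedinger_op_iff: "(\<phi>, \<psi>) \<in> schroedinger_op E q \<longleftrightarrow> (\<exists>x y. \<phi> = fn x \<and> \<psi> = fn y \<and> acts x y)"
proof
  assume "(\<phi>, \<psi>) \<in> schroedinger_op E q"
  then have "\<phi> = fn (ell2_of \<phi>)" "\<psi> = fn (ell2_of \<psi>)" "\<forall>v. \<psi> v = lap \<phi> v"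
    by (auto simp: schroedinger_op_def lap_eq)
  then show "\<exists>x y. \<phi> = fn x \<and> \<psi> = fn y \<and> acts x y" unfolding acts_def by metis
qed (auto simp: schroedinger_op_def acts_def lap_eq)

lemma fn_schroedinger_op_iff: "(fn x, fn y) \<in> schroedinger_op E q \<longleftrightarrow> acts x y"
  by (auto simp: schroedinger_op_iff fn_inject)

lemma neighbour_sum_eq:
  assumes "finite A" "\<And>w. E v w \<Longrightarrow> w \<notin> A \<Longrightarrow> h w = 0"
  shows "(\<Sum>w | E v w. h w) = (\<Sum>w\<in>A. if E v w then h w else 0)"
proof -
  have "(\<Sum>w | E v w. h w) = (\<Sum>w\<in>A \<inter> {w. E v w}. h w)"
    by (rule sum.mono_neutral_right) (use assms in auto)
  also have "\<dots> = (\<Sum>w\<in>A. if E v w then h w else 0)"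
    using assms(1) by (simp add: sum.inter_restrict)
  finally show ?thesis .
qed

lemma lap_finite_support:
  assumes "finite {v. f v \<noteq> 0}" shows "finite {v. lap f v \<noteq> 0}"
proof (rule finite_subset)
  show "{v. lap f v \<noteq> 0} \<subseteq> {v. f v \<noteq> 0} \<union> (\<Union>w\<in>{v. f v \<noteq> 0}. {v. E w v})"
  proof
    fix v assume "v \<in> {v. lap f v \<noteq> 0}"
    then have "f v \<noteq> 0 \<or> (\<Sum>w | E v w. f w) \<noteq> 0" by (auto simp: lap_def)
    then have "f v \<noteq> 0 \<or> (\<exists>w\<in>{w. E v w}. f w \<noteq> 0)" by (meson sum.neutral)
    then show "v \<in> {v. f v \<noteq> 0} \<union> (\<Union>w\<in>{v. f v \<noteq> 0}. {v. E w v})"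
      by (auto dest: E_sym[THEN iffD1])
  qed
qed (use assms in auto)

text \<open>Meaningful on \<open>fs\<close> only: elsewhere \<open>lap (fn x)\<close> may fail to be
  square summable, and the value of \<open>ell2_of\<close> is then unspecified. The maximal operator
  is the relation \<open>acts\<close>.\<close>

definition L :: "'v ell2 \<Rightarrow> 'v ell2" where "L x = ell2_of (lap (fn x))"

lemma fn_L: "x \<in> fs \<Longrightarrow> fn (L x) = lap (fn x)"
  unfolding L_def by (intro fn_ell2_of l2_finite_support lap_finite_support) (simp add: fs_def)

lemma L_fs: "x \<in> fs \<Longrightarrow> L x \<in> fs"
  using fn_L[of x] lap_finite_support[of "fn x"] by (simp add: fs_def)

lemma acts_L: "x \<in> fs \<Longrightarrow> acts x (L x)"
  by (simp add: acts_def fn_L)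

lemma lap_add: "lap (\<lambda>v. f v + h v) v = lap f v + lap h v"
  by (simp add: lap_def sum.distrib algebra_simps)

lemma lap_mult: "lap (\<lambda>v. c * f v) v = c * lap f v"
  by (simp add: lap_def sum_distrib_left scaleR_conv_of_real algebra_simps)

lemma acts_add: "acts x y \<Longrightarrow> acts x' y' \<Longrightarrow> acts (x + x') (y + y')"
  by (simp add: acts_def lap_add plus_ell2.rep_eq plus_fun_def)

lemma acts_cs: "acts x y \<Longrightarrow> acts (cs c x) (cs c y)"
  by (simp add: acts_def lap_mult cs.rep_eq cscale_def)

lemma acts_scaleR: "acts x y \<Longrightarrow> acts (r *\<^sub>R x) (r *\<^sub>R y)"
  using acts_cs[of x y "complex_of_real r"] by (simp add: cs_of_real)

lemma acts_diff: "acts x y \<Longrightarrow> acts x' y' \<Longrightarrow> acts (x - x') (y - y')"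
  using acts_add[OF _ acts_scaleR[of x' y' "-1"]] by simp

lemma acts_unique: "acts x y \<Longrightarrow> acts x z \<Longrightarrow> y = z"
  by (rule ell2_eqI) (simp add: acts_def)

text \<open>The maximal operator is closed, since by local finiteness each value of
  \<open>lap\<close> involves finitely many coordinates.\<close>

lemma acts_limit:
  assumes "X \<longlonglongrightarrow> x" "Y \<longlonglongrightarrow> y" "\<And>n. acts (X n) (Y n)" shows "acts x y"
  unfolding acts_def
proof
  fix v
  have "(\<lambda>n. lap (fn (X n)) v) \<longlonglongrightarrow> lap (fn x) v"
    unfolding lap_def by (intro tendsto_intros tendsto_fn assms)
  moreover have "(\<lambda>n. lap (fn (X n)) v) \<longlonglongrightarrow> fn y v"
    using tendsto_fn[OF assms(2), of v] assms(3) by (simp add: acts_def)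
  ultimately show "fn y v = lap (fn x) v" using LIMSEQ_unique by blast
qed

text \<open>Summation by parts against an arbitrary element of the maximal domain: all sums live on
  a finite set \<open>A\<close> that contains the support of \<open>x\<close>, its neighbours and
  the support of \<open>L x\<close>, and symmetry of \<open>E\<close> exchanges the double
  sum.\<close>

lemma green:
  assumes x: "x \<in> fs" and y: "acts y z" shows "L x \<bullet> y = x \<bullet> z"
proof -
  let ?S = "{v. fn x v \<noteq> 0}"
  define A where "A = ?S \<union> (\<Union>w\<in>?S. {v. E w v}) \<union> {v. fn (L x) v \<noteq> 0}"
  have A: "finite A" using x L_fs[OF x] by (auto simp: A_def fs_def)
  have outside: "fn x v = 0" if "v \<notin> A" for v using that by (auto simp: A_def)
  have nbr: "w \<in> A" if "E v w" "fn x v \<noteq> 0" for v w using that by (auto simp: A_def)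
  have "(\<Sum>v\<in>A. (\<Sum>w | E v w. fn x w) \<bullet> fn y v) = (\<Sum>v\<in>A. \<Sum>w\<in>A. if E v w then fn x w \<bullet> fn y v else 0)"
    unfolding inner_sum_left by (intro sum.cong neighbour_sum_eq A) (auto simp: outside)
  also have "\<dots> = (\<Sum>w\<in>A. \<Sum>v\<in>A. if E w v then fn x w \<bullet> fn y v else 0)"
    by (subst sum.swap) (simp add: E_sym)
  also have "\<dots> = (\<Sum>w\<in>A. fn x w \<bullet> (\<Sum>v | E w v. fn y v))"
    unfolding inner_sum_right by (intro sum.cong neighbour_sum_eq[symmetric] A refl) (use nbr in force)
  finally have swap: "(\<Sum>v\<in>A. (\<Sum>w | E v w. fn x w) \<bullet> fn y v) = (\<Sum>w\<in>A. fn x w \<bullet> (\<Sum>v | E w v. fn y v))" .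
  have "L x \<bullet> y = (\<Sum>v\<in>A. fn (L x) v \<bullet> fn y v)"
    by (rule inner_finite_support[OF A]) (auto simp: A_def)
  also have "\<dots> = (\<Sum>v\<in>A. g v * (fn x v \<bullet> fn y v)) - (\<Sum>v\<in>A. (\<Sum>w | E v w. fn x w) \<bullet> fn y v)"
    by (simp add: fn_L[OF x] lap_def inner_diff_left sum_subtractf)
  also have "\<dots> = (\<Sum>v\<in>A. g v * (fn x v \<bullet> fn y v)) - (\<Sum>w\<in>A. fn x w \<bullet> (\<Sum>v | E w v. fn y v))"
    by (simp only: swap)
  also have "\<dots> = (\<Sum>v\<in>A. fn x v \<bullet> fn z v)"
    using y by (simp add: acts_def lap_def inner_diff_right sum_subtractf)
  also have "\<dots> = x \<bullet> z"
    by (rule inner_finite_support[OF A, symmetric]) (auto simp: outside)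
  finally show ?thesis .
qed

lemma form_eq:
  assumes x: "x \<in> fs" and A: "finite A" and supp: "\<And>v. v \<notin> A \<Longrightarrow> fn x v = 0"
  shows "L x \<bullet> x = (\<Sum>v\<in>A. g v * (cmod (fn x v))\<^sup>2) - (\<Sum>v\<in>A. \<Sum>w\<in>A. if E v w then fn x w \<bullet> fn x v else 0)"
proof -
  have "L x \<bullet> x = (\<Sum>v\<in>A. fn (L x) v \<bullet> fn x v)"
    by (rule inner_finite_support[OF A]) (auto simp: supp)
  also have "\<dots> = (\<Sum>v\<in>A. g v * (cmod (fn x v))\<^sup>2) - (\<Sum>v\<in>A. \<Sum>w | E v w. fn x w \<bullet> fn x v)"
    by (simp add: fn_L[OF x] lap_def inner_diff_left sum_subtractf inner_sum_left power2_norm_eq_inner)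
  also have "(\<Sum>v\<in>A. \<Sum>w | E v w. fn x w \<bullet> fn x v) = (\<Sum>v\<in>A. \<Sum>w\<in>A. if E v w then fn x w \<bullet> fn x v else 0)"
    by (intro sum.cong neighbour_sum_eq A refl) (auto simp: supp)
  finally show ?thesis .
qed

text \<open>By symmetry of \<open>E\<close> the two halves of the sum agree, so each vertex is
  counted once per neighbour in \<open>A\<close>; neighbours outside \<open>A\<close> account for
  the inequality.\<close>

lemma edge_sum_le_deg:
  assumes A: "finite A" and h: "\<And>v. 0 \<le> h v"
  shows "(\<Sum>v\<in>A. \<Sum>w\<in>A. if E v w then (h v + h w) / 2 else 0) \<le> (\<Sum>v\<in>A. deg E v * h v)"
proof -
  have "(\<Sum>v\<in>A. \<Sum>w\<in>A. if E v w then (h v + h w) / 2 else 0)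
      = (\<Sum>v\<in>A. \<Sum>w\<in>A. if E v w then h v / 2 else 0) + (\<Sum>v\<in>A. \<Sum>w\<in>A. if E v w then h w / 2 else 0)"
    unfolding sum.distrib[symmetric] by (intro sum.cong) (auto simp: add_divide_distrib)
  also have "(\<Sum>v\<in>A. \<Sum>w\<in>A. if E v w then h w / 2 else 0) = (\<Sum>v\<in>A. \<Sum>w\<in>A. if E v w then h v / 2 else 0)"
    by (subst sum.swap) (simp add: E_sym)
  also have "(\<Sum>v\<in>A. \<Sum>w\<in>A. if E v w then h v / 2 else 0) + (\<Sum>v\<in>A. \<Sum>w\<in>A. if E v w then h v / 2 else 0)
      = (\<Sum>v\<in>A. \<Sum>w\<in>A. if E v w then h v else 0)"
    unfolding sum.distrib[symmetric] by (intro sum.cong) auto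
  also have "\<dots> \<le> (\<Sum>v\<in>A. deg E v * h v)"
  proof (rule sum_mono)
    fix v
    have "(\<Sum>w\<in>A. if E v w then h v else 0) = real (card (A \<inter> {w. E v w})) * h v"
      using A by (simp add: sum.If_cases)
    also have "\<dots> \<le> deg E v * h v"
      unfolding deg_def by (intro mult_right_mono h of_nat_mono card_mono) auto
    finally show "(\<Sum>w\<in>A. if E v w then h v else 0) \<le> deg E v * h v" .
  qed
  finally show ?thesis .
qed

lemma inner_le_half_squares: "(a::complex) \<bullet> b \<le> ((cmod b)\<^sup>2 + (cmod a)\<^sup>2) / 2"
proof -
  have "0 \<le> (a - b) \<bullet> (a - b)" by simp
  then show ?thesis by (simp add: inner_diff inner_commute power2_norm_eq_inner)
qed

lemma L_nonneg: assumes x: "x \<in> fs" shows "0 \<le> L x \<bullet> x"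
proof -
  let ?S = "{v. fn x v \<noteq> 0}"
  have S: "finite ?S" using x by (simp add: fs_def)
  have "(\<Sum>v\<in>?S. \<Sum>w\<in>?S. if E v w then fn x w \<bullet> fn x v else 0)
      \<le> (\<Sum>v\<in>?S. \<Sum>w\<in>?S. if E v w then ((cmod (fn x v))\<^sup>2 + (cmod (fn x w))\<^sup>2) / 2 else 0)"
    using inner_le_half_squares by (intro sum_mono) auto
  also have "\<dots> \<le> (\<Sum>v\<in>?S. deg E v * (cmod (fn x v))\<^sup>2)" by (rule edge_sum_le_deg[OF S]) simp
  also have "\<dots> \<le> (\<Sum>v\<in>?S. g v * (cmod (fn x v))\<^sup>2)"
    by (intro sum_mono mult_right_mono) (auto simp: g_def q_nonneg)
  finally show ?thesis by (subst form_eq[OF x S]) auto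
qed

lemma maximum_principle:
  assumes "\<And>v. lap (fn x) v + fn x v = 0" shows "x = 0"
proof (rule ccontr)
  assume "x \<noteq> 0"
  then obtain v0 where v0: "fn x v0 \<noteq> 0" using ell2_eqI[of x 0] by auto
  let ?P = "{v. cmod (fn x v0) \<le> cmod (fn x v)}"
  \<comment> \<open>Square summability leaves finitely many vertices at or above the level of
    \<open>v0\<close>, so the modulus attains its maximum even on an infinite graph.\<close>
  have "finite ?P"
  proof (rule ccontr)
    assume inf: "infinite ?P"
    define n where "n = Suc (nat \<lceil>(norm x)\<^sup>2 / (cmod (fn x v0))\<^sup>2\<rceil>)"
    obtain F where F: "F \<subseteq> ?P" "finite F" "card F = n" using infinite_arbitrarily_large[OF inf] by blast
    have "real n * (cmod (fn x v0))\<^sup>2 = (\<Sum>v\<in>F. (cmod (fn x v0))\<^sup>2)" using F by simp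
    also have "\<dots> \<le> (\<Sum>v\<in>F. (cmod (fn x v))\<^sup>2)" using F by (intro sum_mono power_mono) auto
    also have "\<dots> \<le> (norm x)\<^sup>2" by (rule sum_le_ell2_norm[OF F(2)])
    finally have "real n \<le> (norm x)\<^sup>2 / (cmod (fn x v0))\<^sup>2" using v0 by (simp add: field_simps)
    then show False unfolding n_def by linarith
  qed
  then have fin: "finite ((\<lambda>v. cmod (fn x v)) ` ?P)" and ne: "(\<lambda>v. cmod (fn x v)) ` ?P \<noteq> {}" by auto
  obtain v where v: "v \<in> ?P" "Max ((\<lambda>v. cmod (fn x v)) ` ?P) = cmod (fn x v)"
    using Max_in[OF fin ne] by auto
  have max: "cmod (fn x w) \<le> cmod (fn x v)" for w
    using v Max_ge[OF fin, of "cmod (fn x w)"] by (cases "w \<in> ?P") auto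
  have "(g v + 1) *\<^sub>R fn x v = (\<Sum>w | E v w. fn x w)"
    using assms[of v] by (simp add: lap_def algebra_simps)
  then have "(g v + 1) * cmod (fn x v) = cmod (\<Sum>w | E v w. fn x w)"
    using g_nonneg[of v] by (metis abs_of_nonneg add_nonneg_nonneg norm_scaleR zero_le_one)
  also have "\<dots> \<le> (\<Sum>w | E v w. cmod (fn x v))" by (intro order_trans[OF norm_sum] sum_mono max)
  also have "\<dots> = deg E v * cmod (fn x v)" by (simp add: deg_def)
  also have "\<dots> \<le> g v * cmod (fn x v)" by (intro mult_right_mono) (auto simp: g_def q_nonneg)
  finally have "cmod (fn x v) \<le> 0" by (simp add: algebra_simps)
  then show False using v(1) v0 by simp
qed

section \<open>Density of the range of \<Delta> + q + 1 and the core property\<close>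

lemma L_add: "x \<in> fs \<Longrightarrow> y \<in> fs \<Longrightarrow> L (x + y) = L x + L y"
  using subspace_add[OF subspace_fs] by (intro acts_unique[OF acts_L acts_add[OF acts_L acts_L]]) auto

lemma L_scaleR: "x \<in> fs \<Longrightarrow> L (r *\<^sub>R x) = r *\<^sub>R L x"
  using subspace_mul[OF subspace_fs] by (intro acts_unique[OF acts_L acts_scaleR[OF acts_L]]) auto

lemma L_diff: "x \<in> fs \<Longrightarrow> y \<in> fs \<Longrightarrow> L (x - y) = L x - L y"
  using subspace_diff[OF subspace_fs] by (intro acts_unique[OF acts_L acts_diff[OF acts_L acts_L]]) auto

lemma norm_le_L: assumes "x \<in> fs" shows "norm x \<le> norm (L x + x)"
proof (cases "x = 0")
  case False
  have "norm x * norm x \<le> (L x + x) \<bullet> x"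
    using L_nonneg[OF assms] by (simp add: inner_add dot_square_norm power2_eq_square)
  also have "\<dots> \<le> norm (L x + x) * norm x" by (rule norm_cauchy_schwarz)
  finally show ?thesis using False by simp
qed simp

definition atom :: "complex \<Rightarrow> 'v \<Rightarrow> 'v ell2" where "atom c v = ell2_of (cscale c (delta v))"

lemma fn_atom: "fn (atom c v) w = (if w = v then c else 0)"
  by (simp add: atom_def delta_l2) (simp add: cscale_def delta_def)

lemma atom_fs: "atom c v \<in> fs"
  by (simp add: fs_def fn_atom)

lemma inner_atom: "atom c v \<bullet> x = c \<bullet> fn x v"
  by (subst inner_finite_support[of "{v}"]) (auto simp: fn_atom)

text \<open>Together with non-negativity this is essential selfadjointness on \<open>fs\<close>. An
  element orthogonal to the range, tested against atoms, solves the equation pointwise and vanishes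
  by \<open>maximum_principle\<close>.\<close>

lemma range_dense: "closure ((\<lambda>x. L x + x) ` fs) = UNIV"
proof -
  have sub: "subspace ((\<lambda>x. L x + x) ` fs)"
    unfolding subspace_def
  proof (safe)
    show "0 \<in> (\<lambda>x. L x + x) ` fs"
      using L_scaleR[OF atom_fs, of 0] subspace_0[OF subspace_fs] by (intro image_eqI[of _ _ 0]) auto
  next
    fix x y :: "'v ell2" assume "x \<in> fs" "y \<in> fs"
    then show "L x + x + (L y + y) \<in> (\<lambda>x. L x + x) ` fs"
      by (intro image_eqI[of _ _ "x + y"]) (auto simp: L_add subspace_add[OF subspace_fs])
  next
    fix x :: "'v ell2" and r :: real assume "x \<in> fs"
    then show "r *\<^sub>R (L x + x) \<in> (\<lambda>x. L x + x) ` fs"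
      by (intro image_eqI[of _ _ "r *\<^sub>R x"]) (auto simp: L_scaleR subspace_mul[OF subspace_fs] algebra_simps)
  qed
  have "x \<in> closure ((\<lambda>x. L x + x) ` fs)" for x
  proof -
    obtain c where c: "c \<in> closure ((\<lambda>x. L x + x) ` fs)"
      "\<And>s. s \<in> (\<lambda>x. L x + x) ` fs \<Longrightarrow> (x - c) \<bullet> s = 0"
      using projection_exists[OF sub] by blast
    define y where "y = x - c"
    have "lap (fn y) v + fn y v = 0" for v
    proof -
      \<comment> \<open>The inner product is real, so all complex \<open>d\<close> are needed to
        make both the real and the imaginary part vanish.\<close>
      have "d \<bullet> (lap (fn y) v + fn y v) = 0" for d
      proof -
        let ?a = "atom d v"
        define S where "S = {v} \<union> {w. E v w}"
        have S: "finite S" by (simp add: S_def)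
        have la: "fn (L ?a) w = (if w = v then g v *\<^sub>R d else 0) - (if E v w then d else 0)" for w
          unfolding fn_L[OF atom_fs] lap_def fn_atom
          by (subst neighbour_sum_eq[of "{v}"]) (auto simp: E_sym E_irrefl)
        have "(L ?a + ?a) \<bullet> y = (\<Sum>w\<in>S. fn (L ?a + ?a) w \<bullet> fn y w)"
          by (rule inner_finite_support[OF S]) (auto simp: la fn_atom S_def)
        also have "\<dots> = fn (L ?a + ?a) v \<bullet> fn y v + (\<Sum>w | E v w. fn (L ?a + ?a) w \<bullet> fn y w)"
          unfolding S_def by (subst sum.union_disjoint) (auto simp: E_irrefl)
        also have "(\<Sum>w | E v w. fn (L ?a + ?a) w \<bullet> fn y w) = (\<Sum>w | E v w. - (d \<bullet> fn y w))"
          by (intro sum.cong) (auto simp: la fn_atom E_irrefl)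
        also have "fn (L ?a + ?a) v \<bullet> fn y v + \<dots> = d \<bullet> (lap (fn y) v + fn y v)"
          by (simp add: la fn_atom E_irrefl lap_def inner_add inner_diff_right inner_sum_right sum_negf)
        finally show ?thesis using c(2)[of "L ?a + ?a"] atom_fs unfolding y_def by (simp add: inner_commute)
      qed
      then show ?thesis using inner_eq_zero_iff by blast
    qed
    then have "x - c = 0" unfolding y_def[symmetric] by (rule maximum_principle)
    then show ?thesis using c(1) by simp
  qed
  then show ?thesis by blast
qed

text \<open>Preimages of a sequence tending to \<eta> are Cauchy because \<open>L + 1\<close> does
  not decrease norms. The same sequence serves for solvability of the resolvent equation and for the
  core property.\<close>

lemma core_sequence:
  obtains X u where "\<And>n. X n \<in> fs" "X \<longlonglongrightarrow> u" "(\<lambda>n. L (X n)) \<longlonglongrightarrow> \<eta> - u"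
proof -
  have "\<eta> \<in> closure ((\<lambda>x. L x + x) ` fs)" by (simp add: range_dense)
  then obtain Y where Y: "\<And>n. Y n \<in> (\<lambda>x. L x + x) ` fs" "Y \<longlonglongrightarrow> \<eta>"
    unfolding closure_sequential by blast
  then have "\<forall>n. \<exists>x\<in>fs. Y n = L x + x" by blast
  then obtain X where X: "\<And>n. X n \<in> fs" "\<And>n. Y n = L (X n) + X n" by metis
  have "dist (X m) (X n) \<le> dist (Y m) (Y n)" for m n
    using norm_le_L[OF subspace_diff[OF subspace_fs X(1) X(1)], of m n]
    by (simp add: L_diff X dist_norm algebra_simps)
  then have "Cauchy X"
    using LIMSEQ_imp_Cauchy[OF Y(2)] unfolding Cauchy_def by (meson le_less_trans)
  then obtain u where u: "X \<longlonglongrightarrow> u" using Cauchy_convergent convergentD by blast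
  moreover have "(\<lambda>n. L (X n)) \<longlonglongrightarrow> \<eta> - u"
    using tendsto_diff[OF Y(2) u] by (simp add: X(2))
  ultimately show ?thesis using that X(1) by blast
qed

lemma acts_minus_unique: "acts u (\<eta> - u) \<Longrightarrow> acts u' (\<eta> - u') \<Longrightarrow> u = u'"
proof -
  assume "acts u (\<eta> - u)" "acts u' (\<eta> - u')"
  then have "acts (u - u') (\<eta> - u - (\<eta> - u'))" by (rule acts_diff)
  then have "lap (fn (u - u')) v + fn (u - u') v = 0" for v
    using acts_def[of "u - u'"] by (simp flip: \<open>acts (u - u') _\<close>[unfolded acts_def, rule_format])
  then have "u - u' = 0" by (rule maximum_principle)
  then show "u = u'" by simp
qed

text \<open>Approximate a solution \<open>u\<close> of the resolvent equation with right-hand side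
  \<open>y + x\<close>; uniqueness of the solution identifies \<open>u\<close> with
  \<open>x\<close>.\<close>

lemma core:
  assumes "acts x y"
  obtains X where "\<And>n. X n \<in> fs" "X \<longlonglongrightarrow> x" "(\<lambda>n. L (X n)) \<longlonglongrightarrow> y"
proof -
  obtain X u where X: "\<And>n. X n \<in> fs" "X \<longlonglongrightarrow> u" "(\<lambda>n. L (X n)) \<longlonglongrightarrow> (y + x) - u"
    using core_sequence[of "y + x"] by blast
  have "acts u ((y + x) - u)" by (rule acts_limit[OF X(2,3)]) (simp add: acts_L X(1))
  then have "u = x" using acts_minus_unique[of u "y + x" x] assms by simp
  then show ?thesis using that[of X] X by simp
qed

lemma acts_symmetric: assumes "acts x y" "acts x' y'" shows "y \<bullet> x' = x \<bullet> y'"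
proof -
  obtain X where X: "\<And>n. X n \<in> fs" "X \<longlonglongrightarrow> x" "(\<lambda>n. L (X n)) \<longlonglongrightarrow> y"
    using core[OF assms(1)] by blast
  have "(\<lambda>n. X n \<bullet> y') \<longlonglongrightarrow> x \<bullet> y'" by (intro tendsto_intros X)
  moreover have "(\<lambda>n. X n \<bullet> y') \<longlonglongrightarrow> y \<bullet> x'"
    unfolding green[OF X(1) assms(2), symmetric] by (intro tendsto_intros X)
  ultimately show ?thesis using LIMSEQ_unique by blast
qed

lemma acts_nonneg: assumes "acts x y" shows "0 \<le> y \<bullet> x"
proof -
  obtain X where X: "\<And>n. X n \<in> fs" "X \<longlonglongrightarrow> x" "(\<lambda>n. L (X n)) \<longlonglongrightarrow> y"
    using core[OF assms] by blast
  have "(\<lambda>n. L (X n) \<bullet> X n) \<longlonglongrightarrow> y \<bullet> x" by (intro tendsto_intros X)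
  then show ?thesis by (rule LIMSEQ_le_const) (simp add: L_nonneg X(1))
qed

section \<open>The resolvent at -1 as a bounded operator\<close>

lemma resolvent_exists: "\<exists>!u. acts u (\<eta> - u)"
proof -
  obtain X u where X: "\<And>n. X n \<in> fs" "X \<longlonglongrightarrow> u" "(\<lambda>n. L (X n)) \<longlonglongrightarrow> \<eta> - u"
    using core_sequence[of \<eta>] by blast
  have "acts u (\<eta> - u)" by (rule acts_limit[OF X(2,3)]) (simp add: acts_L X(1))
  then show ?thesis using acts_minus_unique by blast
qed

definition B_fun :: "'v ell2 \<Rightarrow> 'v ell2" where "B_fun \<eta> = (THE u. acts u (\<eta> - u))"

lemma acts_B_fun: "acts (B_fun \<eta>) (\<eta> - B_fun \<eta>)"
  unfolding B_fun_def by (rule theI'[OF resolvent_exists])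

lemma B_fun_eqI: "acts u (\<eta> - u) \<Longrightarrow> B_fun \<eta> = u"
  using acts_minus_unique acts_B_fun by blast

lemma bounded_linear_B_fun: "bounded_linear B_fun"
proof (rule bounded_linear_intro[where K=1])
  fix \<eta> \<zeta> :: "'v ell2" and r :: real
  show "B_fun (\<eta> + \<zeta>) = B_fun \<eta> + B_fun \<zeta>"
    using acts_add[OF acts_B_fun[of \<eta>] acts_B_fun[of \<zeta>]] by (intro B_fun_eqI) (simp add: algebra_simps)
  show "B_fun (r *\<^sub>R \<eta>) = r *\<^sub>R B_fun \<eta>"
    using acts_scaleR[OF acts_B_fun[of \<eta>], of r] by (intro B_fun_eqI) (simp add: algebra_simps)
  have "norm (B_fun \<eta>) * norm (B_fun \<eta>) \<le> \<eta> \<bullet> B_fun \<eta>"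
    using acts_nonneg[OF acts_B_fun[of \<eta>]] by (simp add: inner_diff dot_square_norm power2_eq_square)
  also have "\<dots> \<le> norm \<eta> * norm (B_fun \<eta>)" by (rule norm_cauchy_schwarz)
  finally show "norm (B_fun \<eta>) \<le> norm \<eta> * 1" by (cases "B_fun \<eta> = 0") auto
qed

lift_definition B :: "'v ell2 \<Rightarrow>\<^sub>L 'v ell2" is B_fun by (rule bounded_linear_B_fun)

lemma acts_B: "acts (blinfun_apply B \<eta>) (\<eta> - blinfun_apply B \<eta>)"
  by transfer (rule acts_B_fun)

lemma B_eqI: "acts u y \<Longrightarrow> blinfun_apply B (y + u) = u"
  by transfer (rule B_fun_eqI, simp)

lemma B_symmetric: "blinfun_apply B \<eta> \<bullet> \<zeta> = \<eta> \<bullet> blinfun_apply B \<zeta>"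
  using acts_symmetric[OF acts_B[of \<eta>] acts_B[of \<zeta>]] by (simp add: inner_diff)

lemma B_nonneg: "0 \<le> blinfun_apply B \<eta> \<bullet> \<eta>"
proof -
  have "0 \<le> blinfun_apply B \<eta> \<bullet> blinfun_apply B \<eta>" by simp
  also have "\<dots> \<le> blinfun_apply B \<eta> \<bullet> \<eta>"
    using acts_nonneg[OF acts_B[of \<eta>]] by (simp add: inner_diff inner_commute)
  finally show ?thesis .
qed

lemma B_le: "blinfun_apply B \<eta> \<bullet> \<eta> \<le> \<eta> \<bullet> \<eta>"
  using acts_nonneg[OF acts_B[of \<eta>]] inner_ge_zero[of "\<eta> - blinfun_apply B \<eta>"]
  by (simp add: inner_diff inner_commute del: inner_ge_zero)

lemma B_cs: "blinfun_apply B (cs c \<eta>) = cs c (blinfun_apply B \<eta>)"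
  using B_eqI[OF acts_cs[OF acts_B[of \<eta>], of c]] by (simp add: cs_diff)

lemma B_eq_0: "blinfun_apply B \<eta> = 0 \<Longrightarrow> \<eta> = 0"
proof -
  assume "blinfun_apply B \<eta> = 0"
  then have "acts 0 \<eta>" using acts_B[of \<eta>] by simp
  moreover have "acts (0 :: 'v ell2) 0" using acts_scaleR[OF acts_L[OF atom_fs], of 0] by simp
  ultimately show "\<eta> = 0" by (rule acts_unique)
qed

end

section \<open>Form comparison on sparse graphs\<close>

lemma sum_if_edge: "finite S \<Longrightarrow> (\<Sum>v\<in>S. \<Sum>w\<in>S. if E v w then c else 0)
    = real (card {(v, w). v \<in> S \<and> w \<in> S \<and> E v w}) * (c::real)"
  by (subst sum.cartesian_product)
    (auto simp: sum.If_cases case_prod_unfold intro!: arg_cong[where f=card])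

text \<open>Layer-cake decomposition: subtracting the minimum of \<open>h\<close> shrinks its support.\<close>

lemma sparse_min_sum:
  assumes sparse: "k_sparse k E" and "finite S" "\<And>v. v \<in> S \<Longrightarrow> (0::real) \<le> h v"
  shows "(\<Sum>v\<in>S. \<Sum>w\<in>S. if E v w then min (h v) (h w) else 0) \<le> k * (\<Sum>v\<in>S. h v)"
  using assms(2,3)
proof (induction S arbitrary: h rule: finite_psubset_induct)
  case (psubset S)
  show ?case
  proof (cases "S = {}")
    case False
    define m where "m = Min (h ` S)"
    define S' where "S' = {v\<in>S. m < h v}"
    have m: "0 \<le> m" "\<And>v. v \<in> S \<Longrightarrow> m \<le> h v"
      unfolding m_def using psubset False by auto
    have "m \<in> h ` S" unfolding m_def using psubset(1) False by (intro Min_in) auto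
    then obtain v0 where v0: "v0 \<in> S" "h v0 = m" by blast
    have sub: "S' \<subset> S" using v0 unfolding S'_def by auto
    have z: "h v = m" if "v \<in> S" "v \<notin> S'" for v
      using m(2)[OF that(1)] that unfolding S'_def by simp
    \<comment> \<open>The bottom layer, of height \<open>m\<close>, is split off every edge; what
      remains is the sum for \<open>h - m\<close>, which lives on the smaller set
      \<open>S'\<close>.\<close>
    have "(\<Sum>v\<in>S. \<Sum>w\<in>S. if E v w then min (h v) (h w) else 0)
        = (\<Sum>v\<in>S. \<Sum>w\<in>S. (if E v w then m else 0) + (if E v w then min (h v - m) (h w - m) else 0))"
      by (intro sum.cong) auto
    also have "\<dots> = real (card {(v, w). v \<in> S \<and> w \<in> S \<and> E v w}) * m
        + (\<Sum>v\<in>S. \<Sum>w\<in>S. if E v w then min (h v - m) (h w - m) else 0)"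
      by (simp only: sum.distrib sum_if_edge[OF psubset(1)])
    also have "(\<Sum>v\<in>S. \<Sum>w\<in>S. if E v w then min (h v - m) (h w - m) else 0)
        = (\<Sum>v\<in>S'. \<Sum>w\<in>S'. if E v w then min (h v - m) (h w - m) else 0)"
    proof -
      have "(\<Sum>w\<in>S. if E v w then min (h v - m) (h w - m) else 0)
          = (\<Sum>w\<in>S'. if E v w then min (h v - m) (h w - m) else 0)" if "v \<in> S" for v
        using psubset(1) m(2)[OF that] sub by (intro sum.mono_neutral_right) (auto simp: z)
      moreover have "(\<Sum>v\<in>S. \<Sum>w\<in>S'. if E v w then min (h v - m) (h w - m) else 0)
          = (\<Sum>v\<in>S'. \<Sum>w\<in>S'. if E v w then min (h v - m) (h w - m) else 0)"
        using psubset(1) sub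
        by (intro sum.mono_neutral_right ballI sum.neutral) (auto simp: z S'_def)
      ultimately show ?thesis by simp
    qed
    also have "\<dots> \<le> k * (\<Sum>v\<in>S'. h v - m)"
      by (rule psubset(2)[OF sub]) (simp add: S'_def)
    also have "(\<Sum>v\<in>S'. h v - m) = (\<Sum>v\<in>S. h v - m)"
      using psubset(1) sub by (intro sum.mono_neutral_left) (auto simp: z)
    \<comment> \<open>Sparseness of \<open>S\<close> pays for the bottom layer: the cardinality
      counts ordered pairs, hence is twice the number of edges.\<close>
    also have "real (card {(v, w). v \<in> S \<and> w \<in> S \<and> E v w}) * m \<le> k * real (card S) * m"
      using sparse psubset(1) m(1) by (intro mult_right_mono) (auto simp: k_sparse_def num_edges_def)
    finally show ?thesis by (simp add: sum_subtractf algebra_simps)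
  qed simp
qed

text \<open>Expand \<open>(a - \<epsilon> * b)\<^sup>2 / (2 * \<epsilon>) \<ge> 0\<close> and write
  the coefficient \<open>1 / (2 * \<epsilon>)\<close> of \<open>a\<^sup>2\<close> as
  \<open>\<epsilon> / 2\<close> plus the excess \<open>(1 / \<epsilon> - \<epsilon>) / 2\<close>.
  Exchanging \<open>a\<close> and \<open>b\<close> moves the excess to the smaller square. This is
  the origin of the constant in (a).\<close>

lemma product_le_weighted:
  fixes a b \<epsilon> :: real
  assumes "0 \<le> a" "0 \<le> b" "0 < \<epsilon>" "\<epsilon> \<le> 1"
  shows "a * b \<le> \<epsilon> * ((a\<^sup>2 + b\<^sup>2) / 2) + (1 / \<epsilon> - \<epsilon>) / 2 * min (a\<^sup>2) (b\<^sup>2)"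
proof -
  have *: "a * b \<le> \<epsilon> * ((a\<^sup>2 + b\<^sup>2) / 2) + (1 / \<epsilon> - \<epsilon>) / 2 * a\<^sup>2" for a b :: real
  proof -
    have "0 \<le> (a - \<epsilon> * b)\<^sup>2 / (2 * \<epsilon>)" using assms by simp
    also have "\<dots> = \<epsilon> * ((a\<^sup>2 + b\<^sup>2) / 2) + (1 / \<epsilon> - \<epsilon>) / 2 * a\<^sup>2 - a * b"
      using assms by (simp add: power2_eq_square field_simps)
    finally show ?thesis by simp
  qed
  show ?thesis
    using *[of a b] *[of b a] by (auto simp: min_def mult.commute add.commute)
qed

context graph_potential
begin

text \<open>The quadratic form of multiplication by \<open>g\<close>, intended for
  \<open>fs\<close>: for infinite support the sum is 0 by convention.\<close>

definition G :: "'v ell2 \<Rightarrow> real" where "G x = (\<Sum>v | fn x v \<noteq> 0. g v * (cmod (fn x v))\<^sup>2)"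

lemma norm_sq_fs: "x \<in> fs \<Longrightarrow> x \<bullet> x = (\<Sum>v | fn x v \<noteq> 0. (cmod (fn x v))\<^sup>2)"
  by (subst inner_finite_support[of "{v. fn x v \<noteq> 0}"]) (auto simp: fs_def power2_norm_eq_inner)

lemma G_eq:
  assumes "finite A" "\<And>v. v \<notin> A \<Longrightarrow> fn x v = 0"
  shows "G x = (\<Sum>v\<in>A. g v * (cmod (fn x v))\<^sup>2)"
  unfolding G_def using assms by (intro sum.mono_neutral_left) auto

text \<open>Up to sign the difference is the adjacency form, so one estimate of its absolute value
  yields both inequalities of (a). The symmetric part of the edge bound sums to at most
  \<open>\<epsilon> * G x\<close> because \<open>deg E v \<le> g v\<close>, and the minima are
  summed by \<open>sparse_min_sum\<close>.\<close>

lemma form_difference_le: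
  assumes sparse: "k_sparse k E" and x: "x \<in> fs" and \<epsilon>: "0 < \<epsilon>" "\<epsilon> \<le> 1"
  shows "\<bar>L x \<bullet> x - G x\<bar> \<le> \<epsilon> * G x + k / 2 * (1 / \<epsilon> - \<epsilon>) * (x \<bullet> x)"
proof -
  let ?S = "{v. fn x v \<noteq> 0}" and ?h = "\<lambda>v. (cmod (fn x v))\<^sup>2"
  define c where "c = (1 / \<epsilon> - \<epsilon>) / 2"
  have c: "0 \<le> c" using \<epsilon> order_trans[of \<epsilon> 1 "1 / \<epsilon>"] by (simp add: c_def)
  have S: "finite ?S" using x by (simp add: fs_def)
  have "\<bar>L x \<bullet> x - G x\<bar> = \<bar>\<Sum>v\<in>?S. \<Sum>w\<in>?S. if E v w then fn x w \<bullet> fn x v else 0\<bar>"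
    by (subst form_eq[OF x S]) (auto simp: G_def)
  also have "\<dots> \<le> (\<Sum>v\<in>?S. \<Sum>w\<in>?S. if E v w then cmod (fn x v) * cmod (fn x w) else 0)"
  proof (intro order_trans[OF sum_abs] sum_mono)
    fix v w
    show "\<bar>if E v w then fn x w \<bullet> fn x v else 0\<bar> \<le> (if E v w then cmod (fn x v) * cmod (fn x w) else 0)"
      using Cauchy_Schwarz_ineq2[of "fn x w" "fn x v"] by (simp add: mult.commute)
  qed
  also have "\<dots> \<le> (\<Sum>v\<in>?S. \<Sum>w\<in>?S. \<epsilon> * (if E v w then (?h v + ?h w) / 2 else 0)
      + c * (if E v w then min (?h v) (?h w) else 0))"
    unfolding c_def
    by (intro sum_mono) (use product_le_weighted[OF norm_ge_zero norm_ge_zero \<epsilon>] in auto)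
  also have "\<dots> = \<epsilon> * (\<Sum>v\<in>?S. \<Sum>w\<in>?S. if E v w then (?h v + ?h w) / 2 else 0)
      + c * (\<Sum>v\<in>?S. \<Sum>w\<in>?S. if E v w then min (?h v) (?h w) else 0)"
    by (simp only: sum.distrib sum_distrib_left)
  also have "\<dots> \<le> \<epsilon> * (\<Sum>v\<in>?S. deg E v * ?h v) + c * (k * (\<Sum>v\<in>?S. ?h v))"
    by (intro add_mono mult_left_mono edge_sum_le_deg sparse_min_sum S sparse) (use \<epsilon> c in auto)
  also have "\<dots> \<le> \<epsilon> * G x + c * (k * (\<Sum>v\<in>?S. ?h v))"
    unfolding G_def by (intro add_right_mono mult_left_mono sum_mono mult_right_mono) (use \<epsilon> q_nonneg in \<open>auto simp: g_def\<close>)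
  finally show ?thesis unfolding norm_sq_fs[OF x] c_def by (simp add: mult_ac)
qed

text \<open>Symmetry tested on \<open>x\<close> and \<open>cs \<i> x\<close> shows that the complex
  form is real, as comparisons in the order of complex numbers demand.\<close>

lemma acts_inner_imaginary: assumes "acts x y" shows "y \<bullet> cs \<i> x = 0"
proof -
  have "y \<bullet> cs \<i> x = x \<bullet> cs \<i> y" by (rule acts_symmetric[OF assms acts_cs[OF assms]])
  also have "\<dots> = - (y \<bullet> cs \<i> x)"
  proof -
    have "cs (- \<i>) x = - cs \<i> x" by (rule ell2_eqI) simp
    then show ?thesis using inner_cs_left[of \<i> y x] by (simp add: inner_commute)
  qed
  finally show ?thesis by simp
qed

lemma mult_op_fs:
  fixes h :: "'v \<Rightarrow> real"
  assumes x: "x \<in> fs"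
  obtains \<psi> where "(fn x, \<psi>) \<in> mult_op h"
    "l2_inner \<psi> (fn x) = complex_of_real (\<Sum>v | fn x v \<noteq> 0. h v * (cmod (fn x v))\<^sup>2)"
proof -
  let ?\<psi> = "\<lambda>v. complex_of_real (h v) * fn x v"
  have \<psi>: "?\<psi> \<in> l2"
    using x by (intro l2_finite_support) (auto simp: fs_def elim: rev_finite_subset)
  have "l2_inner ?\<psi> (fn x) = (\<Sum>\<^sub>\<infinity>v\<in>{v. fn x v \<noteq> 0}. complex_of_real (h v * (cmod (fn x v))\<^sup>2))"
    unfolding l2_inner_def by (rule infsum_cong_neutral) (auto simp: mult.assoc complex_norm_square[symmetric])
  also have "\<dots> = complex_of_real (\<Sum>v | fn x v \<noteq> 0. h v * (cmod (fn x v))\<^sup>2)"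
    using x by (simp add: fs_def)
  finally show ?thesis using \<psi> by (intro that[of ?\<psi>]) (auto simp: mult_op_def)
qed

theorem form_bounds:
  assumes sparse: "k_sparse k E" and \<epsilon>: "0 < \<epsilon>" "\<epsilon> \<le> 1"
  shows "op_le_on Cc (mult_op (\<lambda>v. (1 - \<epsilon>) * (deg E v + q v) - k / 2 * (1 / \<epsilon> - \<epsilon>))) (schroedinger_op E q)"
    and "op_le_on Cc (schroedinger_op E q) (mult_op (\<lambda>v. (1 + \<epsilon>) * (deg E v + q v) + k / 2 * (1 / \<epsilon> - \<epsilon>)))"
proof -
  have Cc: "\<exists>x\<in>fs. f = fn x" if "f \<in> Cc" for f :: "'v \<Rightarrow> complex"
    using that l2_finite_support[of f] by (intro bexI[of _ "ell2_of f"]) (auto simp: Cc_def fs_def)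
  have L: "(fn x, fn (L x)) \<in> schroedinger_op E q" "l2_inner (fn (L x)) (fn x) = complex_of_real (L x \<bullet> x)"
    if "x \<in> fs" for x
    using that acts_inner_imaginary[OF acts_L]
    by (auto simp: fn_schroedinger_op_iff acts_L l2_inner_fn complex_of_real_def)
  have cmono: "complex_of_real a \<le> complex_of_real b \<longleftrightarrow> a \<le> b" for a b
    by (simp add: less_eq_complex_def)
  have split: "(\<Sum>v | fn x v \<noteq> 0. (a * (deg E v + q v) + c) * (cmod (fn x v))\<^sup>2) = a * G x + c * (x \<bullet> x)"
    if "x \<in> fs" for x and a c :: real
    unfolding norm_sq_fs[OF that] G_def g_def sum_distrib_left sum.distrib[symmetric]
    by (intro sum.cong) (simp_all add: algebra_simps)
  show "op_le_on Cc (mult_op (\<lambda>v. (1 - \<epsilon>) * (deg E v + q v) - k / 2 * (1 / \<epsilon> - \<epsilon>))) (schroedinger_op E q)"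
    unfolding op_le_on_def
  proof
    fix f :: "'v \<Rightarrow> complex" assume "f \<in> Cc"
    then obtain x where x: "x \<in> fs" "f = fn x" using Cc by blast
    obtain \<psi> where \<psi>: "(fn x, \<psi>) \<in> mult_op (\<lambda>v. (1 - \<epsilon>) * (deg E v + q v) - k / 2 * (1 / \<epsilon> - \<epsilon>))"
      "l2_inner \<psi> (fn x) = complex_of_real (\<Sum>v | fn x v \<noteq> 0. ((1 - \<epsilon>) * (deg E v + q v) - k / 2 * (1 / \<epsilon> - \<epsilon>)) * (cmod (fn x v))\<^sup>2)"
      by (rule mult_op_fs[OF x(1)])
    have "l2_inner \<psi> (fn x) = complex_of_real ((1 - \<epsilon>) * G x + - (k / 2 * (1 / \<epsilon> - \<epsilon>)) * (x \<bullet> x))"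
      unfolding \<psi>(2) split[OF x(1), symmetric] by simp
    also have "\<dots> \<le> l2_inner (fn (L x)) (fn x)"
      using form_difference_le[OF sparse x(1) \<epsilon>] unfolding L(2)[OF x(1)] cmono
      by (simp add: abs_le_iff algebra_simps)
    finally show "\<exists>g h. (f, g) \<in> mult_op (\<lambda>v. (1 - \<epsilon>) * (deg E v + q v) - k / 2 * (1 / \<epsilon> - \<epsilon>)) \<and>
        (f, h) \<in> schroedinger_op E q \<and> l2_inner g f \<le> l2_inner h f"
      using \<psi>(1) L(1)[OF x(1)] x(2) by blast
  qed
  show "op_le_on Cc (schroedinger_op E q) (mult_op (\<lambda>v. (1 + \<epsilon>) * (deg E v + q v) + k / 2 * (1 / \<epsilon> - \<epsilon>)))"
    unfolding op_le_on_def
  proof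
    fix f :: "'v \<Rightarrow> complex" assume "f \<in> Cc"
    then obtain x where x: "x \<in> fs" "f = fn x" using Cc by blast
    obtain \<psi> where \<psi>: "(fn x, \<psi>) \<in> mult_op (\<lambda>v. (1 + \<epsilon>) * (deg E v + q v) + k / 2 * (1 / \<epsilon> - \<epsilon>))"
      "l2_inner \<psi> (fn x) = complex_of_real (\<Sum>v | fn x v \<noteq> 0. ((1 + \<epsilon>) * (deg E v + q v) + k / 2 * (1 / \<epsilon> - \<epsilon>)) * (cmod (fn x v))\<^sup>2)"
      by (rule mult_op_fs[OF x(1)])
    have "l2_inner (fn (L x)) (fn x) \<le> complex_of_real ((1 + \<epsilon>) * G x + k / 2 * (1 / \<epsilon> - \<epsilon>) * (x \<bullet> x))"
      using form_difference_le[OF sparse x(1) \<epsilon>] unfolding L(2)[OF x(1)] cmono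
      by (simp add: abs_le_iff algebra_simps)
    also have "\<dots> = l2_inner \<psi> (fn x)" unfolding \<psi>(2) split[OF x(1)] ..
    finally show "\<exists>g h. (f, g) \<in> schroedinger_op E q \<and>
        (f, h) \<in> mult_op (\<lambda>v. (1 + \<epsilon>) * (deg E v + q v) + k / 2 * (1 / \<epsilon> - \<epsilon>)) \<and> l2_inner g f \<le> l2_inner h f"
      using \<psi>(1) L(1)[OF x(1)] x(2) by blast
  qed
qed

end

section \<open>The square root and its domain\<close>

context graph_potential
begin

text \<open>With C and D the roots of B and 1 - B, the relation \<open>S\<close> is D C^(-1). Its
  square is (1 - B) B^(-1), which is \<Delta> + q.\<close>

lemma square_root_exists:
  "\<exists>S. selfadjoint_op S \<and> nonneg_op S \<and> S O S = schroedinger_op E q"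
proof -
  \<comment> \<open>Multiplication by \<open>\<i>\<close> as a real-linear bounded operator: it
    commutes with \<open>B\<close>, so the commutation clauses make \<open>C\<close> and
    \<open>D\<close> complex linear.\<close>
  define J :: "'v ell2 \<Rightarrow>\<^sub>L 'v ell2" where "J = Blinfun (cs \<i>)"
  have "bounded_linear (cs \<i> :: 'v ell2 \<Rightarrow> 'v ell2)"
    by (rule bounded_linear_intro[where K=1]) (auto simp: cs_add cs_scaleR)
  then have J: "blinfun_apply J x = cs \<i> x" for x
    unfolding J_def by (simp add: bounded_linear_Blinfun_apply)
  obtain C where C: "\<And>x y. blinfun_apply C x \<bullet> y = x \<bullet> blinfun_apply C y"
    "\<And>x. 0 \<le> blinfun_apply C x \<bullet> x" "\<And>x. blinfun_apply C x \<bullet> x \<le> x \<bullet> x"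
    "\<And>x. blinfun_apply C (blinfun_apply C x) = blinfun_apply B x"
    and C_comm: "\<And>A x. (\<And>y. blinfun_apply A (blinfun_apply B y) = blinfun_apply B (blinfun_apply A y)) \<Longrightarrow>
      blinfun_apply A (blinfun_apply C x) = blinfun_apply C (blinfun_apply A x)"
    by (rule blinfun_sqrt[OF B_symmetric B_nonneg B_le]) blast
  have I: "blinfun_apply (id_blinfun - B) x = x - blinfun_apply B x" for x
    by (simp add: blinfun.bilinear_simps)
  have I_sym: "blinfun_apply (id_blinfun - B) x \<bullet> y = x \<bullet> blinfun_apply (id_blinfun - B) y" for x y
    by (simp only: I inner_diff B_symmetric)
  have I_nonneg: "0 \<le> blinfun_apply (id_blinfun - B) x \<bullet> x" for x
    using B_le[of x] by (simp only: I inner_diff diff_ge_0_iff_ge)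
  have I_le: "blinfun_apply (id_blinfun - B) x \<bullet> x \<le> x \<bullet> x" for x
    using B_nonneg[of x] by (simp add: I inner_diff)
  obtain D where D: "\<And>x y. blinfun_apply D x \<bullet> y = x \<bullet> blinfun_apply D y"
    "\<And>x. 0 \<le> blinfun_apply D x \<bullet> x"
    "\<And>x. blinfun_apply D (blinfun_apply D x) = x - blinfun_apply B x"
    and D_comm: "\<And>A x. (\<And>y. blinfun_apply A (blinfun_apply B y) = blinfun_apply B (blinfun_apply A y)) \<Longrightarrow>
      blinfun_apply A (blinfun_apply D x) = blinfun_apply D (blinfun_apply A x)"
  proof (rule blinfun_sqrt[OF I_sym I_nonneg I_le])
    fix D assume D: "\<And>x y. blinfun_apply D x \<bullet> y = x \<bullet> blinfun_apply D y"
      "\<And>x. 0 \<le> blinfun_apply D x \<bullet> x"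
      "\<And>x. blinfun_apply D (blinfun_apply D x) = blinfun_apply (id_blinfun - B) x"
      "\<And>A x. (\<And>y. blinfun_apply A (blinfun_apply (id_blinfun - B) y) = blinfun_apply (id_blinfun - B) (blinfun_apply A y)) \<Longrightarrow>
        blinfun_apply A (blinfun_apply D x) = blinfun_apply D (blinfun_apply A x)"
    show thesis
    proof (rule that[of D])
      show "blinfun_apply A (blinfun_apply D x) = blinfun_apply D (blinfun_apply A x)"
        if "\<And>y. blinfun_apply A (blinfun_apply B y) = blinfun_apply B (blinfun_apply A y)" for A x
        by (rule D(4)) (simp add: blinfun.bilinear_simps that)
      show "blinfun_apply D (blinfun_apply D x) = x - blinfun_apply B x" for x
        unfolding D(3) by (rule I)
    qed (fact D(1), fact D(2))
  qed
  have CD: "blinfun_apply C (blinfun_apply D x) = blinfun_apply D (blinfun_apply C x)" for x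
    by (intro D_comm C_comm[symmetric]) simp
  \<comment> \<open>A fourth root of \<open>B\<close>. It makes \<open>S\<close> visibly
    non-negative, because \<open>D u \<bullet> C u = D (C' u) \<bullet> C' u\<close>.\<close>
  obtain C' where C': "\<And>x y. blinfun_apply C' x \<bullet> y = x \<bullet> blinfun_apply C' y"
    "\<And>x. blinfun_apply C' (blinfun_apply C' x) = blinfun_apply C x"
    and C'_comm: "\<And>A x. (\<And>y. blinfun_apply A (blinfun_apply C y) = blinfun_apply C (blinfun_apply A y)) \<Longrightarrow>
      blinfun_apply A (blinfun_apply C' x) = blinfun_apply C' (blinfun_apply A x)"
    by (rule blinfun_sqrt[OF C(1,2,3)]) blast
  have CJ: "cs \<i> (blinfun_apply C x) = blinfun_apply C (cs \<i> x)"
    and DJ: "cs \<i> (blinfun_apply D x) = blinfun_apply D (cs \<i> x)" for x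
    using C_comm[of J x] D_comm[of J x] by (simp_all add: J B_cs)
  define S where "S = {(fn (blinfun_apply C u), fn (blinfun_apply D u)) | u. True}"
  \<comment> \<open>Since \<open>C\<^sup>2 + D\<^sup>2 = 1\<close> and \<open>C\<close>,
    \<open>D\<close> commute, \<open>D a = C b\<close> holds exactly if
    \<open>(a, b) = (C z, D z)\<close> for some \<open>z\<close>, and then
    \<open>z = C a + D b\<close>. Both the computation of \<open>S O S\<close> and that of the
    adjoint reduce to this.\<close>
  have split: "blinfun_apply C (blinfun_apply C a + blinfun_apply D b) = a \<and>
    blinfun_apply D (blinfun_apply C a + blinfun_apply D b) = b"
    if ab: "blinfun_apply D a = blinfun_apply C b" for a b
  proof
    have "blinfun_apply C (blinfun_apply C a + blinfun_apply D b) = blinfun_apply B a + blinfun_apply D (blinfun_apply C b)"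
      by (simp only: blinfun.add_right C(4) CD)
    also have "\<dots> = a" unfolding ab[symmetric] D(3) by simp
    finally show "blinfun_apply C (blinfun_apply C a + blinfun_apply D b) = a" .
    have "blinfun_apply D (blinfun_apply C a + blinfun_apply D b) = blinfun_apply C (blinfun_apply D a) + (b - blinfun_apply B b)"
      by (simp only: blinfun.add_right D(3) CD)
    also have "\<dots> = b" unfolding ab C(4) by simp
    finally show "blinfun_apply D (blinfun_apply C a + blinfun_apply D b) = b" .
  qed
  have "S O S = schroedinger_op E q"
  proof (rule subset_antisym; rule subrelI)
    fix \<phi> \<psi> assume "(\<phi>, \<psi>) \<in> S O S"
    then obtain u u' where u: "\<phi> = fn (blinfun_apply C u)" "\<psi> = fn (blinfun_apply D u')"
      "blinfun_apply D u = blinfun_apply C u'" by (auto simp: S_def fn_inject)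
    define z where "z = blinfun_apply C u + blinfun_apply D u'"
    have "blinfun_apply C u = blinfun_apply B z" "blinfun_apply D u' = z - blinfun_apply B z"
      using split[OF u(3)] C(4)[of z] D(3)[of z] unfolding z_def[symmetric] by simp_all
    then show "(\<phi>, \<psi>) \<in> schroedinger_op E q"
      using acts_B[of z] u by (simp add: fn_schroedinger_op_iff)
  next
    fix \<phi> \<psi> assume "(\<phi>, \<psi>) \<in> schroedinger_op E q"
    then obtain x y where xy: "\<phi> = fn x" "\<psi> = fn y" "acts x y" by (auto simp: schroedinger_op_iff)
    define z where "z = y + x"
    have x: "x = blinfun_apply C (blinfun_apply C z)" using B_eqI[OF xy(3)] by (simp add: z_def C(4))
    moreover have "y = blinfun_apply D (blinfun_apply D z)"
      unfolding D(3) using B_eqI[OF xy(3)] by (simp add: z_def)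
    moreover have S_mem: "(fn (blinfun_apply C u), fn (blinfun_apply D u)) \<in> S" for u by (auto simp: S_def)
    ultimately show "(\<phi>, \<psi>) \<in> S O S"
      using S_mem[of "blinfun_apply C z"] S_mem[of "blinfun_apply D z"] unfolding xy(1,2) CD by auto
  qed
  moreover have "nonneg_op S"
    unfolding nonneg_op_def S_def
  proof clarify
    fix u
    have "blinfun_apply D u \<bullet> blinfun_apply C u = blinfun_apply D (blinfun_apply C' u) \<bullet> blinfun_apply C' u"
      using C'_comm[of D u] CD C' by metis
    moreover have "blinfun_apply D u \<bullet> cs \<i> (blinfun_apply C u) = 0"
    proof -
      have "blinfun_apply D u \<bullet> cs \<i> (blinfun_apply C u) = blinfun_apply C u \<bullet> cs \<i> (blinfun_apply D u)"
        by (simp add: CJ DJ C(1) D(1) CD)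
      also have "\<dots> = cs (cnj \<i>) (blinfun_apply C u) \<bullet> blinfun_apply D u"
        using inner_cs_left[of "cnj \<i>" "blinfun_apply C u" "blinfun_apply D u"] by simp
      also have "cs (cnj \<i>) (blinfun_apply C u) = - cs \<i> (blinfun_apply C u)" by (rule ell2_eqI) simp
      finally show ?thesis by (simp add: inner_commute)
    qed
    ultimately show "0 \<le> l2_inner (fn (blinfun_apply D u)) (fn (blinfun_apply C u))"
      using D(2) by (simp add: l2_inner_fn less_eq_complex_def)
  qed
  moreover have "selfadjoint_op S"
    unfolding selfadjoint_op_def
  proof
    show "densely_defined S"
      unfolding densely_defined_def
    proof (intro ballI allI impI)
      fix \<phi> :: "'v \<Rightarrow> complex" and e :: real assume \<phi>: "\<phi> \<in> l2" and e: "0 < e"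
      define x where "x = ell2_of \<phi>"
      have "subspace (range (blinfun_apply C))"
        using blinfun.bounded_linear_right[of C] subspace_UNIV by (intro linear_subspace_image bounded_linear.linear)
      then obtain c where c: "c \<in> closure (range (blinfun_apply C))"
        "\<And>s. s \<in> range (blinfun_apply C) \<Longrightarrow> (x - c) \<bullet> s = 0"
        using projection_exists by metis
      have "blinfun_apply C (x - c) \<bullet> blinfun_apply C (x - c) = 0" unfolding C(1) by (rule c(2)) simp
      then have "blinfun_apply B (x - c) = 0" using C(4)[of "x - c"] by (simp add: blinfun.bilinear_simps)
      then have "x = c" using B_eq_0[of "x - c"] by simp
      then obtain u where u: "dist (blinfun_apply C u) x < e"
        using c(1) e unfolding closure_approachable by blast
      have "fn (x - blinfun_apply C u) = \<phi> - fn (blinfun_apply C u)"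
        using \<phi> by (simp add: x_def fun_eq_iff)
      then have "l2_norm (\<phi> - fn (blinfun_apply C u)) = norm (x - blinfun_apply C u)"
        using l2_norm_fn by metis
      then show "\<exists>\<psi>\<in>Domain S. l2_norm (\<phi> - \<psi>) < e"
        using u unfolding S_def by (intro bexI[of _ "fn (blinfun_apply C u)"]) (auto simp: dist_norm norm_minus_commute)
    qed
    show "adjoint_op S = S"
    proof (rule subset_antisym; rule subrelI)
      fix \<psi> \<eta> assume a: "(\<psi>, \<eta>) \<in> adjoint_op S"
      define x y where "x = ell2_of \<psi>" and "y = ell2_of \<eta>"
      have xy: "\<psi> = fn x" "\<eta> = fn y" using a by (auto simp: adjoint_op_def x_def y_def)
      have "blinfun_apply D u \<bullet> x = blinfun_apply C u \<bullet> y" for u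
      proof -
        have "(fn (blinfun_apply C u), fn (blinfun_apply D u)) \<in> S" by (auto simp: S_def)
        then have "l2_inner (fn (blinfun_apply D u)) (fn x) = l2_inner (fn (blinfun_apply C u)) (fn y)"
          using a unfolding adjoint_op_def xy by blast
        then show ?thesis by (simp add: l2_inner_fn)
      qed
      then have "u \<bullet> (blinfun_apply D x - blinfun_apply C y) = 0" for u
        by (simp add: inner_diff_right flip: C(1) D(1))
      then have "blinfun_apply D x = blinfun_apply C y" using inner_eq_zero_iff by (metis right_minus_eq)
      note split[OF this]
      moreover have "(fn (blinfun_apply C u), fn (blinfun_apply D u)) \<in> S" for u by (auto simp: S_def)
      note this[of "blinfun_apply C x + blinfun_apply D y"]
      ultimately show "(\<psi>, \<eta>) \<in> S" unfolding xy by simp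
    next
      fix \<psi> \<eta> assume "(\<psi>, \<eta>) \<in> S"
      then obtain u where u: "\<psi> = fn (blinfun_apply C u)" "\<eta> = fn (blinfun_apply D u)" by (auto simp: S_def)
      have "l2_inner (fn (blinfun_apply D w)) (fn (blinfun_apply C u)) = l2_inner (fn (blinfun_apply C w)) (fn (blinfun_apply D u))" for w
        by (simp add: l2_inner_fn CJ DJ C(1) D(1) CD)
      then show "(\<psi>, \<eta>) \<in> adjoint_op S" unfolding adjoint_op_def u S_def by auto
    qed
  qed
  ultimately show ?thesis by blast
qed

text \<open>The finitely supported functions form a core of the square root, so its domain is their
  completion in the form norm.\<close>

definition form_domain :: "('v \<Rightarrow> complex) set" where
  "form_domain = {fn u | u. \<exists>X. (\<forall>n. X n \<in> fs) \<and> X \<longlonglongrightarrow> u \<and>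
    (\<forall>e>0. \<exists>N. \<forall>m\<ge>N. \<forall>n\<ge>N. L (X m - X n) \<bullet> (X m - X n) < e)}"

text \<open>On \<open>fs\<close> the squared norm of S x is \<open>L x \<bullet> x\<close>, so
  convergence in the graph norm of \<open>S\<close> is convergence in the form norm. It remains that
  \<open>fs\<close> is dense in the domain for the graph norm, which comes from
  \<open>range_dense\<close>.\<close>

lemma Domain_square_root:
  assumes sa: "selfadjoint_op S" and SS: "S O S = schroedinger_op E q"
  shows "Domain S = form_domain"
proof -
  define s where "s u w \<longleftrightarrow> (fn u, fn w) \<in> S" for u w
  have adj: "adjoint_op S = S" using sa by (simp add: selfadjoint_op_def)
  have S_iff: "(\<phi>, \<psi>) \<in> S \<longleftrightarrow> (\<exists>u w. \<phi> = fn u \<and> \<psi> = fn w \<and> s u w)" for \<phi> \<psi>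
  proof
    assume a: "(\<phi>, \<psi>) \<in> S"
    then have "(\<phi>, \<psi>) \<in> adjoint_op S" by (simp only: adj)
    then have "\<phi> \<in> l2" "\<psi> \<in> l2" by (auto simp: adjoint_op_def)
    then show "\<exists>u w. \<phi> = fn u \<and> \<psi> = fn w \<and> s u w"
      using a by (intro exI[of _ "ell2_of \<phi>"] exI[of _ "ell2_of \<psi>"]) (simp add: s_def)
  qed (auto simp: s_def)
  \<comment> \<open>As \<open>S\<close> is its own adjoint, membership amounts to a family of
    continuous linear equations in \<open>(u, w)\<close>; linearity and closedness of
    \<open>s\<close> are read off from it.\<close>
  have s_iff: "s u w \<longleftrightarrow> (\<forall>u' w'. s u' w' \<longrightarrow> w' \<bullet> u = u' \<bullet> w \<and> w' \<bullet> cs \<i> u = u' \<bullet> cs \<i> w)" for u w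
  proof -
    have "s u w \<longleftrightarrow> (fn u, fn w) \<in> adjoint_op S" by (simp add: s_def adj)
    also have "\<dots> \<longleftrightarrow> (\<forall>\<phi> \<xi>. (\<phi>, \<xi>) \<in> S \<longrightarrow> l2_inner \<xi> (fn u) = l2_inner \<phi> (fn w))"
      by (auto simp: adjoint_op_def)
    also have "\<dots> \<longleftrightarrow> (\<forall>u' w'. s u' w' \<longrightarrow> l2_inner (fn w') (fn u) = l2_inner (fn u') (fn w))"
      unfolding S_iff by blast
    finally show ?thesis by (simp add: l2_inner_fn)
  qed
  have sym: "w' \<bullet> u = u' \<bullet> w" if "s u w" "s u' w'" for u w u' w'
    using that s_iff by blast
  have s_add: "s (u + u') (w + w')" if "s u w" "s u' w'" for u w u' w'
    using that unfolding s_iff[of u] s_iff[of u'] s_iff[of "u + u'"] by (simp add: inner_add cs_add)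
  have s_scale: "s (r *\<^sub>R u) (r *\<^sub>R w)" if "s u w" for u w and r :: real
    using that unfolding s_iff[of u] s_iff[of "r *\<^sub>R u"] by (simp add: cs_scaleR)
  have s_diff: "s (u - u') (w - w')" if "s u w" "s u' w'" for u w u' w'
    using s_add[OF that(1) s_scale[OF that(2), of "-1"]] by simp
  have blc: "bounded_linear (cs c :: 'v ell2 \<Rightarrow> 'v ell2)" for c
    by (rule bounded_linear_intro[where K="cmod c"]) (auto simp: cs_add cs_scaleR)
  have s_limit: "s u w" if "X \<longlonglongrightarrow> u" "W \<longlonglongrightarrow> w" "\<And>n. s (X n) (W n)" for X W u w
    unfolding s_iff[of u]
  proof (intro allI impI conjI)
    fix u' w' assume s': "s u' w'"
    show "w' \<bullet> u = u' \<bullet> w"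
    proof (rule LIMSEQ_unique)
      show "(\<lambda>n. w' \<bullet> X n) \<longlonglongrightarrow> w' \<bullet> u" by (intro tendsto_intros that)
      have "w' \<bullet> X n = u' \<bullet> W n" for n using s' that(3) s_iff by blast
      then show "(\<lambda>n. w' \<bullet> X n) \<longlonglongrightarrow> u' \<bullet> w" by (auto intro!: tendsto_intros that)
    qed
    show "w' \<bullet> cs \<i> u = u' \<bullet> cs \<i> w"
    proof (rule LIMSEQ_unique)
      show "(\<lambda>n. w' \<bullet> cs \<i> (X n)) \<longlonglongrightarrow> w' \<bullet> cs \<i> u"
        by (intro tendsto_intros bounded_linear.tendsto[OF blc] that)
      have "w' \<bullet> cs \<i> (X n) = u' \<bullet> cs \<i> (W n)" for n using s' that(3) s_iff by blast
      then show "(\<lambda>n. w' \<bullet> cs \<i> (X n)) \<longlonglongrightarrow> u' \<bullet> cs \<i> w"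
        by (auto intro!: tendsto_intros bounded_linear.tendsto[OF blc] that)
    qed
  qed
  have "\<exists>w. s x w \<and> s w (L x)" if "x \<in> fs" for x
  proof -
    have "(fn x, fn (L x)) \<in> S O S" unfolding SS fn_schroedinger_op_iff by (rule acts_L[OF that])
    then obtain \<theta> where "(fn x, \<theta>) \<in> S" "(\<theta>, fn (L x)) \<in> S" by blast
    then obtain w where "\<theta> = fn w" "s x w" "s w (L x)" unfolding S_iff by (metis fn_inject)
    then show ?thesis by metis
  qed
  then obtain R where R: "\<And>x. x \<in> fs \<Longrightarrow> s x (R x)" "\<And>x. x \<in> fs \<Longrightarrow> s (R x) (L x)" by metis
  \<comment> \<open>Single-valuedness: all atoms lie in the domain of \<open>S\<close>, so the
    difference of two images is orthogonal to every atom.\<close>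
  have unique: "w = w'" if "s u w" "s u w'" for u w w'
  proof (rule ell2_eqI)
    fix v
    have "c \<bullet> fn (w - w') v = 0" for c
    proof -
      have "R (atom c v) \<bullet> (u - u) = atom c v \<bullet> (w - w')"
        by (rule sym[OF s_diff[OF that] R(1)[OF atom_fs]])
      then show ?thesis unfolding inner_atom by simp
    qed
    then have "fn (w - w') v = 0" using inner_eq_zero_iff by blast
    then show "fn w v = fn w' v" by simp
  qed
  have R_diff: "R (x - y) = R x - R y" if "x \<in> fs" "y \<in> fs" for x y
    using that subspace_diff[OF subspace_fs] by (intro unique[OF R(1) s_diff[OF R(1) R(1)]]) auto
  have norm_R: "(norm (R x))\<^sup>2 = L x \<bullet> x" if "x \<in> fs" for x
    using sym[OF R(1)[OF that] R(2)[OF that]] by (simp add: power2_norm_eq_inner)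
  have dist_R: "(dist (R x) (R y))\<^sup>2 = L (x - y) \<bullet> (x - y)" if "x \<in> fs" "y \<in> fs" for x y
    using norm_R[OF subspace_diff[OF subspace_fs that]] that by (simp add: dist_norm R_diff)
  show ?thesis
  proof (intro set_eqI iffI)
    fix \<phi> assume "\<phi> \<in> Domain S"
    then obtain u w where u: "\<phi> = fn u" "s u w" by (auto simp: S_iff)
    let ?\<Gamma> = "(\<lambda>x. (x, R x)) ` fs"
    have R_scale: "R (r *\<^sub>R x) = r *\<^sub>R R x" if "x \<in> fs" for x and r :: real
      using that subspace_mul[OF subspace_fs] by (intro unique[OF R(1) s_scale[OF R(1)]]) auto
    have R_add: "R (x + y) = R x + R y" if "x \<in> fs" "y \<in> fs" for x y
      using that subspace_add[OF subspace_fs] by (intro unique[OF R(1) s_add[OF R(1) R(1)]]) auto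
    have "subspace ?\<Gamma>"
      unfolding subspace_def
    proof (intro conjI ballI allI; (elim imageE)?; (hypsubst)?)
      have "R 0 = 0" using R_scale[OF subspace_0[OF subspace_fs], of 0] by simp
      then show "0 \<in> ?\<Gamma>" using subspace_0[OF subspace_fs] by (intro image_eqI[of _ _ 0]) (auto simp: zero_prod_def)
    next
      fix x y :: "'v ell2" assume "x \<in> fs" "y \<in> fs"
      then show "(x, R x) + (y, R y) \<in> ?\<Gamma>"
        by (intro image_eqI[of _ _ "x + y"]) (auto simp: R_add subspace_add[OF subspace_fs])
    next
      fix x :: "'v ell2" and r :: real assume "x \<in> fs"
      then show "r *\<^sub>R (x, R x) \<in> ?\<Gamma>"
        by (intro image_eqI[of _ _ "r *\<^sub>R x"]) (auto simp: R_scale subspace_mul[OF subspace_fs])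
    qed
    \<comment> \<open>Projection in the product space onto the closed graph over \<open>fs\<close>.
      The remainder \<open>(a, b)\<close> again belongs to \<open>s\<close>, so
      \<open>b \<bullet> R x = a \<bullet> L x\<close>, and orthogonality to all
      \<open>(x, R x)\<close> says that \<open>a\<close> is orthogonal to the range of
      \<open>L + 1\<close>.\<close>
    then obtain c where c: "c \<in> closure ?\<Gamma>" "\<And>p. p \<in> ?\<Gamma> \<Longrightarrow> ((u, w) - c) \<bullet> p = 0"
      using projection_exists by metis
    then obtain P where P: "\<And>n. P n \<in> ?\<Gamma>" "P \<longlonglongrightarrow> c" unfolding closure_sequential by blast
    define X where "X n = fst (P n)" for n
    have X: "X n \<in> fs" "P n = (X n, R (X n))" for n using P(1)[of n] by (auto simp: X_def)
    have lim: "X \<longlonglongrightarrow> fst c" "(\<lambda>n. R (X n)) \<longlonglongrightarrow> snd c"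
      using tendsto_fst[OF P(2)] tendsto_snd[OF P(2)] by (simp_all add: X(2))
    define a b where "a = u - fst c" and "b = w - snd c"
    have ab: "s a b" unfolding a_def b_def by (intro s_diff u(2) s_limit[OF lim] R(1) X(1))
    have orth: "a \<bullet> (L x + x) = 0" if x: "x \<in> fs" for x
    proof -
      have "a \<bullet> x + b \<bullet> R x = 0"
        using c(2)[of "(x, R x)"] x by (simp add: a_def b_def inner_prod_def)
      moreover have "b \<bullet> R x = a \<bullet> L x" using sym[OF R(2)[OF x] ab] by simp
      ultimately show ?thesis by (simp add: inner_add_right)
    qed
    have "closure ((\<lambda>x. L x + x) ` fs) \<subseteq> {y. a \<bullet> y = 0}"
      using orth by (intro closure_minimal closed_Collect_eq continuous_intros) auto
    then have "a \<bullet> a = 0" unfolding range_dense by blast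
    then have "u = fst c" by (simp add: a_def)
    moreover have "\<exists>N. \<forall>m\<ge>N. \<forall>n\<ge>N. L (X m - X n) \<bullet> (X m - X n) < e" if "0 < e" for e
    proof -
      have "0 < sqrt e" using that by simp
      then obtain N where "\<forall>m\<ge>N. \<forall>n\<ge>N. dist (R (X m)) (R (X n)) < sqrt e"
        using LIMSEQ_imp_Cauchy[OF lim(2)] unfolding Cauchy_def by blast
      then have "\<forall>m\<ge>N. \<forall>n\<ge>N. (dist (R (X m)) (R (X n)))\<^sup>2 < e"
        using that by (metis power_strict_mono real_sqrt_pow2 zero_le_dist less_imp_le zero_less_numeral)
      then show ?thesis unfolding dist_R[OF X(1) X(1)] by blast
    qed
    ultimately show "\<phi> \<in> form_domain"
      unfolding form_domain_def u(1) using X(1) lim(1) by blast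
  next
    fix \<phi> assume "\<phi> \<in> form_domain"
    then obtain u X where u: "\<phi> = fn u" "\<And>n. X n \<in> fs" "X \<longlonglongrightarrow> u"
      and cauchy: "\<And>e. 0 < e \<Longrightarrow> \<exists>N. \<forall>m\<ge>N. \<forall>n\<ge>N. L (X m - X n) \<bullet> (X m - X n) < e"
      unfolding form_domain_def by blast
    have "Cauchy (\<lambda>n. R (X n))"
      unfolding Cauchy_def
    proof (intro allI impI)
      fix e :: real assume e: "0 < e"
      obtain N where "\<forall>m\<ge>N. \<forall>n\<ge>N. L (X m - X n) \<bullet> (X m - X n) < e\<^sup>2"
        using cauchy[of "e\<^sup>2"] e by auto
      then have "\<forall>m\<ge>N. \<forall>n\<ge>N. dist (R (X m)) (R (X n)) < e"
        unfolding dist_R[OF u(2) u(2), symmetric] using e by (meson less_imp_le power2_less_imp_less)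
      then show "\<exists>N. \<forall>m\<ge>N. \<forall>n\<ge>N. dist (R (X m)) (R (X n)) < e" by blast
    qed
    then obtain w where "(\<lambda>n. R (X n)) \<longlonglongrightarrow> w" using Cauchy_convergent convergentD by blast
    then have "s u w" using s_limit[OF u(3)] R(1) u(2) by blast
    then show "\<phi> \<in> Domain S" unfolding s_def u(1) by blast
  qed
qed

lemma Domain_sqrt_op: "Domain (sqrt_op (schroedinger_op E q)) = form_domain"
proof -
  let ?P = "\<lambda>S. selfadjoint_op S \<and> nonneg_op S \<and> S O S = schroedinger_op E q"
  have "?P (sqrt_op (schroedinger_op E q))"
    unfolding sqrt_op_def using square_root_exists by (rule someI_ex)
  then show ?thesis by (intro Domain_square_root) auto
qed

end

section \<open>Resolvent set and spectrum\<close>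

context graph_potential
begin

abbreviation "T \<equiv> schroedinger_op E q"

definition bounded_below_at :: "complex \<Rightarrow> bool" where
  "bounded_below_at z \<longleftrightarrow> (\<exists>c>0. \<forall>x y. acts x y \<longrightarrow> c * norm x \<le> norm (y - cs z x))"

lemma fn_diff_cs: "fn y - cscale z (fn x) = fn (y - cs z x)"
  by (simp add: fun_eq_iff cscale_def)

lemma shift_op_iff: "(\<phi>, \<eta>) \<in> shift_op T z \<longleftrightarrow> (\<exists>x y. acts x y \<and> \<phi> = fn x \<and> \<eta> = fn (y - cs z x))"
  unfolding shift_op_def schroedinger_op_iff fn_diff_cs[symmetric] by auto

text \<open>Selfadjointness of the maximal operator: testing with \<open>x = B \<eta>\<close> and
  using symmetry of \<open>B\<close> gives \<open>w = B (w + v)\<close>.\<close>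

lemma acts_if_adjoint:
  assumes "\<And>x y. acts x y \<Longrightarrow> y \<bullet> w = x \<bullet> v" shows "acts w v"
proof -
  have "\<eta> \<bullet> (w - blinfun_apply B (w + v)) = 0" for \<eta>
    using assms[OF acts_B[of \<eta>]] B_symmetric[of \<eta> "w + v"] by (simp add: inner_diff inner_add)
  then have "w - blinfun_apply B (w + v) = 0" using inner_eq_zero_iff by blast
  then have "blinfun_apply B (w + v) = w" by simp
  then show ?thesis using acts_B[of "w + v"] by simp
qed

text \<open>The mixed term is real, so \<open>z\<close> enters only through \<open>Re z\<close> and
  \<open>cmod z\<close>; in particular \<open>z\<close> and \<open>cnj z\<close> give the same
  norm.\<close>

lemma norm_shift_sq:
  assumes "acts x y"
  shows "(norm (y - cs z x))\<^sup>2 = y \<bullet> y - 2 * Re z * (y \<bullet> x) + (cmod z)\<^sup>2 * (x \<bullet> x)"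
proof -
  have "y \<bullet> cs z x = Re z * (y \<bullet> x)"
    using acts_inner_imaginary[OF assms] by (subst cs_complex) (simp add: inner_add_right)
  moreover have "cs z x \<bullet> cs z x = (cmod z)\<^sup>2 * (x \<bullet> x)"
    by (simp add: dot_square_norm power_mult_distrib)
  ultimately show ?thesis
    unfolding power2_norm_eq_inner by (simp add: inner_diff inner_commute)
qed

text \<open>A lower bound makes the range of T - z closed. It is also dense: an element orthogonal
  to it is an eigenvector for \<open>cnj z\<close>, and by \<open>norm_shift_sq\<close> T - z
  annihilates it too, so the lower bound forces it to vanish.\<close>

lemma resolvent_set_iff: "z \<in> resolvent_set T \<longleftrightarrow> bounded_below_at z"
proof
  assume "z \<in> resolvent_set T"
  then obtain C where "\<forall>(\<phi>, \<eta>)\<in>shift_op T z. l2_norm \<phi> \<le> C * l2_norm \<eta>"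
    unfolding resolvent_set_def by blast
  then have C: "norm x \<le> C * norm (y - cs z x)" if "acts x y" for x y
    using that shift_op_iff[of "fn x" "fn (y - cs z x)" z] by (metis (no_types, lifting) case_prodD l2_norm_fn)
  have "1 / (\<bar>C\<bar> + 1) * norm x \<le> norm (y - cs z x)" if "acts x y" for x y
  proof -
    have "C * norm (y - cs z x) \<le> (\<bar>C\<bar> + 1) * norm (y - cs z x)" by (intro mult_right_mono) auto
    then show ?thesis using C[OF that] by (simp add: field_simps)
  qed
  then show "bounded_below_at z" unfolding bounded_below_at_def by (intro exI[of _ "1 / (\<bar>C\<bar> + 1)"]) auto
next
  assume "bounded_below_at z"
  then obtain c where c: "0 < c" "\<And>x y. acts x y \<Longrightarrow> c * norm x \<le> norm (y - cs z x)"
    unfolding bounded_below_at_def by blast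
  have "\<exists>x y. acts x y \<and> \<eta> = y - cs z x" for \<eta>
  proof -
    let ?R = "{y - cs z x | x y. acts x y}"
    have "subspace ?R"
      unfolding subspace_def
    proof (intro conjI ballI allI)
      have "acts (0 :: 'v ell2) 0" using acts_scaleR[OF acts_L[OF atom_fs], of 0] by simp
      moreover have "(0 :: 'v ell2) = 0 - cs z 0" by (rule ell2_eqI) simp
      ultimately show "0 \<in> ?R" by blast
    next
      fix a b assume "a \<in> ?R" "b \<in> ?R"
      then obtain x y x' y' where "a = y - cs z x" "acts x y" "b = y' - cs z x'" "acts x' y'" by blast
      then show "a + b \<in> ?R"
        by (intro CollectI exI[of _ "x + x'"] exI[of _ "y + y'"]) (simp add: acts_add cs_add)
    next
      fix a and r :: real assume "a \<in> ?R"
      then obtain x y where "a = y - cs z x" "acts x y" by blast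
      then show "r *\<^sub>R a \<in> ?R"
        by (intro CollectI exI[of _ "r *\<^sub>R x"] exI[of _ "r *\<^sub>R y"]) (simp add: acts_scaleR cs_scaleR scaleR_diff_right)
    qed
    then obtain d where d: "d \<in> closure ?R" "\<And>s. s \<in> ?R \<Longrightarrow> (\<eta> - d) \<bullet> s = 0"
      using projection_exists[of ?R \<eta>] by blast
    define w where "w = \<eta> - d"
    have "acts w (cs (cnj z) w)"
    proof (rule acts_if_adjoint)
      fix x y assume xy: "acts x y"
      then have "w \<bullet> (y - cs z x) = 0" using d(2) unfolding w_def by blast
      then show "y \<bullet> w = x \<bullet> cs (cnj z) w"
        using inner_cs_left[of z x w] by (simp add: inner_diff_right inner_commute)
    qed
    note w = this
    have "(norm (cs (cnj z) w - cs z w))\<^sup>2 = (norm (cs (cnj z) w - cs (cnj z) w))\<^sup>2"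
      unfolding norm_shift_sq[OF w] by simp
    then have "c * norm w \<le> 0" using c(2)[OF w] by simp
    then have "w = 0" using c(1) by (simp add: mult_le_0_iff)
    then have "\<eta> \<in> closure ?R" using d(1) by (simp add: w_def)
    then obtain P where P: "\<And>n. P n \<in> ?R" "P \<longlonglongrightarrow> \<eta>" unfolding closure_sequential by blast
    then obtain X Y where XY: "\<And>n. P n = Y n - cs z (X n)" "\<And>n. acts (X n) (Y n)"
      by (simp only: mem_Collect_eq) metis
    have "Cauchy X"
      unfolding Cauchy_def
    proof (intro allI impI)
      fix e :: real assume "0 < e"
      then have "0 < c * e" using c(1) by simp
      then obtain N where N: "\<And>m n. N \<le> m \<Longrightarrow> N \<le> n \<Longrightarrow> dist (P m) (P n) < c * e"
        using LIMSEQ_imp_Cauchy[OF P(2)] unfolding Cauchy_def by metis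
      have "dist (X m) (X n) < e" if "N \<le> m" "N \<le> n" for m n
      proof -
        have "c * norm (X m - X n) \<le> norm (Y m - Y n - cs z (X m - X n))"
          by (intro c(2) acts_diff XY)
        also have "Y m - Y n - cs z (X m - X n) = P m - P n" by (simp add: XY(1) cs_diff)
        also have "norm (P m - P n) < c * e" using N[OF that] by (simp add: dist_norm)
        finally show ?thesis using c(1) by (simp add: dist_norm)
      qed
      then show "\<exists>M. \<forall>m\<ge>M. \<forall>n\<ge>M. dist (X m) (X n) < e" by blast
    qed
    then obtain x where x: "X \<longlonglongrightarrow> x" using Cauchy_convergent convergentD by blast
    have blc: "bounded_linear (cs z :: 'v ell2 \<Rightarrow> 'v ell2)"
      by (rule bounded_linear_intro[where K="cmod z"]) (auto simp: cs_add cs_scaleR)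
    have "(\<lambda>n. P n + cs z (X n)) \<longlonglongrightarrow> \<eta> + cs z x"
      by (intro tendsto_add P(2) bounded_linear.tendsto[OF blc x])
    then have "Y \<longlonglongrightarrow> \<eta> + cs z x" by (simp add: XY(1))
    then have "acts x (\<eta> + cs z x)" by (rule acts_limit[OF x _ XY(2)])
    then show ?thesis by (intro exI[of _ x] exI[of _ "\<eta> + cs z x"]) simp
  qed
  then have ex: "\<exists>\<phi>. (\<phi>, \<eta>) \<in> shift_op T z" if "\<eta> \<in> l2" for \<eta>
    unfolding shift_op_iff using that by (metis fn_ell2_of)
  have bound: "l2_norm \<phi> \<le> 1 / c * l2_norm \<eta>" if "(\<phi>, \<eta>) \<in> shift_op T z" for \<phi> \<eta>
    using that c unfolding shift_op_iff by (auto simp: field_simps)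
  have uniq: "\<phi> = \<phi>'" if p: "(\<phi>, \<eta>) \<in> shift_op T z" "(\<phi>', \<eta>) \<in> shift_op T z" for \<phi> \<phi>' \<eta>
  proof -
    obtain x y where "acts x y" "\<phi> = fn x" "\<eta> = fn (y - cs z x)"
      using p(1) unfolding shift_op_iff by blast
    moreover obtain x' y' where "acts x' y'" "\<phi>' = fn x'" "\<eta> = fn (y' - cs z x')"
      using p(2) unfolding shift_op_iff by blast
    ultimately have xy: "acts x y" "\<phi> = fn x" "\<eta> = fn (y - cs z x)"
      "acts x' y'" "\<phi>' = fn x'" "\<eta> = fn (y' - cs z x')" by auto
    have "y - cs z x = y' - cs z x'" using xy by (simp add: fn_inject)
    then have "y - y' - cs z (x - x') = 0" by (simp add: cs_diff algebra_simps)
    then have "c * norm (x - x') \<le> 0" using c(2)[OF acts_diff[OF xy(1,4)]] by simp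
    then show ?thesis using c(1) xy(2,5) by (simp add: mult_le_0_iff)
  qed
  show "z \<in> resolvent_set T"
    unfolding resolvent_set_def mem_Collect_eq using ex uniq bound by blast
qed

lemma bounded_below_perturb:
  assumes "bounded_below_at z" shows "\<exists>e>0. \<forall>z'. dist z' z < e \<longrightarrow> bounded_below_at z'"
proof -
  obtain c where c: "0 < c" "\<And>x y. acts x y \<Longrightarrow> c * norm x \<le> norm (y - cs z x)"
    using assms unfolding bounded_below_at_def by blast
  have "bounded_below_at z'" if z': "dist z' z < c" for z'
    unfolding bounded_below_at_def
  proof (intro exI[of _ "c - dist z' z"] conjI allI impI)
    fix x y assume xy: "acts x y"
    have eq: "y - cs z x = (y - cs z' x) + cs (z' - z) x" by (rule ell2_eqI) (simp add: algebra_simps)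
    have "norm (y - cs z x) \<le> norm (y - cs z' x) + norm (cs (z' - z) x)"
      unfolding eq by (rule norm_triangle_ineq)
    then show "(c - dist z' z) * norm x \<le> norm (y - cs z' x)"
      using c(2)[OF xy] by (simp add: left_diff_distrib dist_norm)
  qed (use z' in simp)
  then show ?thesis using c(1) by blast
qed

lemma closed_spectrum: "closed (spectrum T)"
proof -
  have "open (resolvent_set T)"
    unfolding open_dist using bounded_below_perturb by (simp add: resolvent_set_iff)
  then show ?thesis by (simp add: spectrum_def closed_def)
qed

lemma spectrum_real_nonneg:
  assumes "z \<in> spectrum T" shows "Im z = 0" "0 \<le> Re z"
proof -
  have z: "\<not> bounded_below_at z" using assms by (simp add: spectrum_def resolvent_set_iff)
  show "Im z = 0"
  proof (rule ccontr)
    assume "Im z \<noteq> 0"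
    moreover have "\<bar>Im z\<bar> * norm x \<le> norm (y - cs z x)" if xy: "acts x y" for x y
    proof -
      have "(norm (y - cs z x))\<^sup>2 = (norm (y - cs (Re z) x))\<^sup>2 + (Im z)\<^sup>2 * (x \<bullet> x)"
        unfolding norm_shift_sq[OF xy] by (simp add: cmod_power2 algebra_simps)
      then have "(\<bar>Im z\<bar> * norm x)\<^sup>2 \<le> (norm (y - cs z x))\<^sup>2"
        by (simp add: power_mult_distrib power2_norm_eq_inner)
      then show ?thesis by (rule power2_le_imp_le) simp
    qed
    ultimately show False using z unfolding bounded_below_at_def by (metis zero_less_abs_iff)
  qed
  show "0 \<le> Re z"
  proof (rule ccontr)
    assume neg: "\<not> 0 \<le> Re z"
    have "- Re z * norm x \<le> norm (y - cs z x)" if xy: "acts x y" for x y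
    proof (cases "x = 0")
      case False
      have "y \<bullet> y - 2 * Re z * (y \<bullet> x) + (cmod z)\<^sup>2 * (x \<bullet> x) \<ge> (cmod z)\<^sup>2 * (x \<bullet> x)"
        using mult_nonpos_nonneg[of "2 * Re z" "y \<bullet> x"] acts_nonneg[OF xy] neg inner_ge_zero[of y]
        by linarith
      also have "(cmod z)\<^sup>2 * (x \<bullet> x) \<ge> (Re z)\<^sup>2 * (x \<bullet> x)"
        by (intro mult_right_mono) (auto simp: cmod_power2)
      finally have "(- Re z * norm x)\<^sup>2 \<le> (norm (y - cs z x))\<^sup>2"
        unfolding norm_shift_sq[OF xy] by (simp add: power_mult_distrib power2_norm_eq_inner)
      then show ?thesis by (rule power2_le_imp_le) simp
    qed simp
    moreover have "0 < - Re z" using neg by simp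
    ultimately show False using z unfolding bounded_below_at_def by blast
  qed
qed

section \<open>Eigenvectors, isolated spectral points and the complement of the eigenspaces\<close>

lemma eigenspace_iff: "\<phi> \<in> eigenspace T z \<longleftrightarrow> (\<exists>x. \<phi> = fn x \<and> acts x (cs z x))"
proof -
  have "cscale z (fn x) = fn (cs z x)" for x by (simp add: fun_eq_iff cscale_def)
  then show ?thesis unfolding eigenspace_def mem_Collect_eq schroedinger_op_iff by (metis fn_inject)
qed

lemma is_eigenvalue_iff: "is_eigenvalue T z \<longleftrightarrow> (\<exists>x. x \<noteq> 0 \<and> acts x (cs z x))"
proof -
  have "fn x \<noteq> 0 \<longleftrightarrow> x \<noteq> 0" for x :: "'v ell2"
    unfolding fn_inject[symmetric] by (simp add: fun_eq_iff)
  then show ?thesis unfolding is_eigenvalue_def Bex_def eigenspace_iff by metis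
qed

lemma eigenvalue_in_spectrum:
  assumes "acts x (cs z x)" "x \<noteq> 0" shows "z \<in> spectrum T"
proof (rule ccontr)
  assume "z \<notin> spectrum T"
  then obtain c where "0 < c" "c * norm x \<le> norm (cs z x - cs z x)"
    using assms(1) unfolding spectrum_def Compl_iff not_not resolvent_set_iff bounded_below_at_def by blast
  then show False using assms(2) by (simp add: mult_le_0_iff)
qed

lemma real_eigenvalue_nonneg:
  assumes "acts x (r *\<^sub>R x)" "x \<noteq> 0" shows "0 \<le> r"
  using eigenvalue_in_spectrum[of x "complex_of_real r"] spectrum_real_nonneg(2)[of "complex_of_real r"] assms
  by (simp add: cs_of_real)

lemma eigenvectors_orthogonal:
  assumes "acts x (r *\<^sub>R x)" "acts y (s *\<^sub>R y)" "r \<noteq> s" shows "x \<bullet> y = 0"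
  using acts_symmetric[OF assms(1,2)] assms(3) by simp

lemma isolated_spectrum:
  assumes "purely_discrete_spectrum T"
  shows "\<exists>e>0. \<forall>z'. z' \<noteq> z \<longrightarrow> dist z' z < e \<longrightarrow> bounded_below_at z'"
proof (cases "z \<in> spectrum T")
  case True
  then have "z isolated_in spectrum T"
    using assms by (auto simp: purely_discrete_spectrum_def essential_spectrum_def discrete_spectrum_def)
  then obtain U where U: "open U" "U \<inter> spectrum T = {z}" unfolding isolated_in_def by blast
  then obtain e where "0 < e" "\<And>z'. dist z' z < e \<Longrightarrow> z' \<in> U" unfolding open_dist by blast
  then show ?thesis
    using U(2) by (intro exI[of _ e]) (auto simp: spectrum_def simp flip: resolvent_set_iff)
next
  case False
  then show ?thesis using bounded_below_perturb[of z] by (auto simp: spectrum_def resolvent_set_iff)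
qed

text \<open>Eigenspaces are complex subspaces, so real orthogonality to them is complex orthogonality.\<close>

definition K :: "real \<Rightarrow> 'v ell2 set" where
  "K X = {w. \<forall>r\<le>X. \<forall>x. acts x (r *\<^sub>R x) \<longrightarrow> w \<bullet> x = 0}"

lemma closed_K: "closed (K X)"
proof -
  have "K X = (\<Inter>r\<in>{..X}. \<Inter>x\<in>{x. acts x (r *\<^sub>R x)}. {w. w \<bullet> x = 0})" by (auto simp: K_def)
  moreover have "closed {w. w \<bullet> x = 0}" for x :: "'v ell2"
    by (intro closed_Collect_eq continuous_intros)
  ultimately show ?thesis by (simp only:) (intro closed_INT ballI)
qed

text \<open>An eigenvector of T for \<open>r\<close> is one of \<open>B\<close> for
  \<open>1 / (r + 1)\<close>, so symmetry of \<open>B\<close> leaves the orthogonal complement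
  invariant.\<close>

lemma symmetric_on_K: "symmetric_on (K X) (blinfun_apply B)"
proof (rule symmetric_on.intro)
  show "subspace (K X)" by (auto simp: subspace_def K_def inner_add)
  show "bounded_linear (blinfun_apply B)" by (rule blinfun.bounded_linear_right)
  show "blinfun_apply B x \<bullet> y = x \<bullet> blinfun_apply B y" for x y by (rule B_symmetric)
  fix w assume w: "w \<in> K X"
  show "blinfun_apply B w \<in> K X"
    unfolding K_def
  proof (clarify)
    fix r x assume r: "r \<le> X" "acts x (r *\<^sub>R x)"
    show "blinfun_apply B w \<bullet> x = 0"
    proof (cases "x = 0")
      case False
      then have "0 \<le> r" using real_eigenvalue_nonneg r(2) by blast
      have "(r + 1) *\<^sub>R blinfun_apply B x = x"
        using B_eqI[OF r(2)] by (simp add: blinfun.bilinear_simps scaleR_add_left)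
      then have "(r + 1) * (w \<bullet> blinfun_apply B x) = w \<bullet> x" by (metis inner_scaleR_right)
      also have "\<dots> = 0" using w r unfolding K_def by blast
      finally show ?thesis using \<open>0 \<le> r\<close> by (simp add: B_symmetric)
    qed simp
  qed
qed

text \<open>The spectral mapping between \<open>B\<close> and T: for \<open>b = B w\<close>, the
  vector \<open>w - b - (1 / \<mu> - 1) b\<close> is
  \<open>- (1 / \<mu>) (b - \<mu> w)\<close>.\<close>

lemma resolvent_below:
  assumes "bounded_below_at (complex_of_real (1 / \<mu> - 1))" "0 < \<mu>"
  shows "\<exists>c>0. \<forall>w. c * norm w \<le> norm (blinfun_apply B w - \<mu> *\<^sub>R w)"
proof -
  obtain c where c: "0 < c" "\<And>x y. acts x y \<Longrightarrow> c * norm x \<le> norm (y - (1 / \<mu> - 1) *\<^sub>R x)"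
    using assms(1) unfolding bounded_below_at_def cs_of_real by blast
  have "\<mu> * norm w \<le> (1 + 1 / (\<mu> * c)) * norm (blinfun_apply B w - \<mu> *\<^sub>R w)" for w
  proof -
    let ?b = "blinfun_apply B w"
    have "w - ?b - (1 / \<mu> - 1) *\<^sub>R ?b = (- (1 / \<mu>)) *\<^sub>R (?b - \<mu> *\<^sub>R w)"
      using assms(2) by (simp add: algebra_simps)
    then have "c * norm ?b \<le> 1 / \<mu> * norm (?b - \<mu> *\<^sub>R w)"
      using c(2)[OF acts_B[of w]] assms(2) by simp
    then have "norm ?b \<le> 1 / (\<mu> * c) * norm (?b - \<mu> *\<^sub>R w)"
      using c(1) assms(2) by (simp add: field_simps)
    moreover have "norm (\<mu> *\<^sub>R w) \<le> norm ?b + norm (?b - \<mu> *\<^sub>R w)"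
      using norm_triangle_ineq4[of ?b "?b - \<mu> *\<^sub>R w"] by simp
    ultimately show ?thesis using assms(2) by (simp add: distrib_right)
  qed
  moreover have "0 < 1 + 1 / (\<mu> * c)" using c(1) assms(2) by (simp add: add_pos_pos)
  ultimately show ?thesis
    using assms(2) by (intro exI[of _ "\<mu> / (1 + 1 / (\<mu> * c))"]) (auto simp: pos_divide_le_eq mult.commute)
qed

text \<open>On \<open>K X\<close> the operator \<open>B\<close> has no eigenvalue above 1 / (1 + X),
  and isolation of the spectrum supplies the gaps, so \<open>upper_bound_if_gaps\<close> gives B
  \<le> 1 / (1 + X) there. To return to T, apply \<open>positive_square_le\<close> to
  \<open>y + x\<close>, whose image under \<open>B\<close> is \<open>x\<close>.\<close>

theorem form_bound_on_complement:
  assumes disc: "purely_discrete_spectrum T" and X: "0 \<le> X" and xy: "acts x y" and x: "x \<in> K X"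
  shows "X * (x \<bullet> x) \<le> y \<bullet> x"
proof -
  interpret B: symmetric_on "K X" "blinfun_apply B" by (rule symmetric_on_K)
  let ?\<alpha> = "1 / (1 + X)"
  have upper: "blinfun_apply B w \<bullet> w \<le> ?\<alpha> * (w \<bullet> w)" if "w \<in> K X" for w
  proof (rule B.upper_bound_if_gaps[OF closed_K _ _ that])
    fix \<beta> w assume \<beta>: "?\<alpha> < \<beta>" and w: "w \<in> K X" "blinfun_apply B w = \<beta> *\<^sub>R w"
    have "0 < \<beta>" using \<beta> X by (smt (verit) divide_pos_pos)
    have "acts ((1 / \<beta>) *\<^sub>R \<beta> *\<^sub>R w) ((1 / \<beta>) *\<^sub>R (w - \<beta> *\<^sub>R w))"
      using acts_scaleR[OF acts_B[of w], of "1 / \<beta>"] unfolding w(2) .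
    then have "acts w ((1 / \<beta> - 1) *\<^sub>R w)"
      using \<open>0 < \<beta>\<close> by (simp add: scaleR_diff_right scaleR_diff_left)
    moreover have "1 / \<beta> - 1 \<le> X" using \<beta> \<open>0 < \<beta>\<close> X by (simp add: field_simps)
    ultimately show "w = 0" using w(1) unfolding K_def by fastforce
  next
    fix \<beta> assume "?\<alpha> < \<beta>"
    then have \<beta>: "0 < \<beta>" using X by (smt (verit) divide_pos_pos)
    obtain e where e: "0 < e" "\<And>z'. z' \<noteq> complex_of_real (1 / \<beta> - 1) \<Longrightarrow>
      dist z' (complex_of_real (1 / \<beta> - 1)) < e \<Longrightarrow> bounded_below_at z'"
      using isolated_spectrum[OF disc] by blast
    have "isCont (\<lambda>\<mu>. 1 / \<mu>) \<beta>" using \<beta> by (intro continuous_intros) auto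
    then obtain d where d: "0 < d" "\<And>\<mu>. dist \<mu> \<beta> < d \<Longrightarrow> dist (1 / \<mu>) (1 / \<beta>) < e"
      using e(1) unfolding continuous_at_eps_delta by blast
    show "\<exists>r>0. \<forall>\<mu>. \<beta> - r < \<mu> \<longrightarrow> \<mu> < \<beta> \<longrightarrow> (\<exists>c>0. \<forall>w\<in>K X. c * norm w \<le> norm (blinfun_apply B w - \<mu> *\<^sub>R w))"
    proof (rule exI[of _ "min d \<beta>"], intro conjI allI impI)
      fix \<mu> assume \<mu>: "\<beta> - min d \<beta> < \<mu>" "\<mu> < \<beta>"
      then have "0 < \<mu>" "dist \<mu> \<beta> < d" by (auto simp: dist_real_def)
      have "bounded_below_at (complex_of_real (1 / \<mu> - 1))"
      proof (rule e(2))
        show "complex_of_real (1 / \<mu> - 1) \<noteq> complex_of_real (1 / \<beta> - 1)"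
          using \<mu>(2) \<open>0 < \<mu>\<close> \<beta> unfolding of_real_eq_iff by (simp add: field_simps)
        show "dist (complex_of_real (1 / \<mu> - 1)) (complex_of_real (1 / \<beta> - 1)) < e"
          using d(2)[OF \<open>dist \<mu> \<beta> < d\<close>] unfolding dist_of_real by (simp add: dist_real_def)
      qed
      then show "\<exists>c>0. \<forall>w\<in>K X. c * norm w \<le> norm (blinfun_apply B w - \<mu> *\<^sub>R w)"
        using resolvent_below[OF _ \<open>0 < \<mu>\<close>] by blast
    qed (use d(1) \<beta> in auto)
  qed
  have yK: "y \<in> K X"
    unfolding K_def
  proof clarify
    fix r e assume "r \<le> X" "acts e (r *\<^sub>R e)"
    then show "y \<bullet> e = 0" using acts_symmetric[OF xy, of e "r *\<^sub>R e"] x unfolding K_def by simp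
  qed
  have "blinfun_apply B (y + x) \<bullet> blinfun_apply B (y + x) \<le> ?\<alpha> * (blinfun_apply B (y + x) \<bullet> (y + x))"
    using B_nonneg upper subspace_add[OF B.subspace yK x] by (intro B.positive_square_le) auto
  then have "x \<bullet> x \<le> ?\<alpha> * (x \<bullet> (y + x))" unfolding B_eqI[OF xy] .
  then show ?thesis using X by (simp add: field_simps inner_add inner_commute)
qed

end

section \<open>Counting eigenvalues\<close>

lemma sum_fun_apply: "(\<Sum>i\<in>I. f i) v = (\<Sum>i\<in>I. (f i v :: 'a::comm_monoid_add))"
  by (induction I rule: infinite_finite_induct) simp_all

text \<open>Gaussian elimination: an unknown \<open>a0\<close> with nonzero coefficient in equation
  \<open>c\<close> is eliminated from the other equations and recovered as \<open>t\<close>.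
  Arbitrary index sets allow vertices and eigenvectors to act as equations or as unknowns.\<close>

lemma homogeneous_system_solution:
  fixes M :: "'c \<Rightarrow> 'a \<Rightarrow> 'f::field"
  assumes "finite C" "finite A" "card C < card A"
  shows "\<exists>u. (\<exists>a\<in>A. u a \<noteq> 0) \<and> (\<forall>c\<in>C. (\<Sum>a\<in>A. u a * M c a) = 0)"
  using assms
proof (induction C arbitrary: A M rule: finite_induct)
  case empty
  then obtain a where "a \<in> A" by (metis card.empty card_gt_0_iff ex_in_conv)
  then show ?case by (intro exI[of _ "\<lambda>_. 1"]) auto
next
  case (insert c C)
  show ?case
  proof (cases "\<forall>a\<in>A. M c a = 0")
    case True
    obtain u where "\<exists>a\<in>A. u a \<noteq> 0" "\<forall>c\<in>C. (\<Sum>a\<in>A. u a * M c a) = 0"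
      using insert.IH[of A M] insert.prems insert.hyps by auto
    moreover have "(\<Sum>a\<in>A. u a * M c a) = 0" using True by (intro sum.neutral) auto
    ultimately show ?thesis by blast
  next
    case False
    then obtain a0 where a0: "a0 \<in> A" "M c a0 \<noteq> 0" by blast
    have "card C < card (A - {a0})" using insert a0 by simp
    then obtain u where u: "\<exists>a\<in>A - {a0}. u a \<noteq> 0"
      "\<And>d. d \<in> C \<Longrightarrow> (\<Sum>a\<in>A - {a0}. u a * (M d a - M d a0 * M c a / M c a0)) = 0"
      using insert.IH[of "A - {a0}" "\<lambda>d a. M d a - M d a0 * M c a / M c a0"] insert.prems by auto
    define t where "t = - (\<Sum>a\<in>A - {a0}. u a * M c a) / M c a0"
    have split: "(\<Sum>a\<in>A. (u(a0 := t)) a * M d a) = t * M d a0 + (\<Sum>a\<in>A - {a0}. u a * M d a)" for d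
      using insert.prems a0 by (subst sum.remove[of _ a0]) (auto intro!: sum.cong)
    have "(\<Sum>a\<in>A. (u(a0 := t)) a * M c a) = 0"
      unfolding split using a0 by (simp add: t_def)
    moreover have "(\<Sum>a\<in>A. (u(a0 := t)) a * M d a) = 0" if "d \<in> C" for d
    proof -
      have "t * M d a0 = - (\<Sum>a\<in>A - {a0}. u a * (M d a0 * M c a / M c a0))"
        by (simp add: t_def sum_distrib_left sum_divide_distrib mult_ac)
      then show ?thesis using u(2)[OF that] unfolding split
        by (simp add: right_diff_distrib sum_subtractf)
    qed
    moreover have "\<exists>a\<in>A. (u(a0 := t)) a \<noteq> 0" using u(1) by auto
    ultimately show ?thesis by (intro exI[of _ "u(a0 := t)"]) blast
  qed
qed

context graph_potential
begin

text \<open>The slack of 1 in this and in the next counting lemma turns weak form bounds into strict ones.\<close>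

lemma count_lower_bound:
  assumes disc: "purely_discrete_spectrum T" and X: "0 \<le> X" and A: "finite A"
    and span: "\<And>r x. r \<le> X \<Longrightarrow> acts x (r *\<^sub>R x) \<Longrightarrow> fn x \<in> cfun.span A"
    and V: "finite V" "\<And>v. v \<in> V \<Longrightarrow> a * g v + c \<le> X - 1"
    and form: "\<And>x. x \<in> fs \<Longrightarrow> L x \<bullet> x \<le> a * G x + c * (x \<bullet> x)"
  shows "card V \<le> card A"
proof (rule ccontr)
  assume "\<not> ?thesis"
  then have "card A < card V" by simp
  \<comment> \<open>More vertices than eigenvectors: a nonzero function supported in
    \<open>V\<close> is orthogonal, in the complex sense, to everything in \<open>A\<close>, hence
    to all eigenvectors up to level \<open>X\<close>.\<close>
  then obtain u where u: "\<exists>v\<in>V. u v \<noteq> 0" "\<forall>\<phi>\<in>A. (\<Sum>v\<in>V. u v * cnj (\<phi> v)) = 0"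
    using homogeneous_system_solution[OF A V(1), of "\<lambda>\<phi> v. cnj (\<phi> v)"] by blast
  define x where "x = (\<Sum>v\<in>V. atom (u v) v)"
  have fn_x: "fn x v = (if v \<in> V then u v else 0)" for v
    unfolding x_def using V(1) by (simp add: fn_atom)
  have x: "x \<in> fs" unfolding x_def by (intro subspace_sum subspace_fs atom_fs)
  have "cfun.subspace {\<phi>. (\<Sum>v\<in>V. u v * cnj (\<phi> v)) = 0}"
    unfolding cfun.subspace_def
    by (auto simp: cscale_def algebra_simps sum.distrib simp flip: sum_distrib_left)
  then have "cfun.span A \<subseteq> {\<phi>. (\<Sum>v\<in>V. u v * cnj (\<phi> v)) = 0}"
    using u(2) by (intro cfun.span_minimal) auto
  then have orth: "(\<Sum>v\<in>V. u v * cnj (fn e v)) = 0" if "r \<le> X" "acts e (r *\<^sub>R e)" for r e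
    using span[OF that] by blast
  have "x \<in> K X"
    unfolding K_def
  proof clarify
    fix r e assume "r \<le> X" "acts e (r *\<^sub>R e)"
    then have "Re (\<Sum>v\<in>V. u v * cnj (fn e v)) = 0" using orth by simp
    then have "(\<Sum>v\<in>V. fn x v \<bullet> fn e v) = 0" by (simp add: fn_x inner_complex_def)
    then show "x \<bullet> e = 0" using inner_finite_support(1)[of V x e] V(1) fn_x by simp
  qed
  then have "X * (x \<bullet> x) \<le> L x \<bullet> x" by (rule form_bound_on_complement[OF disc X acts_L[OF x]])
  also have "\<dots> \<le> a * G x + c * (x \<bullet> x)" by (rule form[OF x])
  also have "\<dots> = (\<Sum>v\<in>V. (a * g v + c) * (cmod (u v))\<^sup>2)"
    using V(1) by (subst G_eq[of V]) (auto simp: fn_x inner_finite_support(1)[of V] sum_distrib_left sum.distrib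
      power2_norm_eq_inner algebra_simps)
  also have "\<dots> \<le> (\<Sum>v\<in>V. (X - 1) * (cmod (u v))\<^sup>2)"
    by (intro sum_mono mult_right_mono V) auto
  also have "\<dots> = (X - 1) * (x \<bullet> x)"
    using V(1) by (simp add: fn_x inner_finite_support(1)[of V] sum_distrib_left power2_norm_eq_inner)
  finally have "x \<bullet> x \<le> 0" by (simp add: algebra_simps)
  then have x0: "x = 0" by (metis inner_eq_zero_iff inner_ge_zero order_antisym)
  obtain v where "v \<in> V" "u v \<noteq> 0" using u(1) by blast
  then show False using fn_x[of v] unfolding x0 by simp
qed

text \<open>The form bound is carried from the core to the maximal domain. Finite sets
  \<open>F\<close> are used because finite partial sums converge, whereas the full weighted sum is
  only lower semicontinuous under norm convergence.\<close>

lemma weighted_sum_le: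
  assumes form: "\<And>x. x \<in> fs \<Longrightarrow> G x \<le> b * (L x \<bullet> x) + c * (x \<bullet> x)"
    and xy: "acts x y" and F: "finite F"
  shows "(\<Sum>v\<in>F. g v * (cmod (fn x v))\<^sup>2) \<le> b * (y \<bullet> x) + c * (x \<bullet> x)"
proof -
  obtain X where X: "\<And>n. X n \<in> fs" "X \<longlonglongrightarrow> x" "(\<lambda>n. L (X n)) \<longlonglongrightarrow> y"
    using core[OF xy] by blast
  have le: "(\<Sum>v\<in>F. g v * (cmod (fn (X n) v))\<^sup>2) \<le> b * (L (X n) \<bullet> X n) + c * (X n \<bullet> X n)" for n
  proof -
    have fin: "finite (F \<union> {v. fn (X n) v \<noteq> 0})" using F X(1)[of n] by (simp add: fs_def)
    have "(\<Sum>v\<in>F. g v * (cmod (fn (X n) v))\<^sup>2) \<le> (\<Sum>v\<in>F \<union> {v. fn (X n) v \<noteq> 0}. g v * (cmod (fn (X n) v))\<^sup>2)"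
      by (rule sum_mono2[OF fin]) (auto simp: g_nonneg)
    also have "\<dots> = G (X n)" by (rule G_eq[OF fin, symmetric]) auto
    finally show ?thesis using form[OF X(1)[of n]] by linarith
  qed
  show ?thesis
  proof (rule LIMSEQ_le)
    show "(\<lambda>n. \<Sum>v\<in>F. g v * (cmod (fn (X n) v))\<^sup>2) \<longlonglongrightarrow> (\<Sum>v\<in>F. g v * (cmod (fn x v))\<^sup>2)"
      by (intro tendsto_intros tendsto_fn X)
    show "(\<lambda>n. b * (L (X n) \<bullet> X n) + c * (X n \<bullet> X n)) \<longlonglongrightarrow> b * (y \<bullet> x) + c * (x \<bullet> x)"
      by (intro tendsto_intros X)
  qed (use le in blast)
qed

section \<open>Bounding the number of eigenvalues from above; compactness\<close>

lemma acts_sum: "(\<And>i. i \<in> I \<Longrightarrow> acts (x i) (y i)) \<Longrightarrow> acts (\<Sum>i\<in>I. x i) (\<Sum>i\<in>I. y i)"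
proof (induction I rule: infinite_finite_induct)
  case (insert i I)
  then show ?case by (simp add: acts_add)
qed (use acts_scaleR[OF acts_L[OF atom_fs], of 0] in simp_all)

lemma eigenvector_sum:
  assumes R: "finite R" and x: "\<And>r. r \<in> R \<Longrightarrow> acts (x r) (r *\<^sub>R x r)"
  shows "r \<in> R \<Longrightarrow> x r \<bullet> (\<Sum>s\<in>R. x s) = x r \<bullet> x r"
    and "(\<And>r. r \<in> R \<Longrightarrow> r \<le> X) \<Longrightarrow>
      (\<Sum>r\<in>R. r *\<^sub>R x r) \<bullet> (\<Sum>r\<in>R. x r) \<le> X * ((\<Sum>r\<in>R. x r) \<bullet> (\<Sum>r\<in>R. x r))"
proof -
  have eq: "x r \<bullet> (\<Sum>s\<in>R. x s) = x r \<bullet> x r" if r: "r \<in> R" for r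
  proof -
    have "x r \<bullet> (\<Sum>s\<in>R. x s) = x r \<bullet> x r + (\<Sum>s\<in>R - {r}. x r \<bullet> x s)"
      unfolding inner_sum_right by (rule sum.remove[OF R r])
    also have "(\<Sum>s\<in>R - {r}. x r \<bullet> x s) = 0"
      by (intro sum.neutral ballI eigenvectors_orthogonal[OF x x]) (use r in auto)
    finally show ?thesis by simp
  qed
  then show "r \<in> R \<Longrightarrow> x r \<bullet> (\<Sum>s\<in>R. x s) = x r \<bullet> x r" .
  assume X: "\<And>r. r \<in> R \<Longrightarrow> r \<le> X"
  have "(\<Sum>r\<in>R. r *\<^sub>R x r) \<bullet> (\<Sum>r\<in>R. x r) = (\<Sum>r\<in>R. r * (x r \<bullet> x r))"
    by (simp add: inner_sum_left eq)
  also have "\<dots> \<le> (\<Sum>r\<in>R. X * (x r \<bullet> x r))" by (intro sum_mono mult_right_mono X) auto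
  also have "\<dots> = X * (\<Sum>r\<in>R. x r \<bullet> (\<Sum>s\<in>R. x s))" by (simp add: sum_distrib_left eq)
  also have "\<dots> = X * ((\<Sum>r\<in>R. x r) \<bullet> (\<Sum>r\<in>R. x r))" by (simp add: inner_sum_left)
  finally show "(\<Sum>r\<in>R. r *\<^sub>R x r) \<bullet> (\<Sum>r\<in>R. x r) \<le> X * ((\<Sum>r\<in>R. x r) \<bullet> (\<Sum>r\<in>R. x r))" .
qed

lemma count_upper_bound:
  assumes R: "finite R" "\<And>r. r \<in> R \<Longrightarrow> r \<le> X" and X: "0 \<le> X"
    and b: "\<And>r. r \<in> R \<Longrightarrow> finite (bs r) \<and> cfun.independent (bs r) \<and> bs r \<subseteq> eigenspace T (complex_of_real r)"
    and V: "finite V" "\<And>v. v \<notin> V \<Longrightarrow> b * X + c + 1 \<le> g v" and bc: "0 \<le> b" "0 \<le> c"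
    and form: "\<And>x. x \<in> fs \<Longrightarrow> G x \<le> b * (L x \<bullet> x) + c * (x \<bullet> x)"
  shows "(\<Sum>r\<in>R. card (bs r)) \<le> card V"
proof (rule ccontr)
  assume neg: "\<not> ?thesis"
  have fin: "finite (Sigma R bs)" using R(1) b by (intro finite_SigmaI) auto
  have "card (Sigma R bs) = (\<Sum>r\<in>R. card (bs r))" using R(1) b by (intro card_SigmaI) auto
  then have "card V < card (Sigma R bs)" using neg by simp
  \<comment> \<open>More eigenvectors than vertices in \<open>V\<close>: a nontrivial combination
    vanishes on \<open>V\<close>. Its weight is large wherever it lives, although its form is at
    most \<open>X\<close> times its squared norm.\<close>
  then obtain u where u: "\<exists>p\<in>Sigma R bs. u p \<noteq> 0"
    "\<And>v. v \<in> V \<Longrightarrow> (\<Sum>p\<in>Sigma R bs. u p * snd p v) = 0"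
    using homogeneous_system_solution[OF V(1) fin, of "\<lambda>v p. snd p v"] by blast
  define x where "x r = (\<Sum>\<phi>\<in>bs r. cs (u (r, \<phi>)) (ell2_of \<phi>))" for r
  have eig: "\<phi> \<in> l2 \<and> acts (ell2_of \<phi>) (r *\<^sub>R ell2_of \<phi>)" if "r \<in> R" "\<phi> \<in> bs r" for r \<phi>
  proof -
    have "\<phi> \<in> eigenspace T (complex_of_real r)" using b that by blast
    then obtain e where "\<phi> = fn e" "acts e (cs (complex_of_real r) e)" unfolding eigenspace_iff by blast
    then show ?thesis by (simp add: cs_of_real fn_inverse)
  qed
  have fn_xr: "fn (x r) v = (\<Sum>\<phi>\<in>bs r. u (r, \<phi>) * \<phi> v)" if "r \<in> R" for r v
    unfolding x_def using eig that by (auto intro!: sum.cong)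
  have xr: "acts (x r) (r *\<^sub>R x r)" if "r \<in> R" for r
  proof -
    have "acts (x r) (\<Sum>\<phi>\<in>bs r. cs (u (r, \<phi>)) (r *\<^sub>R ell2_of \<phi>))"
      unfolding x_def using eig[OF that] by (intro acts_sum acts_cs) auto
    then show ?thesis by (simp add: x_def cs_scaleR scaleR_sum_right)
  qed
  define z where "z = (\<Sum>r\<in>R. x r)"
  have act: "acts z (\<Sum>r\<in>R. r *\<^sub>R x r)" unfolding z_def by (intro acts_sum xr)
  have le: "(\<Sum>r\<in>R. r *\<^sub>R x r) \<bullet> z \<le> X * (z \<bullet> z)"
    unfolding z_def by (rule eigenvector_sum(2)[OF R(1) xr R(2)])
  have vanish: "fn z v = 0" if "v \<in> V" for v
  proof -
    have "fn z v = (\<Sum>r\<in>R. \<Sum>\<phi>\<in>bs r. u (r, \<phi>) * \<phi> v)" by (simp add: z_def fn_xr)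
    also have "\<dots> = (\<Sum>p\<in>Sigma R bs. u p * snd p v)"
      using R(1) b by (subst sum.Sigma) (auto simp: case_prod_unfold)
    finally show ?thesis using u(2)[OF that] by simp
  qed
  let ?d = "b * X + c"
  have d: "0 \<le> ?d" using X bc by simp
  have "(\<Sum>v\<in>F. (cmod (fn z v))\<^sup>2) \<le> ?d * (z \<bullet> z) / (?d + 1)" if F: "finite F" for F
  proof -
    have "(?d + 1) * (\<Sum>v\<in>F. (cmod (fn z v))\<^sup>2) \<le> (\<Sum>v\<in>F. g v * (cmod (fn z v))\<^sup>2)"
      unfolding sum_distrib_left
    proof (rule sum_mono)
      fix v show "(?d + 1) * (cmod (fn z v))\<^sup>2 \<le> g v * (cmod (fn z v))\<^sup>2"
        using V(2)[of v] vanish[of v] by (cases "v \<in> V") (auto intro!: mult_right_mono)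
    qed
    also have "\<dots> \<le> b * ((\<Sum>r\<in>R. r *\<^sub>R x r) \<bullet> z) + c * (z \<bullet> z)"
      by (rule weighted_sum_le[OF form act F])
    also have "\<dots> \<le> b * (X * (z \<bullet> z)) + c * (z \<bullet> z)"
      by (intro add_right_mono mult_left_mono le bc)
    also have "\<dots> = ?d * (z \<bullet> z)" by (simp add: algebra_simps)
    finally show ?thesis using d by (simp add: pos_le_divide_eq mult.commute)
  qed
  then have "(norm z)\<^sup>2 \<le> ?d * (z \<bullet> z) / (?d + 1)"
    unfolding ell2_norm_sq by (intro infsum_le_finite_sums ell2_summable) auto
  then have "(?d + 1) * (z \<bullet> z) \<le> ?d * (z \<bullet> z)"
    using d unfolding power2_norm_eq_inner by (simp add: pos_le_divide_eq mult.commute)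
  then have "z \<bullet> z \<le> 0" by (simp add: algebra_simps)
  then have z0: "z = 0" by (metis inner_eq_zero_iff inner_ge_zero order_antisym)
  \<comment> \<open>Eigenspaces for different values are orthogonal, so \<open>z = 0\<close> forces
    each component \<open>x r\<close> to vanish; independence inside one eigenspace then excludes
    the nonzero coefficient.\<close>
  obtain r \<phi> where r: "r \<in> R" "\<phi> \<in> bs r" "u (r, \<phi>) \<noteq> 0" using u(1) by auto
  have "x r \<bullet> x r = x r \<bullet> z" unfolding z_def by (rule eigenvector_sum(1)[OF R(1) xr r(1), symmetric])
  then have "x r = 0" using z0 by simp
  then have "(\<Sum>\<phi>\<in>bs r. cscale (u (r, \<phi>)) \<phi>) = 0"
    using fn_xr[OF r(1)] by (simp add: fun_eq_iff cscale_def sum_fun_apply)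
  then have "u (r, \<phi>) = 0"
    using b[OF r(1)] r(2) cfun.independentD[of "bs r" "bs r" "\<lambda>\<phi>. u (r, \<phi>)" \<phi>] by blast
  then show False using r(3) by simp
qed

text \<open>Compactness of the product of discs gives a coordinatewise limit. Outside the finite set
  where \<open>g\<close> is at most \<open>R\<close> the mass is at most \<open>M / R\<close>,
  uniformly in \<open>n\<close>, so the subsequence is Cauchy in norm.\<close>

lemma compact_embedding:
  assumes norm: "\<And>n. norm (X n) \<le> 1"
    and weight: "\<And>n F. finite F \<Longrightarrow> (\<Sum>v\<in>F. g v * (cmod (fn (X n) v))\<^sup>2) \<le> M"
    and fin: "\<And>R. finite {v. g v \<le> R}"
  shows "\<exists>x r. strict_mono (r :: nat \<Rightarrow> nat) \<and> (X \<circ> r) \<longlonglongrightarrow> x"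
proof -
  have "compactin (product_topology (\<lambda>_. euclidean) UNIV) (PiE UNIV (\<lambda>_ :: 'v. cball (0 :: complex) 1))"
    by (subst compactin_PiE) (auto simp: compactin_euclidean_iff)
  then have "compact (PiE UNIV (\<lambda>_ :: 'v. cball (0 :: complex) 1))"
    by (simp add: euclidean_product_topology compactin_euclidean_iff)
  \<comment> \<open>Countability of the vertex set makes the product first countable, so compactness
    yields subsequences.\<close>
  then have sc: "seq_compact (PiE UNIV (\<lambda>_ :: 'v. cball (0 :: complex) 1))" by (rule compact_imp_seq_compact)
  have "\<forall>n. fn (X n) \<in> PiE UNIV (\<lambda>_. cball 0 1)"
    using order_trans[OF cmod_fn_le norm] by (auto simp: dist_norm)
  then obtain f and r :: "nat \<Rightarrow> nat" where r: "strict_mono r" "((\<lambda>n. fn (X n)) \<circ> r) \<longlonglongrightarrow> f"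
    using sc[unfolded seq_compact_def, THEN spec, of "\<lambda>n. fn (X n)"] by blast
  have f: "(\<lambda>n. fn (X (r n)) v) \<longlonglongrightarrow> f v" for v
  proof -
    have "continuous_on UNIV (\<lambda>h :: 'v \<Rightarrow> complex. h v)" by simp
    from continuous_on_tendsto_compose[OF this r(2)] show ?thesis by simp
  qed
  have "Cauchy (X \<circ> r)"
    unfolding Cauchy_def
  proof (intro allI impI)
    fix e :: real assume e: "0 < e"
    \<comment> \<open>The tail of a difference is at most \<open>4 * M / R\<close>, and the factor
      16 brings this below \<open>e\<^sup>2 / 4\<close>. The \<open>max\<close> keeps
      \<open>R\<close> positive.\<close>
    define R where "R = max 1 (16 * M / e\<^sup>2)"
    define W where "W = {v. g v \<le> R}"
    have W: "finite W" unfolding W_def by (rule fin)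
    have R: "0 < R" "4 * M / R \<le> e\<^sup>2 / 4"
    proof -
      show "0 < R" unfolding R_def by simp
      have "16 * M / e\<^sup>2 \<le> R" unfolding R_def by simp
      then show "4 * M / R \<le> e\<^sup>2 / 4" using e \<open>0 < R\<close> by (simp add: field_simps)
    qed
    have "(\<lambda>n. \<Sum>v\<in>W. (cmod (fn (X (r n)) v - f v))\<^sup>2) \<longlonglongrightarrow> (\<Sum>v\<in>W. (cmod (f v - f v))\<^sup>2)"
      by (intro tendsto_intros f)
    then have "(\<lambda>n. \<Sum>v\<in>W. (cmod (fn (X (r n)) v - f v))\<^sup>2) \<longlonglongrightarrow> 0" by simp
    then obtain N where N: "\<And>n. N \<le> n \<Longrightarrow> (\<Sum>v\<in>W. (cmod (fn (X (r n)) v - f v))\<^sup>2) < e\<^sup>2 / 16"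
      using order_tendstoD(2)[of _ 0 sequentially "e\<^sup>2 / 16"] e unfolding eventually_sequentially by auto
    have par: "(cmod (a - b))\<^sup>2 \<le> 2 * (cmod a)\<^sup>2 + 2 * (cmod b)\<^sup>2" for a b :: complex
    proof -
      have "0 \<le> (a + b) \<bullet> (a + b)" by simp
      then show ?thesis by (simp add: power2_norm_eq_inner inner_add inner_diff inner_commute)
    qed
    have "dist ((X \<circ> r) m) ((X \<circ> r) n) < e" if mn: "N \<le> m" "N \<le> n" for m n
    proof -
      let ?x = "X (r m)" and ?y = "X (r n)"
      have "norm (?x - ?y) \<le> sqrt (e\<^sup>2 / 2)"
      proof (rule ell2_norm_le)
        fix F :: "'v set" assume F: "finite F"
        have "(\<Sum>v\<in>F. (cmod (fn (?x - ?y) v))\<^sup>2)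
            = (\<Sum>v\<in>F \<inter> W. (cmod (fn (?x - ?y) v))\<^sup>2) + (\<Sum>v\<in>F - W. (cmod (fn (?x - ?y) v))\<^sup>2)"
          using F by (metis sum.Int_Diff)
        also have "(\<Sum>v\<in>F \<inter> W. (cmod (fn (?x - ?y) v))\<^sup>2) \<le> (\<Sum>v\<in>W. (cmod (fn (?x - ?y) v))\<^sup>2)"
          using W by (intro sum_mono2) auto
        also have "\<dots> \<le> (\<Sum>v\<in>W. 2 * (cmod (fn ?x v - f v))\<^sup>2 + 2 * (cmod (fn ?y v - f v))\<^sup>2)"
        proof (rule sum_mono)
          fix v show "(cmod (fn (?x - ?y) v))\<^sup>2 \<le> 2 * (cmod (fn ?x v - f v))\<^sup>2 + 2 * (cmod (fn ?y v - f v))\<^sup>2"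
            using par[of "fn ?x v - f v" "fn ?y v - f v"] by simp
        qed
        also have "\<dots> \<le> e\<^sup>2 / 4"
          using N[OF mn(1)] N[OF mn(2)] by (simp add: sum.distrib flip: sum_distrib_left)
        also have "(\<Sum>v\<in>F - W. (cmod (fn (?x - ?y) v))\<^sup>2)
            \<le> (\<Sum>v\<in>F - W. 2 / R * (g v * (cmod (fn ?x v))\<^sup>2) + 2 / R * (g v * (cmod (fn ?y v))\<^sup>2))"
        proof (rule sum_mono)
          fix v assume "v \<in> F - W"
          then have "1 \<le> g v / R" using R(1) by (simp add: W_def)
          then have "t * 1 \<le> t * (g v / R)" if "0 \<le> t" for t using that by (rule mult_left_mono)
          from this[of "2 * (cmod (fn ?x v))\<^sup>2 + 2 * (cmod (fn ?y v))\<^sup>2"]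
          show "(cmod (fn (?x - ?y) v))\<^sup>2 \<le> 2 / R * (g v * (cmod (fn ?x v))\<^sup>2) + 2 / R * (g v * (cmod (fn ?y v))\<^sup>2)"
            using par[of "fn ?x v" "fn ?y v"] by (simp add: algebra_simps)
        qed
        also have "\<dots> = 2 / R * (\<Sum>v\<in>F - W. g v * (cmod (fn ?x v))\<^sup>2) + 2 / R * (\<Sum>v\<in>F - W. g v * (cmod (fn ?y v))\<^sup>2)"
          by (simp only: sum.distrib sum_distrib_left)
        also have "\<dots> \<le> 2 / R * M + 2 / R * M"
          using F R(1) by (intro add_mono mult_left_mono weight) auto
        also have "\<dots> = 4 * M / R" by (simp add: field_simps)
        also have "e\<^sup>2 / 4 + 4 * M / R \<le> e\<^sup>2 / 4 + e\<^sup>2 / 4" using R(2) by simp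
        finally show "(\<Sum>v\<in>F. (cmod (fn (?x - ?y) v))\<^sup>2) \<le> (sqrt (e\<^sup>2 / 2))\<^sup>2" by simp
      qed simp
      also have "sqrt (e\<^sup>2 / 2) < e" using e by (intro real_less_lsqrt) auto
      finally show ?thesis by (simp add: dist_norm)
    qed
    then show "\<exists>N. \<forall>m\<ge>N. \<forall>n\<ge>N. dist ((X \<circ> r) m) ((X \<circ> r) n) < e" by blast
  qed
  then show ?thesis using r(1) Cauchy_convergent convergentD by blast
qed

end

section \<open>Discreteness of the spectrum\<close>

context graph_potential
begin

text \<open>This part of the spectrum is compact, so if infinite it would accumulate somewhere,
  which \<open>isolated_spectrum\<close> excludes at every point.\<close>

lemma finite_spectrum_below:
  assumes disc: "purely_discrete_spectrum T" shows "finite {z \<in> spectrum T. Re z \<le> X}"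
proof (rule ccontr)
  let ?S = "{z \<in> spectrum T. Re z \<le> X}"
  assume inf: "infinite ?S"
  have "?S = spectrum T \<inter> {z. Re z \<le> X}" by auto
  then have "closed ?S" by (simp add: closed_Int closed_spectrum closed_halfspace_Re_le)
  moreover have "?S \<subseteq> cball 0 X"
  proof
    fix z assume "z \<in> ?S"
    then show "z \<in> cball 0 X" using spectrum_real_nonneg[of z] by (simp add: cmod_eq_Re)
  qed
  ultimately have "compact ?S" using bounded_cball bounded_subset compact_eq_bounded_closed by blast
  then obtain z where "z islimpt ?S" using Heine_Borel_imp_Bolzano_Weierstrass[OF _ inf] by blast
  moreover obtain e where e: "0 < e" "\<And>z'. z' \<noteq> z \<Longrightarrow> dist z' z < e \<Longrightarrow> bounded_below_at z'"
    using isolated_spectrum[OF disc, of z] by blast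
  have "?S \<inter> ball z e \<subseteq> {z}"
    by (auto simp: spectrum_def resolvent_set_iff dist_commute) (use e(2) in blast)
  then have "finite (?S \<inter> ball z e)" using finite_subset by blast
  ultimately show False using e(1) by (simp add: islimpt_eq_infinite_ball)
qed

section \<open>The eigenvalue counting function\<close>

definition ev :: "real set" where "ev = {r. is_eigenvalue T (complex_of_real r)}"

lemma ev_spectrum: "r \<in> ev \<Longrightarrow> complex_of_real r \<in> spectrum T"
  by (auto simp: ev_def is_eigenvalue_iff intro: eigenvalue_in_spectrum)

lemma ev_nonneg: "r \<in> ev \<Longrightarrow> 0 \<le> r"
  using spectrum_real_nonneg(2)[OF ev_spectrum, of r] by simp

lemma finite_ev: assumes "purely_discrete_spectrum T" shows "finite {r \<in> ev. r \<le> X}"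
proof (rule finite_imageD)
  show "finite (complex_of_real ` {r \<in> ev. r \<le> X})"
    by (rule finite_subset[OF _ finite_spectrum_below[OF assms, of X]]) (auto intro: ev_spectrum)
qed (simp add: inj_on_def)

lemma eigenvalues_below_ess_eq: "purely_discrete_spectrum T \<Longrightarrow> eigenvalues_below_ess T = ev"
  by (simp add: eigenvalues_below_ess_def purely_discrete_spectrum_def ev_def)

definition eigenvalue_count :: "real \<Rightarrow> nat" where
  "eigenvalue_count X = (\<Sum>r | r \<in> ev \<and> r \<le> X. multiplicity_op T r)"

lemma eigenspace_basis:
  assumes "purely_discrete_spectrum T"
  obtains bs where "\<And>r. r \<in> ev \<Longrightarrow> finite (bs r) \<and> cfun.independent (bs r) \<and> bs r \<subseteq> eigenspace T (complex_of_real r)"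
    "\<And>r. r \<in> ev \<Longrightarrow> eigenspace T (complex_of_real r) \<subseteq> cfun.span (bs r)"
    "\<And>r. r \<in> ev \<Longrightarrow> card (bs r) = multiplicity_op T r"
proof -
  have "\<exists>b. finite b \<and> cfun.independent b \<and> b \<subseteq> eigenspace T (complex_of_real r) \<and>
    eigenspace T (complex_of_real r) \<subseteq> cfun.span b \<and> card b = multiplicity_op T r" if "r \<in> ev" for r
  proof -
    have "complex_of_real r \<in> discrete_spectrum T"
      using assms ev_spectrum[OF that] by (auto simp: purely_discrete_spectrum_def essential_spectrum_def)
    then obtain F where F: "finite F" "eigenspace T (complex_of_real r) \<subseteq> cfun.span F"
      unfolding discrete_spectrum_def by blast
    obtain b where b: "b \<subseteq> eigenspace T (complex_of_real r)" "cfun.independent b"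
      "eigenspace T (complex_of_real r) \<subseteq> cfun.span b" "card b = cfun.dim (eigenspace T (complex_of_real r))"
      by (rule cfun.basis_exists)
    then show ?thesis
      using cfun.independent_span_bound[OF F(1) b(2)] F(2) by (auto simp: multiplicity_op_def)
  qed
  then show ?thesis using that by metis
qed

lemma eigenvalue_count_lower:
  assumes disc: "purely_discrete_spectrum T" and X: "0 \<le> X"
    and V: "finite V" "\<And>v. v \<in> V \<Longrightarrow> a * g v + c \<le> X - 1"
    and form: "\<And>x. x \<in> fs \<Longrightarrow> L x \<bullet> x \<le> a * G x + c * (x \<bullet> x)"
  shows "card V \<le> eigenvalue_count X"
proof -
  obtain bs where bs: "\<And>r. r \<in> ev \<Longrightarrow> finite (bs r) \<and> cfun.independent (bs r) \<and> bs r \<subseteq> eigenspace T (complex_of_real r)"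
    "\<And>r. r \<in> ev \<Longrightarrow> eigenspace T (complex_of_real r) \<subseteq> cfun.span (bs r)"
    "\<And>r. r \<in> ev \<Longrightarrow> card (bs r) = multiplicity_op T r"
    by (rule eigenspace_basis[OF disc]) blast
  let ?R = "{r \<in> ev. r \<le> X}"
  have R: "finite ?R" by (rule finite_ev[OF disc])
  have "card V \<le> card (\<Union>r\<in>?R. bs r)"
  proof (rule count_lower_bound[OF disc X _ _ V form])
    show "finite (\<Union>r\<in>?R. bs r)" using R bs(1) by auto
    fix r x assume r: "r \<le> X" "acts x (r *\<^sub>R x)"
    show "fn x \<in> cfun.span (\<Union>r\<in>?R. bs r)"
    proof (cases "x = 0")
      case True
      then have "fn x = 0" by (simp add: fun_eq_iff)
      then show ?thesis by (simp add: cfun.span_zero)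
    next
      case False
      then have "r \<in> ev" using r(2) by (auto simp: ev_def is_eigenvalue_iff cs_of_real)
      moreover have "fn x \<in> eigenspace T (complex_of_real r)"
        using r(2) by (auto simp: eigenspace_iff cs_of_real)
      ultimately have "fn x \<in> cfun.span (bs r)" "bs r \<subseteq> (\<Union>r\<in>?R. bs r)" using bs(2) r(1) by auto
      then show ?thesis using cfun.span_mono by blast
    qed
  qed
  also have "\<dots> \<le> (\<Sum>r\<in>?R. card (bs r))" by (rule card_UN_le[OF R])
  also have "\<dots> = eigenvalue_count X" unfolding eigenvalue_count_def by (intro sum.cong) (auto simp: bs(3))
  finally show ?thesis .
qed

lemma eigenvalue_count_upper:
  assumes disc: "purely_discrete_spectrum T" and X: "0 \<le> X"
    and V: "finite V" "\<And>v. v \<notin> V \<Longrightarrow> b * X + c + 1 \<le> g v" and bc: "0 \<le> b" "0 \<le> c"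
    and form: "\<And>x. x \<in> fs \<Longrightarrow> G x \<le> b * (L x \<bullet> x) + c * (x \<bullet> x)"
  shows "eigenvalue_count X \<le> card V"
proof -
  obtain bs where bs: "\<And>r. r \<in> ev \<Longrightarrow> finite (bs r) \<and> cfun.independent (bs r) \<and> bs r \<subseteq> eigenspace T (complex_of_real r)"
    "\<And>r. r \<in> ev \<Longrightarrow> card (bs r) = multiplicity_op T r"
    by (rule eigenspace_basis[OF disc]) blast
  have "(\<Sum>r | r \<in> ev \<and> r \<le> X. card (bs r)) \<le> card V"
    by (rule count_upper_bound[OF finite_ev[OF disc] _ X _ V bc form]) (use bs in auto)
  moreover have "(\<Sum>r | r \<in> ev \<and> r \<le> X. card (bs r)) = eigenvalue_count X"
    unfolding eigenvalue_count_def by (intro sum.cong) (auto simp: bs(2))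
  ultimately show ?thesis by simp
qed

lemma eigenvalue_count_mono:
  assumes "purely_discrete_spectrum T" "X \<le> Y" shows "eigenvalue_count X \<le> eigenvalue_count Y"
  unfolding eigenvalue_count_def using assms by (intro sum_mono2 finite_ev) auto

text \<open>This turns comparison of eigenvalues into comparison of counting functions. The bound
  \<open>X0\<close> confines the candidates to a finite set, which is why the \<open>LEAST\<close>
  over reals is attained.\<close>

lemma nth_eigenvalue_le_iff:
  assumes disc: "purely_discrete_spectrum T" and ex: "n < eigenvalue_count X0"
  shows "nth_eigenvalue T n \<le> X \<longleftrightarrow> n < eigenvalue_count X" and "nth_eigenvalue T n \<in> ev"
proof -
  let ?P = "\<lambda>x. x \<in> ev \<and> n < eigenvalue_count x"
  have nth: "nth_eigenvalue T n = (LEAST x. ?P x)"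
    unfolding nth_eigenvalue_def eigenvalues_below_ess_eq[OF disc] eigenvalue_count_def ..
  \<comment> \<open>The counting function is constant between eigenvalues, so the largest eigenvalue
    up to \<open>X\<close> has the same count as \<open>X\<close>.\<close>
  have top: "\<exists>y\<in>ev. y \<le> X \<and> n < eigenvalue_count y" if "n < eigenvalue_count X" for X
  proof -
    let ?E = "{r \<in> ev. r \<le> X}"
    have "?E \<noteq> {}"
    proof
      assume "?E = {}"
      then have "eigenvalue_count X = 0" unfolding eigenvalue_count_def by (simp only: sum.empty)
      then show False using that by simp
    qed
    then have "Max ?E \<in> ?E" using finite_ev[OF disc] by (intro Max_in) auto
    moreover have "{r. r \<in> ev \<and> r \<le> Max ?E} = ?E"
      using calculation Max_ge[OF finite_ev[OF disc], of _ X] by force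
    then have "eigenvalue_count (Max ?E) = eigenvalue_count X" by (simp add: eigenvalue_count_def)
    ultimately show ?thesis using that by (intro bexI[of _ "Max ?E"]) auto
  qed
  let ?Q = "{x \<in> ev. x \<le> X0 \<and> n < eigenvalue_count x}"
  have fin: "finite ?Q" by (rule finite_subset[OF _ finite_ev[OF disc, of X0]]) auto
  have "?Q \<noteq> {}" using top[OF ex] by blast
  then have min: "Min ?Q \<in> ?Q" by (rule Min_in[OF fin])
  have least: "Min ?Q \<le> x" if "?P x" for x
  proof (cases "x \<le> X0")
    case True
    then show ?thesis using that by (intro Min_le fin) auto
  next
    case False
    then show ?thesis using min by auto
  qed
  have eq: "nth_eigenvalue T n = Min ?Q"
    unfolding nth by (rule Least_equality) (use min least in auto)
  show "nth_eigenvalue T n \<in> ev" using min unfolding eq by blast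
  show "nth_eigenvalue T n \<le> X \<longleftrightarrow> n < eigenvalue_count X"
  proof
    assume "nth_eigenvalue T n \<le> X"
    then have "eigenvalue_count (Min ?Q) \<le> eigenvalue_count X"
      unfolding eq by (rule eigenvalue_count_mono[OF disc])
    then show "n < eigenvalue_count X" using min by auto
  next
    assume "n < eigenvalue_count X"
    then obtain y where "y \<in> ev" "y \<le> X" "n < eigenvalue_count y" using top by blast
    then show "nth_eigenvalue T n \<le> X" unfolding eq using least[of y] by simp
  qed
qed

lemma eigenvalue_count_unbounded:
  assumes disc: "purely_discrete_spectrum T" and inf: "infinite (UNIV :: 'v set)"
    and form: "\<And>x. x \<in> fs \<Longrightarrow> L x \<bullet> x \<le> a * G x + c * (x \<bullet> x)"
  shows "\<exists>X. n < eigenvalue_count X"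
proof -
  obtain V :: "'v set" where V: "finite V" "card V = Suc n"
    using infinite_arbitrarily_large[OF inf] by blast
  define X where "X = max 0 (Max ((\<lambda>v. a * g v + c) ` V) + 1)"
  have "a * g v + c \<le> X - 1" if "v \<in> V" for v
  proof -
    have "a * g v + c \<le> Max ((\<lambda>v. a * g v + c) ` V)" using V(1) that by (intro Max_ge) auto
    then show ?thesis unfolding X_def by linarith
  qed
  then have "card V \<le> eigenvalue_count X"
    by (intro eigenvalue_count_lower[OF disc _ V(1) _ form]) (auto simp: X_def)
  then show ?thesis using V(2) by (intro exI[of _ X]) simp
qed

text \<open>Infinitely many vertices of bounded weight would produce, by
  \<open>eigenvalue_count_lower\<close>, more eigenvalues below one fixed level than its finite
  count allows.\<close>

lemma finite_sublevel_if_discrete: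
  assumes disc: "purely_discrete_spectrum T" and ac: "0 \<le> a" "0 \<le> c"
    and form: "\<And>x. x \<in> fs \<Longrightarrow> L x \<bullet> x \<le> a * G x + c * (x \<bullet> x)"
  shows "finite {v. g v \<le> R}"
proof (rule ccontr)
  assume inf: "infinite {v. g v \<le> R}"
  define X where "X = a * max R 0 + c + 1"
  obtain V where V: "V \<subseteq> {v. g v \<le> R}" "finite V" "card V = Suc (eigenvalue_count X)"
    using infinite_arbitrarily_large[OF inf] by blast
  have "card V \<le> eigenvalue_count X"
  proof (rule eigenvalue_count_lower[OF disc _ V(2) _ form])
    show "0 \<le> X" using ac by (simp add: X_def)
    fix v assume "v \<in> V"
    then have "g v \<le> max R 0" using V(1) by auto
    then show "a * g v + c \<le> X - 1" unfolding X_def using ac(1) by (simp add: mult_left_mono)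
  qed
  then show False using V(3) by simp
qed

text \<open>Approximate eigenvectors have bounded form, so a subsequence converges and its limit is
  an eigenvector: the spectrum consists of eigenvalues. Applied to finite families of eigenvectors,
  \<open>count_upper_bound\<close> makes the multiplicities finite and the eigenvalues
  isolated.\<close>

theorem discrete_if_finite_sublevels:
  assumes fin: "\<And>R. finite {v. g v \<le> R}" and bc: "0 \<le> b" "0 \<le> c"
    and form: "\<And>x. x \<in> fs \<Longrightarrow> G x \<le> b * (L x \<bullet> x) + c * (x \<bullet> x)"
  shows "purely_discrete_spectrum T"
proof -
  define V where "V X = {v. g v \<le> b * X + c + 1}" for X
  have V: "finite (V X)" "\<And>v. v \<notin> V X \<Longrightarrow> b * X + c + 1 \<le> g v" for X
    unfolding V_def using fin by auto
  have count: "(\<Sum>r\<in>R. card (bs r)) \<le> card (V X)"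
    if "finite R" "\<And>r. r \<in> R \<Longrightarrow> r \<le> X" "0 \<le> X"
      "\<And>r. r \<in> R \<Longrightarrow> finite (bs r) \<and> cfun.independent (bs r) \<and> bs r \<subseteq> eigenspace T (complex_of_real r)"
    for R bs X
    by (rule count_upper_bound[OF that V bc form])
  have fin_ev: "finite {r \<in> ev. r \<le> X}" if X: "0 \<le> X" for X
  proof (rule ccontr)
    assume inf: "infinite {r \<in> ev. r \<le> X}"
    obtain R where R: "R \<subseteq> {r \<in> ev. r \<le> X}" "finite R" "card R = Suc (card (V X))"
      using infinite_arbitrarily_large[OF inf] by blast
    have "\<forall>r\<in>R. \<exists>e\<in>eigenspace T (complex_of_real r). e \<noteq> 0"
      using R(1) by (auto simp: ev_def is_eigenvalue_def)
    then obtain e where e: "\<And>r. r \<in> R \<Longrightarrow> e r \<in> eigenspace T (complex_of_real r) \<and> e r \<noteq> 0" by metis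
    have "(\<Sum>r\<in>R. card {e r}) \<le> card (V X)"
      by (rule count) (use R(1,2) X e in auto)
    then show False using R(3) by simp
  qed
  have fin_dim: "\<exists>B. finite B \<and> eigenspace T (complex_of_real r) \<subseteq> cfun.span B" if r: "0 \<le> r" for r
  proof -
    obtain b where b: "b \<subseteq> eigenspace T (complex_of_real r)" "cfun.independent b"
      "eigenspace T (complex_of_real r) \<subseteq> cfun.span b"
      by (rule cfun.maximal_independent_subset)
    have "finite b"
    proof (rule ccontr)
      assume inf: "infinite b"
      obtain b' where b': "b' \<subseteq> b" "finite b'" "card b' = Suc (card (V r))"
        using infinite_arbitrarily_large[OF inf] by blast
      have "(\<Sum>s\<in>{r}. card b') \<le> card (V r)"
        by (rule count) (use b b' r cfun.independent_mono[OF b(2) b'(1)] in auto)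
      then show False using b'(3) by simp
    qed
    then show ?thesis using b(3) by blast
  qed
  have eigenvalue: "is_eigenvalue T z" if z: "z \<in> spectrum T" for z
  proof -
    define r where "r = Re z"
    have zr: "z = complex_of_real r" using spectrum_real_nonneg(1)[OF z] by (simp add: r_def complex_eq_iff)
    have "\<not> bounded_below_at z" using z by (simp add: spectrum_def resolvent_set_iff)
    then have ex: "\<exists>x y. acts x y \<and> norm (y - r *\<^sub>R x) < d * norm x" if "0 < d" for d
      using that unfolding bounded_below_at_def zr cs_of_real by (meson not_le)
    have "\<exists>x y. acts x y \<and> norm x = 1 \<and> norm (y - r *\<^sub>R x) < 1 / real (Suc n)" for n
    proof -
      obtain x y where xy: "acts x y" "norm (y - r *\<^sub>R x) < 1 / real (Suc n) * norm x"
        using ex[of "1 / real (Suc n)"] by auto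
      have "0 < 1 / real (Suc n) * norm x" using xy(2) by (rule le_less_trans[OF norm_ge_zero])
      then have x: "0 < norm x" by (cases "x = 0") auto
      have "norm ((1 / norm x) *\<^sub>R y - r *\<^sub>R (1 / norm x) *\<^sub>R x) = 1 / norm x * norm (y - r *\<^sub>R x)"
      proof -
        have "(1 / norm x) *\<^sub>R y - r *\<^sub>R (1 / norm x) *\<^sub>R x = (1 / norm x) *\<^sub>R (y - r *\<^sub>R x)"
          by (simp add: scaleR_diff_right)
        then show ?thesis by simp
      qed
      also have "\<dots> < 1 / real (Suc n)" using xy(2) x by (simp add: pos_divide_less_eq)
      finally show ?thesis
        using acts_scaleR[OF xy(1), of "1 / norm x"] x
        by (intro exI[of _ "(1 / norm x) *\<^sub>R x"] exI[of _ "(1 / norm x) *\<^sub>R y"]) simp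
    qed
    then obtain x y where xy: "\<And>n. acts (x n) (y n)" "\<And>n. norm (x n) = 1"
      "\<And>n. norm (y n - r *\<^sub>R x n) < 1 / real (Suc n)" by metis
    have form_le: "y n \<bullet> x n \<le> r + 1" for n
    proof -
      have "(y n - r *\<^sub>R x n) \<bullet> x n \<le> norm (y n - r *\<^sub>R x n) * norm (x n)" by (rule norm_cauchy_schwarz)
      also have "\<dots> \<le> 1"
      proof -
        have "1 / real (Suc n) \<le> 1" by simp
        then show ?thesis unfolding xy(2)[of n] using xy(3)[of n] by linarith
      qed
      finally show ?thesis using xy(2)[of n] by (simp add: inner_diff dot_square_norm)
    qed
    have "\<exists>l s. strict_mono (s :: nat \<Rightarrow> nat) \<and> (x \<circ> s) \<longlonglongrightarrow> l"
    proof (rule compact_embedding[OF _ _ fin])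
      fix n and F :: "'v set" assume F: "finite F"
      have "(\<Sum>v\<in>F. g v * (cmod (fn (x n) v))\<^sup>2) \<le> b * (y n \<bullet> x n) + c * (x n \<bullet> x n)"
        by (rule weighted_sum_le[OF form xy(1) F])
      also have "\<dots> \<le> b * (r + 1) + c"
        using mult_left_mono[OF form_le bc(1)] xy(2)[of n] by (simp add: dot_square_norm)
      finally show "(\<Sum>v\<in>F. g v * (cmod (fn (x n) v))\<^sup>2) \<le> b * (r + 1) + c" .
    qed (use xy(2) in simp)
    then obtain l and s :: "nat \<Rightarrow> nat" where l: "strict_mono s" "(\<lambda>n. x (s n)) \<longlonglongrightarrow> l"
      by (auto simp: o_def)
    have "(\<lambda>n. y n - r *\<^sub>R x n) \<longlonglongrightarrow> 0"
      by (rule LIMSEQ_norm_0) (use xy(3) in auto)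
    then have "(\<lambda>n. y (s n) - r *\<^sub>R x (s n)) \<longlonglongrightarrow> 0"
      using LIMSEQ_subseq_LIMSEQ[OF _ l(1)] by (fastforce simp: o_def)
    then have "(\<lambda>n. (y (s n) - r *\<^sub>R x (s n)) + r *\<^sub>R x (s n)) \<longlonglongrightarrow> 0 + r *\<^sub>R l"
      by (intro tendsto_intros l(2))
    then have "(\<lambda>n. y (s n)) \<longlonglongrightarrow> r *\<^sub>R l" by simp
    then have "acts l (r *\<^sub>R l)" by (rule acts_limit[OF l(2) _ xy(1)])
    moreover have "(\<lambda>n. norm (x (s n))) \<longlonglongrightarrow> norm l" by (intro tendsto_intros l(2))
    then have "norm l = 1" unfolding xy(2) using LIMSEQ_unique tendsto_const by blast
    ultimately show ?thesis unfolding zr is_eigenvalue_iff cs_of_real by (intro exI[of _ l]) auto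
  qed
  have "z \<in> discrete_spectrum T" if z: "z \<in> spectrum T" for z
  proof -
    have zr: "z = complex_of_real (Re z)" "0 \<le> Re z"
      using spectrum_real_nonneg[OF z] by (simp_all add: complex_eq_iff)
    have "spectrum T \<inter> ball z 1 \<subseteq> complex_of_real ` {r \<in> ev. r \<le> Re z + 1}"
    proof
      fix w assume w: "w \<in> spectrum T \<inter> ball z 1"
      then have wr: "w = complex_of_real (Re w)" using spectrum_real_nonneg(1)[of w] by (simp add: complex_eq_iff)
      then have "Re w \<in> ev" using eigenvalue[of w] w by (simp add: ev_def)
      moreover have "Re w \<le> Re z + 1"
        using w abs_Re_le_cmod[of "w - z"] by (auto simp: dist_norm norm_minus_commute)
      ultimately show "w \<in> complex_of_real ` {r \<in> ev. r \<le> Re z + 1}" using wr by blast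
    qed
    then have "finite (spectrum T \<inter> ball z 1)"
      by (rule finite_subset) (use fin_ev[of "Re z + 1"] zr(2) in auto)
    then have "\<not> z islimpt spectrum T" unfolding islimpt_eq_infinite_ball by (meson zero_less_one)
    then have "z isolated_in spectrum T" using z by (simp add: isolated_in_islimpt_iff)
    moreover have "\<exists>B. finite B \<and> eigenspace T z \<subseteq> cfun.span B" using fin_dim[OF zr(2)] unfolding zr(1)[symmetric] .
    ultimately show ?thesis using eigenvalue[OF z] by (simp add: discrete_spectrum_def)
  qed
  then show ?thesis by (auto simp: purely_discrete_spectrum_def essential_spectrum_def)
qed

end

section \<open>Comparison with the multiplication operator\<close>

text \<open>Without edges the neighbour sums are empty; this is how all results on \<Delta> + q
  become available for multiplication operators.\<close>

lemma mult_op_eq_schroedinger_op: "mult_op h = schroedinger_op (\<lambda>_ _. False) h"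
  by (simp add: mult_op_def schroedinger_op_def)

lemma liminf_at_infinity_eq_infty_iff:
  "liminf_at_infinity h = \<infinity> \<longleftrightarrow> (\<forall>R. finite {v. h v \<le> R})"
proof
  assume inf: "liminf_at_infinity h = \<infinity>"
  show "\<forall>R. finite {v. h v \<le> R}"
  proof
    fix R
    have "ereal R < (SUP W\<in>{W. finite W}. INF x\<in>UNIV - W. ereal (h x))"
      using inf by (simp add: liminf_at_infinity_def)
    then obtain W where W: "finite W" "ereal R < (INF x\<in>UNIV - W. ereal (h x))"
      unfolding less_SUP_iff by blast
    have "v \<in> W" if "h v \<le> R" for v
    proof (rule ccontr)
      assume "v \<notin> W"
      then have "(INF x\<in>UNIV - W. ereal (h x)) \<le> ereal (h v)" by (intro INF_lower) auto
      with W(2) have "ereal R < ereal (h v)" by (rule less_le_trans)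
      then show False using that by simp
    qed
    then have "{v. h v \<le> R} \<subseteq> W" by auto
    then show "finite {v. h v \<le> R}" using W(1) by (rule finite_subset)
  qed
next
  assume fin: "\<forall>R. finite {v. h v \<le> R}"
  have "ereal R \<le> liminf_at_infinity h" for R
    unfolding liminf_at_infinity_def
    by (rule SUP_upper2[of "{v. h v \<le> R}"]) (use fin in \<open>auto intro!: INF_greatest\<close>)
  then show "liminf_at_infinity h = \<infinity>" using ereal_top by blast
qed

text \<open>The approximating sequence already converges in norm, so the form inequality makes it
  Cauchy for the second form as well. The graphs may differ since one of them will have no
  edges.\<close>

lemma form_domain_mono:
  assumes P: "graph_potential E p" and Q: "graph_potential E' q" and ac: "0 < a" "0 \<le> c"
    and le: "\<And>x. x \<in> fs \<Longrightarrow> graph_potential.L E' q x \<bullet> x \<le> a * (graph_potential.L E p x \<bullet> x) + c * (x \<bullet> x)"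
  shows "graph_potential.form_domain E p \<subseteq> graph_potential.form_domain E' q"
proof
  interpret P: graph_potential E p by (rule P)
  interpret Q: graph_potential E' q by (rule Q)
  fix \<phi> assume "\<phi> \<in> P.form_domain"
  then obtain u X where u: "\<phi> = fn u" "\<And>n. X n \<in> fs" "X \<longlonglongrightarrow> u"
    and cauchy: "\<And>e. 0 < e \<Longrightarrow> \<exists>N. \<forall>m\<ge>N. \<forall>n\<ge>N. P.L (X m - X n) \<bullet> (X m - X n) < e"
    unfolding P.form_domain_def by blast
  have "\<exists>N. \<forall>m\<ge>N. \<forall>n\<ge>N. Q.L (X m - X n) \<bullet> (X m - X n) < e" if e: "0 < e" for e
  proof -
    obtain N where N: "\<And>m n. N \<le> m \<Longrightarrow> N \<le> n \<Longrightarrow> P.L (X m - X n) \<bullet> (X m - X n) < e / (2 * a)"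
      using cauchy[of "e / (2 * a)"] e ac by auto
    \<comment> \<open>Each of the two terms of the form bound gets \<open>e / 2\<close>;
      \<open>c + 1\<close> avoids a division by zero.\<close>
    have "0 < sqrt (e / (2 * (c + 1)))" using e ac by simp
    then obtain N' where N': "\<And>m n. N' \<le> m \<Longrightarrow> N' \<le> n \<Longrightarrow> dist (X m) (X n) < sqrt (e / (2 * (c + 1)))"
      using LIMSEQ_imp_Cauchy[OF u(3)] unfolding Cauchy_def by metis
    have "Q.L (X m - X n) \<bullet> (X m - X n) < e" if mn: "max N N' \<le> m" "max N N' \<le> n" for m n
    proof -
      let ?d = "X m - X n"
      have "(norm ?d)\<^sup>2 < (sqrt (e / (2 * (c + 1))))\<^sup>2"
        using N'[of m n] mn by (intro power_strict_mono) (auto simp: dist_norm)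
      then have "?d \<bullet> ?d < e / (2 * (c + 1))" using e ac by (simp add: power2_norm_eq_inner)
      then have "c * (?d \<bullet> ?d) \<le> c * (e / (2 * (c + 1)))" using ac by (intro mult_left_mono) auto
      also have "\<dots> \<le> e / 2" using e ac by (simp add: field_simps)
      finally have "c * (?d \<bullet> ?d) \<le> e / 2" .
      moreover have "a * (P.L ?d \<bullet> ?d) < a * (e / (2 * a))"
        using N[of m n] mn ac by (intro mult_strict_left_mono) auto
      then have "a * (P.L ?d \<bullet> ?d) < e / 2" using ac by simp
      moreover have "Q.L ?d \<bullet> ?d \<le> a * (P.L ?d \<bullet> ?d) + c * (?d \<bullet> ?d)"
        by (intro le subspace_diff[OF subspace_fs] u)
      ultimately show ?thesis by linarith
    qed
    then show ?thesis by blast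
  qed
  then show "\<phi> \<in> Q.form_domain" unfolding Q.form_domain_def u(1) using u(2,3) by blast
qed

section \<open>Sparse graphs: both operators side by side\<close>

locale sparse_graph_potential = graph_potential E q
  for E :: "'v::countable \<Rightarrow> 'v \<Rightarrow> bool" and q :: "'v \<Rightarrow> real" +
  fixes k :: real
  assumes k_nonneg: "0 \<le> k" and sparse: "k_sparse k E"
begin

text \<open>Multiplication by \<open>g\<close> as the operator of the edgeless graph with potential
  \<open>g\<close>; by \<open>M_L\<close> its form on \<open>fs\<close> is \<open>G\<close>.\<close>

sublocale M: graph_potential "\<lambda>_ _. False" g
  by unfold_locales (auto simp: locally_finite_graph_def symp_def irreflp_def g_nonneg)

lemma M_g: "M.g = g"
  by (simp add: fun_eq_iff M.g_def deg_def)

lemma M_G: "M.G x = G x"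
  by (simp add: M.G_def G_def M_g)

lemma M_L: "x \<in> fs \<Longrightarrow> M.L x \<bullet> x = G x"
  by (subst M.form_eq[of x "{v. fn x v \<noteq> 0}"]) (auto simp: fs_def G_def M_g)

definition \<kappa> :: "real \<Rightarrow> real" where "\<kappa> \<epsilon> = k / 2 * (1 / \<epsilon> - \<epsilon>)"

lemma \<kappa>_nonneg: "0 < \<epsilon> \<Longrightarrow> \<epsilon> \<le> 1 \<Longrightarrow> 0 \<le> \<kappa> \<epsilon>"
  using k_nonneg order_trans[of \<epsilon> 1 "1 / \<epsilon>"] by (simp add: \<kappa>_def)

lemma form_upper:
  assumes "x \<in> fs" "0 < \<epsilon>" "\<epsilon> \<le> 1"
  shows "L x \<bullet> x \<le> (1 + \<epsilon>) * G x + \<kappa> \<epsilon> * (x \<bullet> x)"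
  using form_difference_le[OF sparse assms] by (simp add: \<kappa>_def abs_le_iff algebra_simps)

lemma form_lower:
  assumes "x \<in> fs" "0 < \<epsilon>" "\<epsilon> < 1"
  shows "G x \<le> 1 / (1 - \<epsilon>) * (L x \<bullet> x) + \<kappa> \<epsilon> / (1 - \<epsilon>) * (x \<bullet> x)"
proof -
  have "(1 - \<epsilon>) * G x \<le> L x \<bullet> x + \<kappa> \<epsilon> * (x \<bullet> x)"
    using form_difference_le[OF sparse assms(1,2)] assms(3) by (simp add: \<kappa>_def abs_le_iff algebra_simps)
  then have "G x \<le> (L x \<bullet> x + \<kappa> \<epsilon> * (x \<bullet> x)) / (1 - \<epsilon>)"
    using assms(3) by (simp add: pos_le_divide_eq mult.commute)
  then show ?thesis by (simp add: add_divide_distrib)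
qed

lemma Domain_sqrt_op_eq: "Domain (sqrt_op T) = Domain (sqrt_op (mult_op g))"
proof -
  \<comment> \<open>Any fixed \<epsilon> below 1 would serve; the lower form bound degenerates at
    \<epsilon> = 1.\<close>
  have half: "0 < (1/2 :: real)" "(1/2 :: real) < 1" "(1/2 :: real) \<le> 1" by auto
  have "form_domain \<subseteq> M.form_domain"
    using form_lower[OF _ half(1,2)] \<kappa>_nonneg[OF half(1,3)] M_L
    by (intro form_domain_mono[where a="1 / (1 - 1/2)" and c="\<kappa> (1/2) / (1 - 1/2)"] graph_potential_axioms M.graph_potential_axioms) auto
  moreover have "M.form_domain \<subseteq> form_domain"
    using form_upper[OF _ half(1,3)] \<kappa>_nonneg[OF half(1,3)] M_L
    by (intro form_domain_mono[where a="1 + 1/2" and c="\<kappa> (1/2)"] graph_potential_axioms M.graph_potential_axioms) auto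
  ultimately show ?thesis
    unfolding mult_op_eq_schroedinger_op Domain_sqrt_op M.Domain_sqrt_op by blast
qed

lemma purely_discrete_iff: "purely_discrete_spectrum T \<longleftrightarrow> (\<forall>R. finite {v. g v \<le> R})"
proof
  assume disc: "purely_discrete_spectrum T"
  \<comment> \<open>At \<epsilon> = 1 the constant \<open>\<kappa> 1\<close> is 0, and the form is
    at most \<open>2 * G x\<close>.\<close>
  show "\<forall>R. finite {v. g v \<le> R}"
    using finite_sublevel_if_discrete[OF disc, of "1 + 1" "\<kappa> 1"] form_upper[of _ 1] \<kappa>_nonneg[of 1] by simp
next
  assume fin: "\<forall>R. finite {v. g v \<le> R}"
  have "0 \<le> \<kappa> (1/2)" by (rule \<kappa>_nonneg) auto
  then show "purely_discrete_spectrum T"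
    by (intro discrete_if_finite_sublevels[where b="1 / (1 - 1/2)" and c="\<kappa> (1/2) / (1 - 1/2)"] form_lower) (use fin in auto)
qed

context
  assumes disc: "purely_discrete_spectrum T"
begin

lemma finite_sublevel: "finite {v. g v < R}"
  by (rule finite_subset[of _ "{v. g v \<le> R}"]) (use disc purely_discrete_iff in auto)

lemma M_disc: "purely_discrete_spectrum M.T"
  using disc unfolding purely_discrete_iff
  by (intro M.discrete_if_finite_sublevels[where b=1 and c=0]) (auto simp: M_g M_G M_L)

text \<open>Both counts are compared with the number of vertices below a level. Each of the two
  counting bounds costs one unit of slack, hence the 2.\<close>

lemma count_le_M:
  assumes "0 \<le> X" "0 < \<epsilon>" "\<epsilon> < 1"
  shows "eigenvalue_count X \<le> M.eigenvalue_count (1 / (1 - \<epsilon>) * X + \<kappa> \<epsilon> / (1 - \<epsilon>) + 2)"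
proof -
  let ?R = "1 / (1 - \<epsilon>) * X + \<kappa> \<epsilon> / (1 - \<epsilon>) + 1"
  have \<kappa>: "0 \<le> \<kappa> \<epsilon>" using assms by (intro \<kappa>_nonneg) auto
  have "eigenvalue_count X \<le> card {v. g v < ?R}"
    by (rule eigenvalue_count_upper[OF disc assms(1) finite_sublevel _ _ _ form_lower]) (use assms \<kappa> in auto)
  also have "\<dots> \<le> M.eigenvalue_count (?R + 1)"
    by (rule M.eigenvalue_count_lower[OF M_disc _ finite_sublevel, where a=1 and c=0])
      (use assms \<kappa> in \<open>auto simp: M_g M_G M_L\<close>)
  finally show ?thesis by (simp add: add.assoc)
qed

text \<open>Again through the number of vertices below a level; here the first unit of slack is
  spent before the form bound and is therefore multiplied by 1 + \<epsilon>.\<close>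

lemma M_count_le:
  assumes "0 \<le> X" "0 < \<epsilon>" "\<epsilon> \<le> 1"
  shows "M.eigenvalue_count X \<le> eigenvalue_count ((1 + \<epsilon>) * (X + 1) + \<kappa> \<epsilon> + 1)"
proof -
  have "M.eigenvalue_count X \<le> card {v. g v < X + 1}"
    by (rule M.eigenvalue_count_upper[OF M_disc assms(1) finite_sublevel, where b=1 and c=0])
      (auto simp: M_g M_G M_L)
  also have "\<dots> \<le> eigenvalue_count ((1 + \<epsilon>) * (X + 1) + \<kappa> \<epsilon> + 1)"
  proof (rule eigenvalue_count_lower[OF disc _ finite_sublevel _ form_upper[OF _ assms(2,3)]])
    show "0 \<le> (1 + \<epsilon>) * (X + 1) + \<kappa> \<epsilon> + 1" using assms \<kappa>_nonneg[of \<epsilon>] by simp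
    fix v assume "v \<in> {v. g v < X + 1}"
    then show "(1 + \<epsilon>) * g v + \<kappa> \<epsilon> \<le> (1 + \<epsilon>) * (X + 1) + \<kappa> \<epsilon> + 1 - 1"
      using assms(2) by (simp add: mult_left_mono)
  qed
  finally show ?thesis .
qed

text \<open>By \<open>nth_eigenvalue_le_iff\<close> the counting inequalities become bounds between
  the eigenvalues of the two operators, with factors close to 1 and additive constants. The latter
  are negligible because the eigenvalues tend to infinity.\<close>

lemma eigenvalue_ratio_tendsto:
  assumes inf: "infinite (UNIV :: 'v set)"
  shows "(\<lambda>n. nth_eigenvalue T n / nth_eigenvalue M.T n) \<longlonglongrightarrow> 1"
proof -
  let ?l = "nth_eigenvalue T" and ?m = "nth_eigenvalue M.T"
  have T_ex: "\<exists>X. n < eigenvalue_count X" for n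
    by (rule eigenvalue_count_unbounded[OF disc inf form_upper[of _ 1]]) auto
  have M_ex: "\<exists>X. n < M.eigenvalue_count X" for n
    by (rule M.eigenvalue_count_unbounded[OF M_disc inf, of 1 0]) (auto simp: M_G M_L)
  have T_iff: "?l n \<le> X \<longleftrightarrow> n < eigenvalue_count X" for n X
    using nth_eigenvalue_le_iff(1)[OF disc] T_ex by blast
  have M_iff: "?m n \<le> X \<longleftrightarrow> n < M.eigenvalue_count X" for n X
    using M.nth_eigenvalue_le_iff(1)[OF M_disc] M_ex by blast
  have l0: "0 \<le> ?l n" for n
    using nth_eigenvalue_le_iff(2)[OF disc] T_ex ev_nonneg by blast
  have m0: "0 \<le> ?m n" for n
    using M.nth_eigenvalue_le_iff(2)[OF M_disc] M_ex M.ev_nonneg by blast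
  have upper: "?l n \<le> (1 + \<epsilon>) * (?m n + 1) + \<kappa> \<epsilon> + 1" if "0 < \<epsilon>" "\<epsilon> \<le> 1" for n \<epsilon>
    using M_iff[of n "?m n"] M_count_le[OF m0[of n] that] unfolding T_iff by simp
  have lower: "?m n \<le> 1 / (1 - \<epsilon>) * ?l n + \<kappa> \<epsilon> / (1 - \<epsilon>) + 2" if "0 < \<epsilon>" "\<epsilon> < 1" for n \<epsilon>
    using T_iff[of n "?l n"] count_le_M[OF l0[of n] that] unfolding M_iff by simp
  have large: "\<exists>N. \<forall>n\<ge>N. R < ?m n" for R
  proof (intro exI[of _ "M.eigenvalue_count R"] allI impI)
    fix n assume "M.eigenvalue_count R \<le> n"
    then show "R < ?m n" using M_iff[of n R] by linarith
  qed
  show ?thesis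
  proof (rule LIMSEQ_I)
    fix e :: real assume e: "0 < e"
    define \<epsilon> where "\<epsilon> = min (1/2) (e/2)"
    have \<epsilon>: "0 < \<epsilon>" "\<epsilon> < 1" "\<epsilon> \<le> e / 2" using e by (auto simp: \<epsilon>_def)
    have \<kappa>: "0 \<le> \<kappa> \<epsilon>" using \<epsilon> by (intro \<kappa>_nonneg) auto
    \<comment> \<open>\<open>D\<close> dominates the additive constants of both comparisons,
      \<open>\<kappa> \<epsilon> + 2 + \<epsilon>\<close> and
      \<open>\<kappa> \<epsilon> + 2 * (1 - \<epsilon>)\<close>. One half of \<open>e\<close>
      absorbs \<open>D\<close>, the other half absorbs \<epsilon>.\<close>
    define D where "D = \<kappa> \<epsilon> + 4"
    obtain N where N: "\<And>n. N \<le> n \<Longrightarrow> 2 * D / e < ?m n" using large by blast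
    have "norm (?l n / ?m n - 1) < e" if "N \<le> n" for n
    proof -
      have "0 < 2 * D / e" using e \<kappa> by (simp add: D_def)
      then have m: "0 < ?m n" using N[OF that] by (rule less_trans)
      have mD: "D < e / 2 * ?m n" using N[OF that] e by (simp add: field_simps)
      have "\<epsilon> * ?m n \<le> e / 2 * ?m n" using \<epsilon>(3) m by (intro mult_right_mono) auto
      then have a: "?l n - ?m n < e * ?m n"
        using upper[of \<epsilon> n] \<epsilon> mD by (simp add: D_def algebra_simps)
      have "(1 - \<epsilon>) * ?m n \<le> (1 - \<epsilon>) * (1 / (1 - \<epsilon>) * ?l n + \<kappa> \<epsilon> / (1 - \<epsilon>) + 2)"
        using lower[OF \<epsilon>(1,2)] \<epsilon> by (intro mult_left_mono) auto
      also have "\<dots> = ?l n + \<kappa> \<epsilon> + 2 * (1 - \<epsilon>)" using \<epsilon> by (simp add: distrib_left)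
      finally have "?m n - ?l n < e * ?m n"
        using \<open>\<epsilon> * ?m n \<le> e / 2 * ?m n\<close> \<epsilon> mD by (simp add: D_def algebra_simps)
      then have "\<bar>?l n - ?m n\<bar> < e * ?m n" using a by (simp add: abs_less_iff)
      moreover have "?l n / ?m n - 1 = (?l n - ?m n) / ?m n" using m by (simp add: diff_divide_distrib)
      ultimately show ?thesis using m by (simp add: pos_divide_less_eq)
    qed
    then show "\<exists>no. \<forall>n\<ge>no. norm (?l n / ?m n - 1) < e" by blast
  qed
qed

end

end

theorem theorem1p1:
  fixes E :: "'v::countable \<Rightarrow> 'v \<Rightarrow> bool" and q :: "'v \<Rightarrow> real" and k :: real
  assumes "locally_finite_graph E"
    and "0 \<le> k"
    and "k_sparse k E"
    and "\<forall>v. 0 \<le> q v"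
  shows "(\<forall>\<epsilon>::real. 0 < \<epsilon> \<and> \<epsilon> \<le> 1 \<longrightarrow>
            op_le_on Cc
              (mult_op (\<lambda>v. (1 - \<epsilon>) * (deg E v + q v) - k / 2 * (1 / \<epsilon> - \<epsilon>)))
              (schroedinger_op E q) \<and>
            op_le_on Cc
              (schroedinger_op E q)
              (mult_op (\<lambda>v. (1 + \<epsilon>) * (deg E v + q v) + k / 2 * (1 / \<epsilon> - \<epsilon>))))
       \<and> Domain (sqrt_op (schroedinger_op E q)) = Domain (sqrt_op (mult_op (\<lambda>v. deg E v + q v)))
       \<and> (purely_discrete_spectrum (schroedinger_op E q) \<longleftrightarrow>
            liminf_at_infinity (\<lambda>v. deg E v + q v) = \<infinity>)
       \<and> (purely_discrete_spectrum (schroedinger_op E q) \<and> infinite (UNIV :: 'v set) \<longrightarrow>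
            liminf (\<lambda>n. ereal (nth_eigenvalue (schroedinger_op E q) n
                              / nth_eigenvalue (mult_op (\<lambda>v. deg E v + q v)) n)) = 1)"
proof -
  interpret sparse_graph_potential E q k
    using assms by unfold_locales auto
  have g: "(\<lambda>v. deg E v + q v) = g" by (simp add: fun_eq_iff g_def)
  show ?thesis
  proof (intro conjI)
    show "\<forall>\<epsilon>::real. 0 < \<epsilon> \<and> \<epsilon> \<le> 1 \<longrightarrow>
            op_le_on Cc
              (mult_op (\<lambda>v. (1 - \<epsilon>) * (deg E v + q v) - k / 2 * (1 / \<epsilon> - \<epsilon>)))
              (schroedinger_op E q) \<and>
            op_le_on Cc
              (schroedinger_op E q)
              (mult_op (\<lambda>v. (1 + \<epsilon>) * (deg E v + q v) + k / 2 * (1 / \<epsilon> - \<epsilon>)))"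
      using form_bounds[OF sparse] by blast
    show "Domain (sqrt_op T) = Domain (sqrt_op (mult_op (\<lambda>v. deg E v + q v)))"
      unfolding g by (rule Domain_sqrt_op_eq)
    show "purely_discrete_spectrum T \<longleftrightarrow> liminf_at_infinity (\<lambda>v. deg E v + q v) = \<infinity>"
      unfolding g liminf_at_infinity_eq_infty_iff by (rule purely_discrete_iff)
    show "purely_discrete_spectrum T \<and> infinite (UNIV :: 'v set) \<longrightarrow>
        liminf (\<lambda>n. ereal (nth_eigenvalue T n / nth_eigenvalue (mult_op (\<lambda>v. deg E v + q v)) n)) = 1"
      unfolding g mult_op_eq_schroedinger_op one_ereal_def
      by (intro impI lim_imp_Liminf tendsto_ereal eigenvalue_ratio_tendsto) auto
  qed
qed

end
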